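(* Let $d\ge2$ and $\Sigma_\mu,\Sigma_\nu\in\mathcal S_d^+$ with $\Sigma_\nu$ of rank $d'\in\{1,\dots,d-1\}$, so that $\Sigma_\nu=O\,\mathrm{diag}(\lambda_1,\dots,\lambda_{d'},0,\dots,0)\,O^*$ for some $\lambda_1,\dots,\lambda_{d'}>0$ and some $O\in\mathcal O_d$. Let $\Gamma\in\mathcal S_{d'}^+$ denote the covariance matrix of $\mathcal J_2\big(\mathcal N_{d'}(0,\mathrm{diag}(\lambda_1,\dots,\lambda_{d'})),\mathcal N_{d'}(0,(O^*\Sigma_\mu O)_{1:d',1:d'})\big)$, and let $\Sigma_\star\in\mathbb R^{d\times d}$ denote the matrix such that $(O^*\Sigma_\star O)_{1:d',1:d'}=\Gamma$ and all other entries of $O^*\Sigma_\star O$ are equal to those of $O^*\Sigma_\mu O$. Let $g:\mathbb R^d\to\mathbb R^{d'}$ be defined by $g(x)=(O^* )_{1:d',1:d}\,x$. Then $\eta_\star$ is a $\mathcal W_2$-projection of $\mathcal N_d(0,\Sigma_\nu)$ on the set of distributions dominating $\mathcal N_d(0,\Sigma_\mu)$ in the convex order if and only if the covariance matrix of $\eta_\star$ is $\Sigma_\star$, $g\#\eta_\star=\mathcal N_{d'}(0,\Gamma)$ and $\mathcal N_d(0,\Sigma_\mu)\le_{cx}\eta_\star$. The distribution $\mathcal N_d(0,\Sigma_\star)$ is one of these projections and is thus the unique projection among Gaussian distributions. Moreover, $\Sigma_\star$ is the unique minimizer of $$\inf_{\Sigma\in\mathcal S_d^+:\,\Sigma_\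mu\le\Sigma}\operatorname{tr}\left(\Sigma-2(\Sigma_\nu^{1/2}\Sigma\Sigma_\nu^{1/2})^{1/2}\right).$$
   Context: $\mathcal S_d^+$ is the set of real symmetric positive semi-definite $d\times d$ matrices, $\mathcal O_d$ the group of $d\times d$ orthogonal matrices, $O^*$ the transpose, and $\le$ between symmetric matrices is the positive semi-definite (Loewner) order. For a matrix $M$, $(M)_{i_1:i_2,j_1:j_2}$ is the submatrix of rows $i_1,\dots,i_2$ and columns $j_1,\dots,j_2$. $\mathcal N_d(m,\Sigma)$ is the (possibly degenerate) Gaussian distribution on $\mathbb R^d$. $g\#\eta$ is the image (pushforward) of $\eta$ by $g$. $\mathcal P_2(\mathbb R^d)$ is the set of probability measures with finite second moment and $\mathcal W_2$ the quadratic Wasserstein distance. The convex order is defined by $\mu\le_{cx}\nu$ iff $\int f\,d\mu\le\int f\,d\nu$ for every convex $f$. A $\mathcal W_2$-projection of $\nu$ on the set of distributions dominating $\mu$ in the convex order is a minimizer of $\eta\mapsto\mathcal W_2(\nu,\eta)$ over $\{\eta\in\mathcal P_2(\mathbb R^d):\mu\le_{cx}\eta\}$; when $\nu$ is absolutely continuous with respect to the Lebesgue measure it is known to exist and be unique and is denoted $\mathcal J_2(\nu,\mu)$ (this applies in dimension $d'$ to $\nu=\mathcal N_{d'}(0,\mathrm{diag}(\lambda_1,\dots,\lambda_{d'}))$). *)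

theory Defs
  imports "HOL-Probability.Probability"
begin

section \<open>Matrices\<close>

definition psd :: "real^'n^'n \<Rightarrow> bool" where
  "psd A \<longleftrightarrow> transpose A = A \<and> (\<forall>x. 0 \<le> x \<bullet> (A *v x))"

text \<open>The order is only meant to be used between symmetric matrices.\<close>

definition loewner_le :: "real^'n^'n \<Rightarrow> real^'n^'n \<Rightarrow> bool" where
  "loewner_le A B \<longleftrightarrow> psd (B - A)"

text \<open>The square root of a positive semi-definite matrix; unspecified for other matrices.\<close>

definition matrix_sqrt :: "real^'n^'n \<Rightarrow> real^'n^'n" where
  "matrix_sqrt A = (THE R. psd R \<and> R ** R = A)"

definition diag_matrix :: "real^'n \<Rightarrow> real^'n^'n" where
  "diag_matrix v = (\<chi> i j. if i = j then v $ i else 0)"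

text \<open>
  Coordinates of a vector are indexed by finite types, which carry no canonical order. Blocks are
  therefore selected by maps between index types: a selection of \<open>d'\<close> of the \<open>d\<close> coordinates is an
  injection \<open>e :: 'm \<Rightarrow> 'n\<close> with \<open>CARD('m) = d'\<close> and \<open>CARD('n) = d\<close>. With the coordinates listed so
  that \<open>range e\<close> comes first, \<open>submatrix e e A\<close> is the block of rows and columns \<open>1, \<dots>, d'\<close>,
  \<open>submatrix e id A\<close> consists of the first \<open>d'\<close> rows, and \<open>zero_pad e v\<close> is
  \<open>(v\<^sub>1, \<dots>, v\<^sub>d\<^sub>', 0, \<dots>, 0)\<close>.
\<close>

definition submatrix :: "('p \<Rightarrow> 'm) \<Rightarrow> ('q \<Rightarrow> 'n) \<Rightarrow> real^'n^'m \<Rightarrow> real^'q^'p" where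
  "submatrix r c A = (\<chi> i j. A $ r i $ c j)"

definition zero_pad :: "('m \<Rightarrow> 'n) \<Rightarrow> real^'m \<Rightarrow> real^'n" where
  "zero_pad e v = (\<chi> k. if k \<in> range e then v $ inv e k else 0)"


section \<open>Probability measures with finite second moment\<close>

definition P2 :: "'a::euclidean_space measure set" where
  "P2 = {\<eta>. prob_space \<eta> \<and> sets \<eta> = sets borel \<and> integrable \<eta> (\<lambda>x. (norm x)\<^sup>2)}"

definition covariance_matrix :: "(real^'n) measure \<Rightarrow> real^'n^'n" where
  "covariance_matrix \<eta> =
    (\<chi> i j. \<integral>x. (x $ i - (\<integral>y. y $ i \<partial>\<eta>)) * (x $ j - (\<integral>y. y $ j \<partial>\<eta>)) \<partial>\<eta>)"

text \<open>
  The possibly degenerate Gaussian distribution with mean \<open>m\<close> and positive semi-definite covariance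
  matrix \<open>S\<close>, as an affine image of the standard Gaussian distribution.
\<close>

definition std_gaussian :: "(real^'n) measure" where
  "std_gaussian = density lborel (\<lambda>x. ennreal (\<Prod>i\<in>UNIV. std_normal_density (x $ i)))"

definition gaussian :: "real^'n \<Rightarrow> real^'n^'n \<Rightarrow> (real^'n) measure" where
  "gaussian m S = distr std_gaussian borel (\<lambda>x. m + matrix_sqrt S *v x)"


section \<open>Convex order and Wasserstein distance\<close>

text \<open>
  A convex function need not be integrable for a measure in \<open>P2\<close>, in which case the Bochner integral
  would be \<open>0\<close>. However it is bounded below by an affine function, so its negative part has a
  finite integral and its integral is a well-defined element of \<open>(-\<infinity>, \<infinity>]\<close>.
\<close>

definition extended_integral :: "'a measure \<Rightarrow> ('a \<Rightarrow> real) \<Rightarrow> ereal" where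
  "extended_integral M f =
    enn2ereal (\<integral>\<^sup>+x. ennreal (f x) \<partial>M) - enn2ereal (\<integral>\<^sup>+x. ennreal (- f x) \<partial>M)"

definition convex_order :: "'a::euclidean_space measure \<Rightarrow> 'a measure \<Rightarrow> bool" where
  "convex_order \<mu> \<nu> \<longleftrightarrow>
    (\<forall>f. convex_on UNIV f \<longrightarrow> extended_integral \<mu> f \<le> extended_integral \<nu> f)"

definition couplings ::
  "'a::euclidean_space measure \<Rightarrow> 'a measure \<Rightarrow> ('a \<times> 'a) measure set" where
  "couplings \<mu> \<nu> =
    {\<pi>. prob_space \<pi> \<and> sets \<pi> = sets borel \<and> distr \<pi> borel fst = \<mu> \<and> distr \<pi> borel snd = \<nu>}"

text \<open>The infimum is finite whenever both measures are in \<open>P2\<close>.\<close>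

definition W2 :: "'a::euclidean_space measure \<Rightarrow> 'a measure \<Rightarrow> real" where
  "W2 \<mu> \<nu> =
    sqrt (enn2real (INF \<pi>\<in>couplings \<mu> \<nu>. \<integral>\<^sup>+z. ennreal ((dist (fst z) (snd z))\<^sup>2) \<partial>\<pi>))"

definition is_W2_projection ::
  "'a::euclidean_space measure \<Rightarrow> 'a measure \<Rightarrow> 'a measure \<Rightarrow> bool" where
  "is_W2_projection \<nu> \<mu> = is_arg_min (W2 \<nu>) (\<lambda>\<eta>. \<eta> \<in> P2 \<and> convex_order \<mu> \<eta>)"

text \<open>Meaningful when the projection is unique, in particular for absolutely continuous \<open>\<nu>\<close>.\<close>

definition J2 :: "'a::euclidean_space measure \<Rightarrow> 'a measure \<Rightarrow> 'a measure" where
  "J2 \<nu> \<mu> = (THE \<eta>. is_W2_projection \<nu> \<mu> \<eta>)"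

end

theory Submission
  imports Defs
begin

text \<open>
  Let \<open>G\<close> consist of the first \<open>d'\<close> rows of \<open>O\<^sup>*\<close>, \<open>\<Lambda> = diag(\<lambda>)\<close>, so that \<open>\<Sigma>\<^sub>\<nu> = G\<^sup>* \<Lambda> G\<close>, and let
  \<open>A = G \<Sigma>\<^sub>\<mu> G\<^sup>*\<close>. Minimizing \<open>tr(M\<^sup>-\<^sup>1 \<Lambda>) + tr(M A)\<close> over \<open>0 < M \<le> I\<close> gives \<open>M\<close> and \<open>T = M\<^sup>-\<^sup>1\<close> with \<open>A \<le> T \<Lambda> T\<close> and
  \<open>tr((I - M)(T \<Lambda> T - A)) = 0\<close>. The cost of a coupling \<open>(X, Y)\<close> of \<open>N(0, \<Sigma>\<^sub>\<nu>)\<close> with a dominating distribution is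
  then a constant plus \<open>tr(P (Cov Y - \<Sigma>\<^sub>\<mu>))\<close> plus the expectation of
  \<open>(G Y - T G X) \<bullet> M (G Y - T G X)\<close>, where \<open>P = I - G\<^sup>* M G\<close> is positive semi-definite. The last two terms are
  nonnegative. They vanish along near-optimal couplings iff \<open>G Y\<close> has the law \<open>N(0, T \<Lambda> T)\<close> and \<open>Cov Y = \<Sigma>\<^sub>\<star>\<close>
  with \<open>\<Gamma> = T \<Lambda> T\<close>. The case \<open>G = I\<close> identifies \<open>J\<^sub>2\<close>, and the same \<open>M\<close>, \<open>T\<close> and \<open>P\<close> solve the trace problem.
\<close>


section \<open>Matrix algebra and the spectral theorem\<close>

text \<open>For \<open>x\<close> in the support of \<open>N(0, \<Sigma>\<^sub>\<nu>)\<close>,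
  \<open>a = G x\<close> and \<open>b = G y\<close>, the product \<open>x . y\<close> equals
  \<open>a . b\<close>, and completing the square with any positive definite \<open>M\<close> with
  inverse \<open>T\<close> gives
  \<open>2 a . b = a . T a + b . M b - (b - T a) . M (b - T a)\<close>. Each such \<open>M\<close>
  thus bounds the cost from below by second moments alone, and \<open>M <= I\<close> is exactly what
  makes \<open>P\<close> positive semi-definite, so that \<open>Cov Y\<close> may be replaced by
  \<open>\<Sigma>\<^sub>\<mu>\<close>. The resulting bound is
  \<open>tr \<Lambda> + tr \<Sigma>\<^sub>\<mu>\<close> minus the function minimized over
  \<open>M\<close>: the minimization selects the best lower bound, and the two conditions on
  \<open>T\<close> are its first-order conditions. The obstacle is degeneracy. The cost sees the
  component of \<open>Y\<close> in the kernel of \<open>G\<close> only through its second moment, so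
  the law of \<open>Y\<close> is not determined. The covariance is, because \<open>P\<close> is the
  identity on that kernel and a positive semi-definite \<open>Cov Y - \<Sigma>\<^sub>\<mu>\<close>
  of zero trace against \<open>P\<close> must vanish there.\<close>

lemma transpose_add: "transpose (A + B) = transpose A + transpose (B :: 'a::plus^'n^'m)"
  and transpose_diff: "transpose (C - D) = transpose C - transpose (D :: 'b::minus^'n^'m)"
  by (simp_all add: transpose_def vec_eq_iff)

lemma matrix_diff_ldistrib: "A ** (B - C) = A ** B - A ** (C :: 'a::ring_1^'p^'n)"
  by (vector matrix_matrix_mult_def sum_subtractf[symmetric] algebra_simps)

lemma matrix_diff_rdistrib: "(A - B) ** C = A ** C - B ** (C :: 'a::ring_1^'p^'n)"
  by (vector matrix_matrix_mult_def sum_subtractf[symmetric] algebra_simps)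

lemma matrix_add_rdistrib: "(A + B) ** C = A ** C + B ** (C :: 'a::ring_1^'p^'n)"
  by (vector matrix_matrix_mult_def sum.distrib[symmetric] algebra_simps)

lemma trace_scaleR: "trace (c *\<^sub>R A) = c * trace (A :: real^'n^'n)"
  by (simp add: trace_def sum_distrib_left)

lemma continuous_on_matrix_mult [continuous_intros]:
  fixes f :: "'a::topological_space \<Rightarrow> real^'n^'m" and g :: "'a \<Rightarrow> real^'p^'n"
  shows "continuous_on S f \<Longrightarrow> continuous_on S g \<Longrightarrow> continuous_on S (\<lambda>x. f x ** g x)"
  unfolding matrix_matrix_mult_def by (intro continuous_intros)

lemma continuous_on_matrix_vector_mult [continuous_intros]:
  fixes f :: "'a::topological_space \<Rightarrow> real^'n^'m" and g :: "'a \<Rightarrow> real^'n"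
  shows "continuous_on S f \<Longrightarrow> continuous_on S g \<Longrightarrow> continuous_on S (\<lambda>x. f x *v g x)"
  unfolding matrix_vector_mult_def by (intro continuous_intros)

lemma continuous_on_trace [continuous_intros]:
  fixes f :: "'a::topological_space \<Rightarrow> real^'n^'n"
  shows "continuous_on S f \<Longrightarrow> continuous_on S (\<lambda>x. trace (f x))"
  unfolding trace_def by (intro continuous_intros)

lemma continuous_on_transpose [continuous_intros]:
  fixes f :: "'a::topological_space \<Rightarrow> real^'n^'m"
  shows "continuous_on S f \<Longrightarrow> continuous_on S (\<lambda>x. transpose (f x))"
  unfolding transpose_def by (intro continuous_intros)

lemma inner_matrix_vector_mult:
  fixes A :: "real^'n^'m"
  shows "x \<bullet> (A *v y) = (transpose A *v x) \<bullet> y"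
  by (simp add: dot_lmul_matrix)

lemma inner_matrix_vector_commute:
  fixes A :: "real^'n^'n"
  assumes "transpose A = A"
  shows "x \<bullet> (A *v y) = y \<bullet> (A *v x)"
  using assms inner_matrix_vector_mult[of x A y] by (simp add: inner_commute del: transpose_matrix_vector)

lemma matrix_eq_0_iff: "(A :: real^'n^'m) = 0 \<longleftrightarrow> (\<forall>x. A *v x = 0)"
  by (metis matrix_eq matrix_vector_mult_0)

text \<open>A maximizer \<open>w\<close> of the quadratic form on the unit sphere of the orthogonal
  complement of \<open>B\<close> is an eigenvector. The complement is invariant because
  \<open>A\<close> is symmetric and \<open>B\<close> consists of eigenvectors, so the residual
  \<open>A w - c w\<close> lies in it and is itself an admissible direction of variation.\<close>

lemma symmetric_matrix_eigenvector_in_complement: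
  fixes A :: "real^'n^'n"
  assumes sym: "transpose A = A" and eig: "\<forall>b\<in>B. \<exists>c. A *v b = c *\<^sub>R b"
    and z: "z \<noteq> 0" "\<And>b. b \<in> B \<Longrightarrow> b \<bullet> z = 0"
  obtains w c where "norm w = 1" "\<And>b. b \<in> B \<Longrightarrow> b \<bullet> w = 0" "A *v w = c *\<^sub>R w"
proof -
  let ?W = "{x. \<forall>b\<in>B. b \<bullet> x = 0}"
  have AW: "A *v x \<in> ?W" if "x \<in> ?W" for x
  proof -
    have "b \<bullet> (A *v x) = 0" if "b \<in> B" for b
    proof -
      obtain c where "A *v b = c *\<^sub>R b" using eig \<open>b \<in> B\<close> by blast
      then show ?thesis
        using \<open>x \<in> ?W\<close> \<open>b \<in> B\<close> inner_matrix_vector_commute[OF sym, of b x]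
        by (simp add: inner_commute)
    qed
    then show ?thesis by blast
  qed
  have clW: "closed ?W"
    unfolding Ball_def by (intro closed_Collect_all closed_Collect_imp open_Collect_const closed_Collect_eq continuous_intros)
  let ?K = "?W \<inter> sphere 0 1"
  have "compact ?K" using clW by (simp add: closed_Int_compact)
  moreover have "z /\<^sub>R norm z \<in> ?K" using z by simp
  moreover have "continuous_on ?K (\<lambda>x. x \<bullet> (A *v x))" by (intro continuous_intros)
  ultimately obtain w where w: "w \<in> ?K" and mx: "\<And>y. y \<in> ?K \<Longrightarrow> y \<bullet> (A *v y) \<le> w \<bullet> (A *v w)"
    using continuous_attains_sup[of ?K "\<lambda>x. x \<bullet> (A *v x)"] by blast
  define c where "c = w \<bullet> (A *v w)"
  have bound: "y \<bullet> (A *v y) \<le> c * (y \<bullet> y)" if "y \<in> ?W" for y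
  proof (cases "y = 0")
    case False
    have "y /\<^sub>R norm y \<in> ?K" using that False by simp
    from mx[OF this] have "(y \<bullet> (A *v y)) / (norm y)\<^sup>2 \<le> c"
      by (simp add: c_def matrix_vector_mult_scaleR power2_eq_square field_simps)
    then show ?thesis using False by (simp add: pos_divide_le_eq power2_norm_eq_inner)
  qed simp
  define v where "v = A *v w - c *\<^sub>R w"
  have vW: "v \<in> ?W" using w AW[of w] by (simp add: v_def inner_diff_right)
  have ww: "w \<bullet> w = 1" using w by (simp add: norm_eq_1)
  \<comment> \<open>The bound at \<open>w + t v\<close>: the terms of order 0 and those with
    \<open>v . w\<close> cancel, which leaves \<open>v . v\<close> as the only first-order
    coefficient.\<close>
  have *: "2 * t * (v \<bullet> v) \<le> t\<^sup>2 * (c * (v \<bullet> v) - v \<bullet> (A *v v))" for t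
  proof -
    have in_W: "w + t *\<^sub>R v \<in> ?W" using vW w by (simp add: inner_add_right)
    have quad: "(w + t *\<^sub>R v) \<bullet> (A *v (w + t *\<^sub>R v))
        = c + 2 * t * (v \<bullet> (A *v w)) + t\<^sup>2 * (v \<bullet> (A *v v))"
      using inner_matrix_vector_commute[OF sym, of w v]
      by (simp add: matrix_vector_right_distrib matrix_vector_mult_scaleR inner_add_left
          inner_add_right c_def power2_eq_square distrib_left mult.assoc)
    have sq: "(w + t *\<^sub>R v) \<bullet> (w + t *\<^sub>R v) = 1 + 2 * t * (v \<bullet> w) + t\<^sup>2 * (v \<bullet> v)"
      using ww inner_commute[of w v]
      by (simp add: inner_add_left inner_add_right power2_eq_square distrib_left mult.assoc)
    have "c + 2 * t * (v \<bullet> (A *v w)) + t\<^sup>2 * (v \<bullet> (A *v v))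
        \<le> c * (1 + 2 * t * (v \<bullet> w) + t\<^sup>2 * (v \<bullet> v))"
      using bound[OF in_W] unfolding quad sq .
    moreover have "v \<bullet> (A *v w) = v \<bullet> v + c * (v \<bullet> w)"
      using inner_add_right[of v v "c *\<^sub>R w"] by (simp add: v_def)
    ultimately show ?thesis by (simp add: algebra_simps)
  qed
  have "v \<bullet> v = 0"
  proof (rule ccontr)
    assume "v \<bullet> v \<noteq> 0"
    then have pos: "v \<bullet> v > 0" using inner_ge_zero[of v] by linarith
    \<comment> \<open>With \<open>t = (v . v) / D\<close> the right side of \<open>*\<close> is at
      most \<open>t (v . v)\<close>, half of the left side; the summand 1 keeps \<open>D\<close>
      positive.\<close>
    let ?D = "\<bar>c * (v \<bullet> v) - v \<bullet> (A *v v)\<bar> + 1"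
    let ?t = "(v \<bullet> v) / ?D"
    have "?D > 0" "?t > 0" using pos by (auto intro!: divide_pos_pos)
    have "2 * ?t * (v \<bullet> v) \<le> ?t\<^sup>2 * ?D"
      using *[of ?t] by (rule order_trans) (intro mult_left_mono, auto)
    also have "\<dots> = ?t * (v \<bullet> v)"
      using \<open>?D > 0\<close> by (simp add: power2_eq_square)
    finally have "?t * (v \<bullet> v) \<le> 0" by argo
    with mult_pos_pos[OF \<open>?t > 0\<close> pos] show False by linarith
  qed
  then have "A *v w = c *\<^sub>R w" by (simp add: v_def)
  with w that[of w c] show ?thesis by simp
qed

lemma symmetric_matrix_eigenbasis:
  fixes A :: "real^'n^'n"
  assumes sym: "transpose A = A"
  obtains B where "finite B" "pairwise orthogonal B" "\<And>b. b \<in> B \<Longrightarrow> norm b = 1"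
    "span B = UNIV" "\<And>b. b \<in> B \<Longrightarrow> \<exists>c. A *v b = c *\<^sub>R b"
proof -
  let ?P = "\<lambda>B. finite B \<and> pairwise orthogonal B \<and> (\<forall>b\<in>B. norm b = 1) \<and> (\<forall>b\<in>B. \<exists>c. A *v b = c *\<^sub>R b)"
  have indep: "independent B" if "?P B" for B
    using that pairwise_orthogonal_independent[of B] by force
  have "\<exists>B. ?P B \<and> card B = k" if "k \<le> CARD('n)" for k
    using that
  proof (induction k)
    case 0
    show ?case by (rule exI[of _ "{}"]) simp
  next
    case (Suc k)
    then obtain B where B: "?P B" "card B = k" by auto
    have "dim B = k" using B indep dim_eq_card_independent by blast
    then have "span B \<subset> UNIV"
      using Suc.prems dim_eq_full[of B] by auto
    then obtain z where z: "z \<noteq> 0" "\<And>y. y \<in> span B \<Longrightarrow> orthogonal z y"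
      using orthogonal_to_subspace_exists_gen[of B UNIV] by auto
    have z': "\<And>b. b \<in> B \<Longrightarrow> b \<bullet> z = 0"
      using z(2) span_base by (auto simp: orthogonal_def inner_commute)
    obtain w c where w: "norm w = 1" "\<And>b. b \<in> B \<Longrightarrow> b \<bullet> w = 0" "A *v w = c *\<^sub>R w"
      using symmetric_matrix_eigenvector_in_complement[OF sym _ z(1) z', of B] B by auto
    have "w \<notin> B" using w by fastforce
    then have "?P (insert w B) \<and> card (insert w B) = Suc k"
      using B w by (auto simp: pairwise_insert orthogonal_def inner_commute)
    then show ?case by blast
  qed
  then obtain B where B: "?P B" "card B = CARD('n)" by blast
  then have "dim B = CARD('n)" using indep dim_eq_card_independent by metis
  then have "span B = UNIV" using dim_eq_full[of B] by simp
  with B that show ?thesis by blast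
qed

text \<open>\<open>F f\<close> multiplies each vector of an orthonormal eigenbasis by the value of
  \<open>f\<close> at its eigenvalue. Square roots, pseudo-inverses and support projections then
  come with all their product relations, as pointwise identities. The last clause holds because a
  positive semi-definite matrix has nonnegative eigenvalues.\<close>

lemma symmetric_matrix_functional_calculus:
  fixes A :: "real^'n^'n"
  assumes sym: "transpose A = A"
  obtains F :: "(real \<Rightarrow> real) \<Rightarrow> real^'n^'n" where
    "\<And>f. transpose (F f) = F f" "\<And>f g. F f ** F g = F (\<lambda>x. f x * g x)"
    "F (\<lambda>_. 1) = mat 1" "F (\<lambda>x. x) = A"
    "\<And>f g. psd A \<Longrightarrow> (\<And>x. x \<ge> 0 \<Longrightarrow> f x = g x) \<Longrightarrow> F f = F g"
proof -
  obtain B where B: "finite B" "pairwise orthogonal B" "\<And>b. b \<in> B \<Longrightarrow> norm b = 1"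
    "span B = UNIV" "\<And>b. b \<in> B \<Longrightarrow> \<exists>c. A *v b = c *\<^sub>R b"
    using symmetric_matrix_eigenbasis[OF sym] by metis
  from B(5) obtain c where c: "\<And>b. b \<in> B \<Longrightarrow> A *v b = c b *\<^sub>R b" by metis
  define L where "L f x = (\<Sum>b\<in>B. (f (c b) * (x \<bullet> b)) *\<^sub>R b)" for f :: "real \<Rightarrow> real" and x
  define F where "F f = matrix (L f)" for f
  have lin: "linear (L f)" for f
    by (rule linearI) (auto simp: L_def inner_add_left algebra_simps sum.distrib scaleR_sum_right)
  have F: "F f *v x = L f x" for f x
    unfolding F_def using matrix_vector_mul(2)[OF lin[of f]] by metis
  have expand: "(\<Sum>b\<in>B. (x \<bullet> b) *\<^sub>R b) = x" for x
    using orthonormal_basis_expand[OF B(2,3) _ B(1)] B(4) by simp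
  have bb: "b \<bullet> b' = (if b = b' then 1 else 0)" if "b \<in> B" "b' \<in> B" for b b'
    using B(2,3) that by (auto simp: pairwise_def orthogonal_def norm_eq_1)
  have Lb: "L f x \<bullet> b = f (c b) * (x \<bullet> b)" if "b \<in> B" for f x b
    using that B(1) by (simp add: L_def inner_sum_left bb if_distrib[where f="\<lambda>u. _ * u"]
        cong: if_cong)
  show ?thesis
  proof
    fix f g
    show "transpose (F f) = F f"
    proof (subst matrix_eq, rule allI, rule vector_eq_rdot[THEN iffD1], rule allI)
      fix x y
      have "(transpose (F f) *v x) \<bullet> y = x \<bullet> (F f *v y)"
        by (rule inner_matrix_vector_mult[symmetric])
      also have "\<dots> = (F f *v x) \<bullet> y"
        by (simp add: F L_def inner_sum_left inner_sum_right)
          (simp add: inner_commute mult.commute mult.left_commute)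
      finally show "(transpose (F f) *v x) \<bullet> y = (F f *v x) \<bullet> y" .
    qed
    show "F f ** F g = F (\<lambda>x. f x * g x)"
      by (simp add: matrix_eq matrix_vector_mul_assoc[symmetric] F)
        (simp add: L_def[of f] Lb, simp add: L_def mult.assoc)
  next
    show "F (\<lambda>_. 1) = mat 1" by (simp add: matrix_eq F L_def expand)
    show "F (\<lambda>x. x) = A"
    proof (subst matrix_eq, rule allI)
      fix x
      have "A *v x = (\<Sum>b\<in>B. (x \<bullet> b) *\<^sub>R (A *v b))"
        by (subst expand[of x, symmetric]) (simp add: matrix_vector_mult_scaleR linear_sum[OF matrix_vector_mul_linear])
      then show "F (\<lambda>x. x) *v x = A *v x" by (simp add: F L_def c mult.commute)
    qed
  next
    fix f g :: "real \<Rightarrow> real" assume "psd A" and fg: "\<And>x. x \<ge> 0 \<Longrightarrow> f x = g x"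
    have "c b \<ge> 0" if "b \<in> B" for b
    proof -
      have "0 \<le> b \<bullet> (A *v b)" using \<open>psd A\<close> by (simp add: psd_def)
      then show ?thesis using that bb by (simp add: c)
    qed
    then have "L f = L g" using fg by (auto simp: L_def fun_eq_iff intro!: sum.cong)
    then show "F f = F g" by (simp add: F_def)
  qed
qed


section \<open>Positive semi-definite matrices\<close>

lemma psdD: "psd A \<Longrightarrow> transpose A = A" "psd A \<Longrightarrow> 0 \<le> x \<bullet> (A *v x)"
  by (simp_all add: psd_def)

lemma psd_congruence:
  assumes "psd A"
  shows "psd (X ** A ** transpose X)"
  unfolding psd_def
proof (intro conjI allI)
  show "transpose (X ** A ** transpose X) = X ** A ** transpose X"
    using psdD(1)[OF assms] by (simp add: matrix_transpose_mul matrix_mul_assoc)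
  fix x
  have "x \<bullet> ((X ** A ** transpose X) *v x) = x \<bullet> (X *v (A *v (transpose X *v x)))"
    by (simp only: matrix_vector_mul_assoc matrix_mul_assoc)
  also have "\<dots> = (transpose X *v x) \<bullet> (A *v (transpose X *v x))"
    by (rule inner_matrix_vector_mult)
  finally show "0 \<le> x \<bullet> ((X ** A ** transpose X) *v x)"
    using psdD(2)[OF assms] by metis
qed

lemma psd_mat_1: "psd (mat 1)"
  by (simp add: psd_def)

lemma psd_0: "psd 0"
  by (simp add: psd_def transpose_def vec_eq_iff)

lemma psd_mult_transpose: "psd (X ** transpose X)"
  using psd_congruence[OF psd_mat_1, of X] by simp

lemma psd_add: "psd A \<Longrightarrow> psd B \<Longrightarrow> psd (A + B)"
  by (simp add: psd_def transpose_add matrix_vector_mult_add_rdistrib inner_add_right)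

lemma psd_scaleR: "psd A \<Longrightarrow> c \<ge> 0 \<Longrightarrow> psd (c *\<^sub>R A)"
  by (simp add: psd_def transpose_scalar scaleR_matrix_vector_assoc[symmetric])

lemma psd_diag_matrix:
  assumes "\<And>i. v $ i \<ge> 0"
  shows "psd (diag_matrix v)"
proof -
  have "diag_matrix v *v x = (\<chi> i. v $ i * x $ i)" for x
    by (simp add: diag_matrix_def matrix_vector_mult_def if_distrib[where f="\<lambda>u. u * _"] cong: if_cong)
  then have "x \<bullet> (diag_matrix v *v x) = (\<Sum>i\<in>UNIV. v $ i * (x $ i * x $ i))" for x
    by (simp add: inner_vec_def mult.left_commute)
  then have "0 \<le> x \<bullet> (diag_matrix v *v x)" for x
    using assms by (simp add: sum_nonneg)
  moreover have "transpose (diag_matrix v) = diag_matrix v"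
    by (simp add: transpose_def diag_matrix_def vec_eq_iff)
  ultimately show ?thesis by (simp add: psd_def)
qed

text \<open>Product relations need checking at nonnegative arguments only;
  \<open>sqrt x * sqrt x = x\<close>, for instance, fails at negative ones.\<close>

lemma psd_functional_calculus:
  fixes A :: "real^'n^'n"
  assumes "psd A"
  obtains F :: "(real \<Rightarrow> real) \<Rightarrow> real^'n^'n" where
    "\<And>f. transpose (F f) = F f"
    "\<And>f g h. (\<And>x. x \<ge> 0 \<Longrightarrow> f x * g x = h x) \<Longrightarrow> F f ** F g = F h"
    "F (\<lambda>_. 1) = mat 1" "F (\<lambda>x. x) = A"
proof (rule symmetric_matrix_functional_calculus[OF psdD(1)[OF assms]])
  fix F :: "(real \<Rightarrow> real) \<Rightarrow> real^'n^'n"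
  assume F: "\<And>f. transpose (F f) = F f" "\<And>f g. F f ** F g = F (\<lambda>x. f x * g x)"
      "F (\<lambda>_. 1) = mat 1" "F (\<lambda>x. x) = A"
      "\<And>f g. psd A \<Longrightarrow> (\<And>x. x \<ge> 0 \<Longrightarrow> f x = g x) \<Longrightarrow> F f = F g"
  show thesis
  proof (rule that[of F])
    fix f g h :: "real \<Rightarrow> real"
    assume "\<And>x. x \<ge> 0 \<Longrightarrow> f x * g x = h x"
    then show "F f ** F g = F h" unfolding F(2) by (rule F(5)[OF assms])
  qed (fact F(1) F(3) F(4))+
qed

lemma psd_sqrt_exists:
  fixes A :: "real^'n^'n"
  assumes A: "psd A"
  obtains R where "psd R" "R ** R = A"
proof (rule psd_functional_calculus[OF A])
  fix F :: "(real \<Rightarrow> real) \<Rightarrow> real^'n^'n"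
  assume F: "\<And>f. transpose (F f) = F f"
    "\<And>f g h. (\<And>x. x \<ge> 0 \<Longrightarrow> f x * g x = h x) \<Longrightarrow> F f ** F g = F h" "F (\<lambda>x. x) = A"
  \<comment> \<open>The fourth root exhibits \<open>F sqrt\<close> as the square of a symmetric
    matrix, hence as positive semi-definite.\<close>
  have "F (\<lambda>x. sqrt (sqrt x)) ** F (\<lambda>x. sqrt (sqrt x)) = F sqrt"
    by (rule F(2)) simp
  then have "psd (F sqrt)"
    using psd_mult_transpose[of "F (\<lambda>x. sqrt (sqrt x))"] F(1) by simp
  moreover have "F sqrt ** F sqrt = F (\<lambda>x. x)" by (rule F(2)) simp
  ultimately show thesis using that[of "F sqrt"] F(3) by simp
qed

text \<open>With a square root \<open>R\<close> of \<open>A\<close>, the form at \<open>x\<close> is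
  the squared norm of \<open>R x\<close>.\<close>

lemma psd_null_vector:
  assumes A: "psd A" and x: "x \<bullet> (A *v x) = 0"
  shows "A *v x = 0"
proof -
  obtain R where R: "psd R" "R ** R = A" using psd_sqrt_exists[OF A] .
  have "(R *v x) \<bullet> (R *v x) = x \<bullet> (R *v (R *v x))"
    using inner_matrix_vector_mult[of x R "R *v x"] psdD(1)[OF R(1)] by simp
  then have "R *v x = 0" using x by (simp add: matrix_vector_mul_assoc R)
  then have "R *v (R *v x) = 0" by simp
  then show ?thesis by (simp only: matrix_vector_mul_assoc R)
qed

lemma trace_nonneg_psd:
  assumes "psd A"
  shows "0 \<le> A $ i $ i" "0 \<le> trace A"
proof -
  have "A $ i $ i = axis i 1 \<bullet> (A *v axis i 1)" for i
    by (simp add: matrix_vector_mul_component inner_axis inner_axis')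
  then show "0 \<le> A $ i $ i" "0 \<le> trace A"
    using psdD(2)[OF assms] by (auto simp: trace_def intro!: sum_nonneg)
qed

text \<open>The nonnegative diagonal entries all vanish, so every basis vector is a zero of the
  quadratic form and is killed by the matrix.\<close>

lemma psd_trace_0:
  assumes "psd A" "trace A = 0"
  shows "A = 0"
proof -
  have "A $ i $ i = axis i 1 \<bullet> (A *v axis i 1)" for i
    by (simp add: matrix_vector_mul_component inner_axis inner_axis')
  moreover have "A $ i $ i = 0" for i
    using assms trace_nonneg_psd(1)[OF assms(1)] sum_nonneg_eq_0_iff[of UNIV "\<lambda>i. A $ i $ i"]
    by (simp add: trace_def)
  ultimately have "A *v axis i 1 = 0" for i
    using psd_null_vector[OF assms(1)] by metis
  then have "column i A = 0" for i by (simp add: matrix_vector_mult_basis)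
  then show ?thesis by (simp add: column_def vec_eq_iff)
qed

lemma trace_mult_transpose: "trace (transpose X ** X) = (norm (X :: real^'n^'m))\<^sup>2"
proof -
  have "trace (transpose X ** X) = (\<Sum>i\<in>UNIV. \<Sum>k\<in>UNIV. (X $ k $ i)\<^sup>2)"
    by (simp add: trace_def matrix_matrix_mult_def transpose_def power2_eq_square)
  also have "\<dots> = (\<Sum>k\<in>UNIV. \<Sum>i\<in>UNIV. (X $ k $ i)\<^sup>2)" by (rule sum.swap)
  also have "\<dots> = X \<bullet> X" by (simp add: inner_vec_def power2_eq_square)
  finally show ?thesis by (simp add: power2_norm_eq_inner)
qed

text \<open>The product need not be symmetric, but it has the trace of the congruence
  \<open>R B R\<close>, where \<open>R\<close> is a square root of \<open>A\<close>.\<close>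

lemma trace_mult_psd_nonneg:
  assumes "psd A" "psd B"
  shows "0 \<le> trace (A ** B)"
proof -
  obtain R where R: "psd R" "R ** R = A" using psd_sqrt_exists[OF assms(1)] .
  have "trace (A ** B) = trace (R ** B ** transpose R)"
    using R psdD(1) trace_mul_sym[of R "R ** B"] by (metis matrix_mul_assoc)
  then show ?thesis using trace_nonneg_psd(2)[OF psd_congruence[OF assms(2)]] by metis
qed

lemma trace_mult_psd_mono:
  assumes "psd A" "psd (C - B)"
  shows "trace (A ** B) \<le> trace (A ** C)" "trace (B ** A) \<le> trace (C ** A)"
  using trace_mult_psd_nonneg[OF assms] trace_mul_sym[of A]
  by (simp_all add: matrix_diff_ldistrib trace_sub)

lemma norm_matrix_vector_mult_le: "norm ((X :: real^'n^'m) *v x) \<le> norm X * norm x"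
proof (rule power2_le_imp_le)
  have "(norm (X *v x))\<^sup>2 = (\<Sum>i\<in>UNIV. (X $ i \<bullet> x)\<^sup>2)"
    by (subst power2_norm_eq_inner)
      (simp add: inner_vec_def[of "X *v x"] matrix_vector_mul_component power2_eq_square)
  also have "\<dots> \<le> (\<Sum>i\<in>UNIV. (X $ i \<bullet> X $ i) * (x \<bullet> x))"
    by (intro sum_mono Cauchy_Schwarz_ineq)
  also have "\<dots> = (norm X * norm x)\<^sup>2"
    by (simp add: power_mult_distrib power2_norm_eq_inner inner_vec_def[of X] sum_distrib_right)
  finally show "(norm (X *v x))\<^sup>2 \<le> (norm X * norm x)\<^sup>2" .
qed simp

text \<open>The trace is the squared Frobenius norm of the square root, which dominates the squared
  operator norm.\<close>

lemma psd_le_trace: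
  assumes "psd A"
  shows "psd (trace A *\<^sub>R mat 1 - A)"
  unfolding psd_def
proof (intro conjI allI)
  show "transpose (trace A *\<^sub>R mat 1 - A) = trace A *\<^sub>R mat 1 - A"
    using psdD(1)[OF assms] by (simp add: transpose_diff transpose_scalar)
  obtain R where R: "psd R" "R ** R = A" using psd_sqrt_exists[OF assms] .
  fix x
  have "x \<bullet> (A *v x) = (R *v x) \<bullet> (R *v x)"
    using inner_matrix_vector_mult[of x R "R *v x"] R psdD(1)
    by (metis matrix_vector_mul_assoc)
  also have "\<dots> \<le> (norm R)\<^sup>2 * (x \<bullet> x)"
    using norm_matrix_vector_mult_le[of R x]
    by (metis norm_ge_zero power2_norm_eq_inner power_mono power_mult_distrib)
  also have "(norm R)\<^sup>2 = trace A" using trace_mult_transpose[of R] R psdD(1) by metis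
  finally show "0 \<le> x \<bullet> ((trace A *\<^sub>R mat 1 - A) *v x)"
    by (simp add: matrix_vector_mult_diff_rdistrib inner_diff_right scaleR_matrix_vector_assoc[symmetric])
qed

lemma trace_mult_psd_le:
  assumes "psd A" "psd B"
  shows "trace (A ** B) \<le> trace A * trace B"
  using trace_mult_psd_mono(1)[OF assms(1) psd_le_trace[OF assms(2)]]
  by (simp add: matrix_scalar_ac trace_scaleR mult.commute flip: scalar_matrix_assoc)

lemma norm_psd_le_trace:
  assumes "psd A"
  shows "norm A \<le> trace A"
proof (rule power2_le_imp_le)
  show "(norm A)\<^sup>2 \<le> (trace A)\<^sup>2"
    using trace_mult_psd_le[OF assms assms] trace_mult_transpose[of A] psdD(1)[OF assms]
    by (simp add: power2_eq_square)
qed (rule trace_nonneg_psd(2)[OF assms])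

text \<open>With \<open>D = R - S\<close>, the identity \<open>R D + D S = R R - S S = 0\<close>
  multiplied by \<open>D\<close> gives \<open>tr(D R D) + tr(D S D) = 0\<close>. Both traces are
  nonnegative, so \<open>R\<close> and \<open>S\<close> vanish on the range of \<open>D\<close>;
  then so does \<open>D\<close>, and \<open>D D = 0\<close>.\<close>

lemma psd_sqrt_unique:
  assumes "psd R" "psd S" "R ** R = S ** S"
  shows "R = S"
proof -
  let ?D = "R - S"
  have D: "transpose ?D = ?D" using assms by (simp add: transpose_diff psdD)
  have "R ** ?D + ?D ** S = 0"
    using assms(3) by (simp add: matrix_diff_ldistrib matrix_diff_rdistrib)
  then have "?D ** (R ** ?D) + ?D ** (?D ** S) = 0"
    by (metis matrix_add_ldistrib times0_right)
  then have "trace (?D ** (R ** ?D)) + trace (?D ** (?D ** S)) = 0"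
    by (metis trace_add trace_0 mat_0)
  moreover have "trace (?D ** (?D ** S)) = trace (?D ** S ** transpose ?D)"
    using trace_mul_sym[of ?D "?D ** S"] D by simp
  moreover have "trace (?D ** (R ** ?D)) = trace (?D ** R ** transpose ?D)"
    using D by (simp add: matrix_mul_assoc)
  ultimately have tr: "trace (?D ** R ** transpose ?D) = 0" "trace (?D ** S ** transpose ?D) = 0"
    using trace_nonneg_psd(2)[OF psd_congruence, of R ?D] trace_nonneg_psd(2)[OF psd_congruence, of S ?D]
      assms by linarith+
  have "T *v (?D *v x) = 0" if "psd T" "trace (?D ** T ** transpose ?D) = 0" for T x
  proof (rule psd_null_vector[OF that(1)])
    have "?D ** T ** ?D = 0" using psd_trace_0[OF psd_congruence[OF that(1)] that(2)] D by simp
    then have "?D *v (T *v (?D *v x)) = 0" by (simp add: matrix_vector_mul_assoc matrix_mul_assoc)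
    then show "(?D *v x) \<bullet> (T *v (?D *v x)) = 0"
      by (metis D inner_matrix_vector_mult inner_zero_right)
  qed
  then have "?D *v (?D *v x) = 0" for x
    using tr assms by (simp add: matrix_vector_mult_diff_rdistrib)
  then have "(?D *v x) \<bullet> (?D *v x) = 0" for x
    by (metis D inner_matrix_vector_mult inner_zero_right)
  then have "?D = 0" by (simp add: matrix_eq_0_iff)
  then show ?thesis by simp
qed

lemma matrix_sqrt_eqI:
  assumes "psd R" "R ** R = A"
  shows "matrix_sqrt A = R"
  unfolding matrix_sqrt_def using assms psd_sqrt_unique by (intro the_equality) auto

lemma
  assumes "psd A"
  shows psd_matrix_sqrt: "psd (matrix_sqrt A)"
    and matrix_sqrt_mult_self: "matrix_sqrt A ** matrix_sqrt A = A"
proof -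
  obtain R where "psd R" "R ** R = A" using psd_sqrt_exists[OF assms] .
  with matrix_sqrt_eqI[OF this] show "psd (matrix_sqrt A)" "matrix_sqrt A ** matrix_sqrt A = A"
    by simp_all
qed

text \<open>\<open>B\<close> is symmetric since left and right inverses agree, and
  \<open>B = B A B^T\<close> is a congruence of \<open>A\<close>.\<close>

lemma psd_inverse:
  assumes "psd A" "A ** B = mat 1"
  shows "psd B"
proof -
  have BA: "B ** A = mat 1" using assms(2) by (simp add: matrix_left_right_inverse)
  have "transpose B ** A = mat 1"
    using arg_cong[OF assms(2), of transpose] psdD(1)[OF assms(1)] by (simp add: matrix_transpose_mul)
  then have "transpose B = B" by (metis assms(2) matrix_mul_assoc matrix_mul_lid matrix_mul_rid)
  then show ?thesis using psd_congruence[OF assms(1), of B] BA by simp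
qed

lemma closed_psd: "closed {A :: real^'n^'n. psd A}"
  unfolding psd_def
  by (intro closed_Collect_conj closed_Collect_all closed_Collect_eq closed_Collect_le continuous_intros)


section \<open>The dual problem\<close>

text \<open>A vector killed by \<open>N\<close> is a zero of the form of \<open>M\<close>, hence is
  killed by the invertible \<open>M\<close>. This gives inverses to the points of a segment starting
  at \<open>M\<close>, which must have one to compete in the dual problem.\<close>

lemma invertible_of_psd_bound:
  fixes M N :: "real^'n^'n"
  assumes "psd (N - c *\<^sub>R M)" "c > 0" "psd M" "T ** M = mat 1"
  obtains N' where "N ** N' = mat 1" "N' ** N = mat 1"
proof -
  have "x = 0" if "N *v x = 0" for x
  proof -
    have "0 \<le> x \<bullet> ((N - c *\<^sub>R M) *v x)" using assms(1) psdD(2) by blast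
    then have "c * (x \<bullet> (M *v x)) \<le> 0"
      using that by (simp add: matrix_vector_mult_diff_rdistrib inner_diff_right flip: scaleR_matrix_vector_assoc)
    then have "x \<bullet> (M *v x) = 0"
      using psdD(2)[OF \<open>psd M\<close>, of x] \<open>c > 0\<close> by (simp add: mult_le_0_iff)
    then have "T *v (M *v x) = 0" by (simp add: psd_null_vector[OF \<open>psd M\<close>])
    then show ?thesis using assms(4) by (simp add: matrix_vector_mul_assoc)
  qed
  then have "inj ((*v) N)"
    by (simp add: linear_injective_0[OF matrix_vector_mul_linear])
  then show ?thesis
    using that matrix_left_invertible_injective[of N] matrix_left_right_inverse by blast
qed

lemma psd_inverse_antimono:
  fixes M N :: "real^'n^'n"
  assumes "psd (N - c *\<^sub>R M)" "c > 0" "psd M" "psd N" "M ** T = mat 1" "N ** N' = mat 1"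
  shows "psd ((1 / c) *\<^sub>R T - N')"
proof -
  have T: "psd T" "T ** M = mat 1" and N': "psd N'" "N' ** N = mat 1"
    using assms psd_inverse by (simp_all add: matrix_left_right_inverse)
  have "0 \<le> x \<bullet> (((1 / c) *\<^sub>R T - N') *v x)" for x
  proof -
    \<comment> \<open>The \<open>M\<close>-form is expanded at \<open>c N' x - T x\<close>, a vector
      that vanishes when \<open>N = c M\<close>; replacing \<open>c M\<close> by \<open>N\<close> at
      \<open>N' x\<close> then leaves the claim.\<close>
    let ?y = "N' *v x" and ?z = "T *v x"
    have Ny: "N *v ?y = x" and Mz: "M *v ?z = x"
      using assms by (simp_all add: matrix_vector_mul_assoc)
    let ?w = "c *\<^sub>R ?y - ?z"
    have "0 \<le> ?w \<bullet> (M *v ?w)" using psdD(2)[OF assms(3)] .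
    also have "?w \<bullet> (M *v ?w) = c * (c * (?y \<bullet> (M *v ?y))) - 2 * c * (x \<bullet> ?y) + x \<bullet> ?z"
      using inner_matrix_vector_commute[OF psdD(1)[OF assms(3)], of ?z ?y]
      by (simp add: matrix_vector_mult_diff_distrib matrix_vector_mult_scaleR inner_diff_left
          inner_diff_right Mz inner_commute[of "?y" x] inner_commute[of "?z" x] right_diff_distrib)
    also have "c * (?y \<bullet> (M *v ?y)) \<le> ?y \<bullet> (N *v ?y)"
      using psdD(2)[OF assms(1), of ?y]
      by (simp add: matrix_vector_mult_diff_rdistrib inner_diff_right flip: scaleR_matrix_vector_assoc)
    finally have "0 \<le> c * (?y \<bullet> (N *v ?y)) - 2 * c * (x \<bullet> ?y) + x \<bullet> ?z"
      using \<open>c > 0\<close> by (simp add: mult_left_mono)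
    then have "c * (x \<bullet> ?y) \<le> x \<bullet> ?z" by (simp add: Ny inner_commute)
    then show ?thesis using \<open>c > 0\<close>
      by (simp add: matrix_vector_mult_diff_rdistrib inner_diff_right field_simps flip: scaleR_matrix_vector_assoc)
  qed
  then show ?thesis
    using T N' by (simp add: psd_def transpose_diff transpose_scalar)
qed

text \<open>The left and the right inverse each give a first-order identity; inserting one into the
  other yields an exact expansion in which the unknown \<open>N'\<close> occurs only in the
  remainder, where a crude bound suffices.\<close>

lemma inverse_perturbation:
  fixes M E :: "real^'n^'n"
  assumes "M ** T = mat 1" "T ** M = mat 1" "N' ** (M + t *\<^sub>R E) = mat 1" "(M + t *\<^sub>R E) ** N' = mat 1"
  shows "N' = T - t *\<^sub>R (T ** E ** T) + t\<^sup>2 *\<^sub>R (T ** E ** N' ** E ** T)"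
proof -
  have "N' ** (M + t *\<^sub>R E) ** T = T" using assms by simp
  then have 1: "N' = T - t *\<^sub>R (N' ** E ** T)"
    using assms(1) by (simp add: matrix_add_ldistrib matrix_add_rdistrib matrix_scalar_ac
        matrix_mul_assoc[symmetric] flip: scalar_matrix_assoc) (simp add: algebra_simps)
  have "T ** ((M + t *\<^sub>R E) ** N') = T" using assms by simp
  then have 2: "N' = T - t *\<^sub>R (T ** E ** N')"
    using assms(2) by (simp add: matrix_add_ldistrib matrix_add_rdistrib matrix_scalar_ac
        matrix_mul_assoc flip: scalar_matrix_assoc) (simp add: algebra_simps)
  have "N' = T - t *\<^sub>R (T ** E ** N')" by (rule 2)
  also have "T ** E ** N' = T ** E ** (T - t *\<^sub>R (N' ** E ** T))" using 1 by simp
  finally show ?thesis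
    by (simp add: matrix_diff_ldistrib matrix_scalar_ac matrix_mul_assoc scaleR_diff_right power2_eq_square
        diff_diff_eq2 flip: scalar_matrix_assoc) (simp add: algebra_simps)
qed

text \<open>The set of invertible matrices is not closed, so the minimization runs over pairs
  \<open>(M, T)\<close> subject to the closed condition \<open>M T = I\<close>. The constraint
  \<open>M <= I\<close> bounds \<open>M\<close>, and since \<open>\<Lambda>\<close> is invertible a
  bound on \<open>tr(T \<Lambda>)\<close> bounds \<open>T\<close>.\<close>

lemma exists_dual_minimizer:
  fixes A \<Lambda> :: "real^'n^'n"
  assumes A: "psd A" and \<Lambda>: "psd \<Lambda>" "invertible \<Lambda>"
  obtains M T where "psd M" "psd (mat 1 - M)" "psd T" "M ** T = mat 1"
    "\<And>N N'. psd N \<Longrightarrow> psd (mat 1 - N) \<Longrightarrow> psd N' \<Longrightarrow> N ** N' = mat 1 \<Longrightarrow>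
      trace (T ** \<Lambda>) + trace (M ** A) \<le> trace (N' ** \<Lambda>) + trace (N ** A)"
proof -
  let ?h = "\<lambda>(M, T). trace (T ** \<Lambda>) + trace (M ** A)"
  \<comment> \<open>The value of \<open>?h\<close> at \<open>M = T = I\<close>; the pairs excluded
    by the last condition of \<open>?K\<close> have a larger value.\<close>
  let ?C = "trace \<Lambda> + trace A"
  let ?K = "{p :: (real^'n^'n) \<times> (real^'n^'n). psd (fst p) \<and> psd (mat 1 - fst p) \<and> psd (snd p) \<and>
      fst p ** snd p = mat 1 \<and> trace (snd p ** \<Lambda>) \<le> ?C}"
  obtain \<Lambda>' where \<Lambda>': "\<Lambda> ** \<Lambda>' = mat 1" using \<Lambda>(2) by (auto simp: invertible_def)
  have "psd \<Lambda>'" by (rule psd_inverse[OF \<Lambda>(1) \<Lambda>'])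
  obtain L where L: "psd L" "L ** L = \<Lambda>" using psd_sqrt_exists[OF \<Lambda>(1)] .
  have bound: "norm (fst p) \<le> CARD('n)" "norm (snd p) \<le> ?C * trace \<Lambda>'" if "p \<in> ?K" for p
  proof -
    obtain M T where p: "p = (M, T)" by (cases p)
    have K: "psd M" "psd (mat 1 - M)" "psd T" "trace (T ** \<Lambda>) \<le> ?C" using that p by auto
    have "trace M \<le> CARD('n)"
      using trace_nonneg_psd(2)[OF K(2)] by (simp add: trace_sub trace_I)
    then show "norm (fst p) \<le> CARD('n)" using norm_psd_le_trace[OF K(1)] p by simp
    \<comment> \<open>\<open>tr T\<close> is rewritten as \<open>tr((L T L) \<Lambda>')\<close>, a
      product of positive semi-definite matrices whose first factor has trace
      \<open>tr(T \<Lambda>)\<close>.\<close>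
    have "psd (L ** T ** L)" using psd_congruence[OF K(3), of L] psdD(1)[OF L(1)] by simp
    then have "trace (L ** T ** L ** \<Lambda>') \<le> trace (L ** T ** L) * trace \<Lambda>'"
      using trace_mult_psd_le \<open>psd \<Lambda>'\<close> by blast
    also have "trace (L ** T ** L) = trace (T ** \<Lambda>)"
      using trace_mul_sym[of L "T ** L"] L by (simp add: matrix_mul_assoc flip: L(2))
    also have "L ** T ** L ** \<Lambda>' = L ** (T ** (L ** \<Lambda>'))" by (simp add: matrix_mul_assoc)
    also have "trace \<dots> = trace (T ** (L ** \<Lambda>') ** L)" by (rule trace_mul_sym)
    also have "T ** (L ** \<Lambda>') ** L = T"
    proof -
      have "L ** (L ** \<Lambda>') = mat 1" using \<Lambda>' L by (simp add: matrix_mul_assoc)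
      then have "(L ** \<Lambda>') ** L = mat 1" using matrix_left_right_inverse by blast
      then show ?thesis by (simp add: matrix_mul_assoc[symmetric])
    qed
    finally have "trace T \<le> ?C * trace \<Lambda>'"
      using K(4) trace_nonneg_psd(2)[OF \<open>psd \<Lambda>'\<close>] by (meson mult_right_mono order_trans)
    then show "norm (snd p) \<le> ?C * trace \<Lambda>'" using norm_psd_le_trace[OF K(3)] p by simp
  qed
  have "norm p \<le> CARD('n) + ?C * trace \<Lambda>'" if "p \<in> ?K" for p
    using norm_Pair_le[of "fst p" "snd p"] bound[OF that] by simp
  then have "bounded ?K" by (meson bounded_iff)
  moreover have "closed ?K"
  proof (intro closed_Collect_conj)
    have psdc: "closed {p. psd (f p)}" if "continuous_on UNIV f"
      for f :: "(real^'n^'n) \<times> (real^'n^'n) \<Rightarrow> real^'n^'n"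
      using closed_vimage[OF closed_psd that] by (simp add: vimage_def)
    show "closed {p :: (real^'n^'n) \<times> (real^'n^'n). psd (fst p)}" "closed {p :: (real^'n^'n) \<times> (real^'n^'n). psd (snd p)}"
      "closed {p :: (real^'n^'n) \<times> (real^'n^'n). psd (mat 1 - fst p)}"
      by (intro psdc continuous_intros)+
    show "closed {p :: (real^'n^'n) \<times> (real^'n^'n). fst p ** snd p = mat 1}"
      "closed {p :: (real^'n^'n) \<times> (real^'n^'n). trace (snd p ** \<Lambda>) \<le> ?C}"
      by (intro closed_Collect_eq closed_Collect_le continuous_intros)+
  qed
  ultimately have "compact ?K" by (simp add: compact_eq_bounded_closed)
  moreover have I: "(mat 1, mat 1) \<in> ?K"
    using trace_nonneg_psd(2)[OF A] by (simp add: psd_mat_1 psd_0)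
  moreover have "continuous_on ?K ?h"
    unfolding case_prod_beta by (intro continuous_intros)
  ultimately obtain p where p: "p \<in> ?K" and min: "\<And>q. q \<in> ?K \<Longrightarrow> ?h p \<le> ?h q"
    using continuous_attains_inf[of ?K ?h] by blast
  show ?thesis
  proof (rule that[of "fst p" "snd p"])
    fix N N' :: "real^'n^'n"
    assume N: "psd N" "psd (mat 1 - N)" "psd N'" "N ** N' = mat 1"
    show "trace (snd p ** \<Lambda>) + trace (fst p ** A) \<le> trace (N' ** \<Lambda>) + trace (N ** A)"
    proof (cases "trace (N' ** \<Lambda>) \<le> ?C")
      case True
      then have "(N, N') \<in> ?K" using N by simp
      from min[OF this] show ?thesis by (simp add: case_prod_beta)
    next
      case False
      then show ?thesis
        using min[OF I] trace_mult_psd_nonneg[OF N(1) A] by (simp add: case_prod_beta)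
    qed
  qed (use p in auto)
qed

text \<open>First-order conditions at the dual minimizer. The derivative of the objective in the
  direction \<open>E\<close> is \<open>- tr(E (T \<Lambda> T - A))\<close>, hence
  \<open>tr((N - M) (T \<Lambda> T - A)) <= 0\<close> for all admissible \<open>N\<close>. Lowering
  \<open>M\<close> along a rank-one matrix gives the semi-definiteness, and \<open>N = I\<close>
  gives complementary slackness.\<close>

lemma exists_optimal_expansion:
  fixes A \<Lambda> :: "real^'n^'n"
  assumes A: "psd A" and \<Lambda>: "psd \<Lambda>" "invertible \<Lambda>"
  obtains M T where "psd M" "psd (mat 1 - M)" "psd T" "M ** T = mat 1"
    "psd (T ** \<Lambda> ** T - A)" "trace ((mat 1 - M) ** (T ** \<Lambda> ** T - A)) = 0"
proof (rule exists_dual_minimizer[OF assms])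
  fix M T :: "real^'n^'n"
  assume M: "psd M" "psd (mat 1 - M)" and T: "psd T" and MT: "M ** T = mat 1"
    and min: "\<And>N N'. psd N \<Longrightarrow> psd (mat 1 - N) \<Longrightarrow> psd N' \<Longrightarrow> N ** N' = mat 1 \<Longrightarrow>
      trace (T ** \<Lambda>) + trace (M ** A) \<le> trace (N' ** \<Lambda>) + trace (N ** A)"
  have TM: "T ** M = mat 1" using MT by (simp add: matrix_left_right_inverse)
  let ?G = "T ** \<Lambda> ** T"
  have variation: "trace ((N - M) ** (?G - A)) \<le> 0" if N: "psd N" "psd (mat 1 - N)" for N
  proof -
    let ?E = "N - M"
    let ?k = "trace (T ** ?E ** T ** ?E ** T ** \<Lambda>)"
    have E: "transpose ?E = ?E" using N M by (simp add: transpose_diff psdD)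
    \<comment> \<open>For \<open>t <= 1/2\<close> the matrix \<open>M + t E\<close> stays above
      \<open>M / 2\<close>, even if \<open>N\<close> is singular; its inverse stays below
      \<open>2 T\<close>, which bounds the second-order remainder uniformly.\<close>
    have quad: "t * trace (?E ** (?G - A)) \<le> 2 * t\<^sup>2 * ?k" if t: "0 < t" "t \<le> 1 / 2" for t
    proof -
      have conv: "M + t *\<^sub>R ?E = (1 - t) *\<^sub>R M + t *\<^sub>R N" by (simp add: algebra_simps)
      have psdN: "psd (M + t *\<^sub>R ?E)"
        unfolding conv using t by (intro psd_add psd_scaleR M N) auto
      have "mat 1 - (M + t *\<^sub>R ?E) = (1 - t) *\<^sub>R (mat 1 - M) + t *\<^sub>R (mat 1 - N)" by (simp add: algebra_simps)
      then have leI: "psd (mat 1 - (M + t *\<^sub>R ?E))"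
        using t by (auto intro!: psd_add psd_scaleR M N)
      have "M + t *\<^sub>R ?E - (1 / 2) *\<^sub>R M = (1 / 2 - t) *\<^sub>R M + t *\<^sub>R N" by (simp add: vec_eq_iff field_simps)
      then have ge: "psd (M + t *\<^sub>R ?E - (1 / 2) *\<^sub>R M)"
        using t by (auto intro!: psd_add psd_scaleR M N)
      obtain N' where N': "(M + t *\<^sub>R ?E) ** N' = mat 1" "N' ** (M + t *\<^sub>R ?E) = mat 1"
        using invertible_of_psd_bound[OF ge _ M(1) TM] by auto
      have psdN': "psd N'" by (rule psd_inverse[OF psdN N'(1)])
      have le2: "psd (2 *\<^sub>R T - N')"
        using psd_inverse_antimono[OF ge _ M(1) psdN MT N'(1)] by simp
      have "psd (2 *\<^sub>R (T ** ?E ** T ** ?E ** T) - T ** ?E ** N' ** ?E ** T)"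
      proof -
        have "X ** (2 *\<^sub>R T - N') ** Y = 2 *\<^sub>R (X ** T ** Y) - X ** N' ** Y" for X Y :: "real^'n^'n"
          by (simp add: matrix_diff_ldistrib matrix_diff_rdistrib matrix_scalar_ac flip: scalar_matrix_assoc)
        from this[of "T ** ?E" "?E ** T"] show ?thesis
          using psd_congruence[OF le2, of "T ** ?E"]
          by (simp add: matrix_transpose_mul E psdD(1)[OF T] matrix_mul_assoc)
      qed
      then have bnd: "trace (T ** ?E ** N' ** ?E ** T ** \<Lambda>) \<le> 2 * ?k"
        using trace_mult_psd_mono(2)[OF \<Lambda>(1)]
        by (fastforce simp: trace_scaleR simp flip: scalar_matrix_assoc)
      have "N' = T - t *\<^sub>R (T ** ?E ** T) + t\<^sup>2 *\<^sub>R (T ** ?E ** N' ** ?E ** T)"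
        by (rule inverse_perturbation[OF MT TM N'(2,1)])
      then have "N' ** \<Lambda> = (T - t *\<^sub>R (T ** ?E ** T) + t\<^sup>2 *\<^sub>R (T ** ?E ** N' ** ?E ** T)) ** \<Lambda>" by simp
      then have "trace (N' ** \<Lambda>) = trace (T ** \<Lambda>) - t * trace (T ** ?E ** T ** \<Lambda>)
          + t\<^sup>2 * trace (T ** ?E ** N' ** ?E ** T ** \<Lambda>)"
        by (simp only: matrix_add_rdistrib matrix_diff_rdistrib[of T] trace_add trace_sub trace_scaleR
            scalar_matrix_assoc[symmetric])
      moreover have "trace (T ** ?E ** T ** \<Lambda>) = trace (?E ** ?G)"
        using trace_mul_sym[of T "?E ** T ** \<Lambda>"] by (simp only: matrix_mul_assoc)
      moreover have "trace (T ** \<Lambda>) + trace (M ** A) \<le> trace (N' ** \<Lambda>) + trace ((M + t *\<^sub>R ?E) ** A)"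
        by (rule min[OF psdN leI psdN' N'(1)])
      moreover have "trace ((M + t *\<^sub>R ?E) ** A) = trace (M ** A) + t * trace (?E ** A)"
        by (simp add: matrix_add_rdistrib trace_add trace_scaleR flip: scalar_matrix_assoc)
      moreover have "t\<^sup>2 * trace (T ** ?E ** N' ** ?E ** T ** \<Lambda>) \<le> t\<^sup>2 * (2 * ?k)"
        by (intro mult_left_mono bnd) simp
      moreover have "trace (?E ** (?G - A)) = trace (?E ** ?G) - trace (?E ** A)"
        by (simp only: matrix_diff_ldistrib[of _ ?G] trace_sub)
      ultimately show ?thesis by (simp only: right_diff_distrib)
    qed
    have *: "trace (?E ** (?G - A)) \<le> 2 * t * ?k" if "0 < t" "t \<le> 1 / 2" for t
    proof -
      have "t * trace (?E ** (?G - A)) \<le> t * (2 * t * ?k)"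
        using quad[OF that] by (simp only: power2_eq_square ac_simps)
      then show ?thesis using \<open>0 < t\<close> by (simp only: mult_le_cancel_left_pos)
    qed
    have "((\<lambda>t. 2 * t * ?k) \<longlongrightarrow> 2 * 0 * ?k) (at_right 0)"
      by (intro tendsto_intros)
    moreover have "eventually (\<lambda>t. trace (?E ** (?G - A)) \<le> 2 * t * ?k) (at_right (0::real))"
      unfolding eventually_at_right_field using * by (intro exI[of _ "1/2"]) auto
    ultimately show ?thesis
      using tendsto_lowerbound[of _ "2 * 0 * ?k"] by fastforce
  qed
  have psdG: "psd (?G - A)"
  proof -
    have sym: "transpose (?G - A) = ?G - A"
      using T \<Lambda>(1) A by (simp add: transpose_diff matrix_transpose_mul psdD matrix_mul_assoc)
    have "0 \<le> v \<bullet> ((?G - A) *v v)" for v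
    proof -
      \<comment> \<open>The rank-one matrix \<open>v v^T\<close>: for symmetric \<open>X\<close>,
        \<open>tr(V X)\<close> is the quadratic form of \<open>X\<close> at
        \<open>v\<close>.\<close>
      let ?V = "(\<chi> i j. v $ i * v $ j) :: real^'n^'n"
      have Vx: "?V *v x = (v \<bullet> x) *\<^sub>R v" for x
        by (simp add: matrix_vector_mult_def vec_eq_iff inner_vec_def sum_distrib_left mult_ac)
      have V: "psd ?V" unfolding psd_def
        by (simp add: Vx transpose_def vec_eq_iff mult.commute) (simp add: inner_commute)
      obtain s where s: "s > 0" "psd (M - s *\<^sub>R ?V)"
      proof -
        \<comment> \<open>\<open>M - s v v^T\<close> is positive semi-definite as long as
          \<open>s (v . T v) <= 1\<close>; the summand 1 avoids a division by zero at
          \<open>v = 0\<close>.\<close>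
        let ?c = "v \<bullet> (T *v v) + 1"
        have "?c > 0" using psdD(2)[OF T, of v] by linarith
        have "0 \<le> x \<bullet> ((M - (1 / ?c) *\<^sub>R ?V) *v x)" for x
        proof -
          let ?u = "T *v v" and ?a = "v \<bullet> x"
          have Mu: "M *v ?u = v" using MT by (simp add: matrix_vector_mul_assoc)
          let ?w = "x - (?a / ?c) *\<^sub>R ?u"
          have "0 \<le> ?w \<bullet> (M *v ?w)" by (rule psdD(2)[OF M(1)])
          also have "\<dots> = x \<bullet> (M *v x) - 2 * (?a / ?c) * ?a + (?a / ?c)\<^sup>2 * (v \<bullet> ?u)"
            using inner_matrix_vector_commute[OF psdD(1)[OF M(1)], of ?u x]
            by (simp add: matrix_vector_mult_diff_distrib matrix_vector_mult_scaleR inner_diff_left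
                inner_diff_right Mu inner_commute[of x v] inner_commute[of ?u v] power2_eq_square right_diff_distrib)
          also have "\<dots> \<le> x \<bullet> (M *v x) - 2 * (?a / ?c) * ?a + (?a / ?c)\<^sup>2 * ?c"
            by (intro add_left_mono mult_left_mono) auto
          also have "\<dots> = x \<bullet> (M *v x) - ?a * ?a / ?c"
            using \<open>?c > 0\<close> by (simp add: power2_eq_square)
          finally show ?thesis
            by (simp add: matrix_vector_mult_diff_rdistrib inner_diff_right Vx inner_commute[of x v] flip: scaleR_matrix_vector_assoc)
        qed
        then have "psd (M - (1 / ?c) *\<^sub>R ?V)"
          using psdD(1)[OF M(1)] psdD(1)[OF V] by (simp add: psd_def transpose_diff transpose_scalar)
        then show ?thesis using that[of "1 / ?c"] \<open>?c > 0\<close> by simp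
      qed
      have eq: "mat 1 - (M - s *\<^sub>R ?V) = (mat 1 - M) + s *\<^sub>R ?V" by simp
      have "psd (mat 1 - (M - s *\<^sub>R ?V))"
        unfolding eq using s(1) by (intro psd_add psd_scaleR M V) simp
      from variation[OF s(2) this] have "0 \<le> s * trace (?V ** (?G - A))"
        by (simp add: trace_def matrix_matrix_mult_def sum_negf sum_distrib_left mult.assoc)
      then have "0 \<le> trace (?V ** (?G - A))" using s(1) by (simp add: zero_le_mult_iff)
      also have "trace (?V ** (?G - A)) = (\<Sum>i\<in>UNIV. \<Sum>j\<in>UNIV. v $ i * v $ j * (?G - A) $ j $ i)"
        unfolding trace_def matrix_matrix_mult_def by simp
      also have "\<dots> = v \<bullet> ((?G - A) *v v)"
        unfolding inner_vec_def matrix_vector_mult_def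
        by (subst sum.swap) (simp add: sum_distrib_left mult_ac)
      finally show ?thesis .
    qed
    with sym show ?thesis by (simp add: psd_def)
  qed
  \<comment> \<open>\<open>N = I\<close> gives one inequality; the other is the nonnegativity of the
    trace of a product of positive semi-definite matrices.\<close>
  have "trace ((mat 1 - M) ** (?G - A)) = 0"
    using variation[OF psd_mat_1] trace_mult_psd_nonneg[OF M(2) psdG] by (simp add: psd_0)
  with M T MT psdG show thesis by (rule that)
qed


section \<open>The standard Gaussian distribution\<close>

lemma nn_integral_lborel_translate:
  fixes f :: "'a::euclidean_space \<Rightarrow> ennreal"
  assumes [measurable]: "f \<in> borel_measurable borel"
  shows "(\<integral>\<^sup>+x. f (c + x) \<partial>lborel) = (\<integral>\<^sup>+x. f x \<partial>lborel)"
  by (subst lborel_distr_plus[of c, symmetric], subst nn_integral_distr) auto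

lemma nn_integral_lborel_reflect:
  fixes f :: "'a::euclidean_space \<Rightarrow> ennreal"
  assumes [measurable]: "f \<in> borel_measurable borel"
  shows "(\<integral>\<^sup>+x. f (c - x) \<partial>lborel) = (\<integral>\<^sup>+x. f x \<partial>lborel)"
proof -
  have "distr lborel borel (\<lambda>x. c - x) = lborel"
    using lborel_affine[of "-1" c] by (simp add: density_1)
  then show ?thesis
    using nn_integral_distr[of "\<lambda>x. c - x" lborel borel f] by simp
qed

text \<open>Uniqueness of a translation-invariant measure: comparing with the unit ball, which is
  fixed by orthogonal maps, by exchanging two integrals.\<close>

lemma lborel_orthogonal_transformation:
  fixes f :: "'a::euclidean_space \<Rightarrow> 'a"
  assumes "orthogonal_transformation f"
  shows "distr lborel borel f = lborel"
proof (rule measure_eqI)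
  have lin: "linear f" by (rule orthogonal_transformation_linear[OF assms])
  have nrm: "norm (f x) = norm x" for x by (rule orthogonal_transformation_norm[OF assms])
  have surj: "surj f" by (rule orthogonal_transformation_surj[OF assms])
  have [measurable]: "f \<in> borel_measurable borel"
    using lin linear_conv_bounded_linear by (intro borel_measurable_continuous_onI linear_continuous_on) blast
  obtain g where fg: "f (g x) = x" for x using surj by (metis surj_f_inv_f)
  fix A assume "A \<in> sets (distr lborel borel f)"
  then have [measurable]: "A \<in> sets borel" by simp
  define B where "B = ball (0::'a) 1"
  have [measurable]: "B \<in> sets borel" and fB: "f x \<in> B \<longleftrightarrow> x \<in> B" for x
    by (simp_all add: B_def nrm)
  let ?a = "indicator A :: 'a \<Rightarrow> ennreal" and ?b = "indicator B :: 'a \<Rightarrow> ennreal"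
  let ?l = "lborel :: 'a measure"
  have B: "emeasure ?l B \<noteq> 0" "emeasure ?l B \<noteq> \<infinity>"
    using emeasure_lborel_ball_finite[of "0::'a" 1]
    by (auto simp: B_def emeasure_ball unit_ball_vol_pos[THEN less_imp_neq, symmetric] less_top)
  have ball: "(\<integral>\<^sup>+x. ?b (c + x) \<partial>?l) = emeasure ?l B" for c
    using nn_integral_lborel_translate[of ?b c] by simp
  have refl_A: "(\<integral>\<^sup>+x. ?a (c - x) \<partial>?l) = emeasure ?l A" for c
    using nn_integral_lborel_reflect[of ?a c] by simp
  have "(\<integral>\<^sup>+y. ?a (f y) \<partial>?l) * emeasure ?l B = (\<integral>\<^sup>+y. (\<integral>\<^sup>+x. ?a (f y) * ?b (f y + x) \<partial>?l) \<partial>?l)"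
    by (subst nn_integral_cmult) (simp_all add: ball nn_integral_multc)
  also have "\<dots> = (\<integral>\<^sup>+x. (\<integral>\<^sup>+y. ?a (f y) * ?b (f y + x) \<partial>?l) \<partial>?l)"
    by (rule lborel_pair.Fubini') measurable
  also have "\<dots> = (\<integral>\<^sup>+x. (\<integral>\<^sup>+y. ?a (f y - x) * ?b (f y) \<partial>?l) \<partial>?l)"
  proof (rule nn_integral_cong)
    \<comment> \<open>Substituting \<open>y - g x\<close> for \<open>y\<close> moves the shift from
      the ball to \<open>A\<close>, since \<open>f (g x) = x\<close>.\<close>
    fix x
    have "(\<integral>\<^sup>+y. ?a (f y) * ?b (f y + x) \<partial>?l) = (\<integral>\<^sup>+y. ?a (f (- g x + y)) * ?b (f (- g x + y) + x) \<partial>?l)"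
      by (rule nn_integral_lborel_translate[symmetric]) measurable
    also have "\<dots> = (\<integral>\<^sup>+y. ?a (f y - x) * ?b (f y) \<partial>?l)"
      using linear_diff[OF lin] fg by simp
    finally show "(\<integral>\<^sup>+y. ?a (f y) * ?b (f y + x) \<partial>?l) = (\<integral>\<^sup>+y. ?a (f y - x) * ?b (f y) \<partial>?l)" .
  qed
  also have "\<dots> = (\<integral>\<^sup>+y. (\<integral>\<^sup>+x. ?a (f y - x) * ?b (f y) \<partial>?l) \<partial>?l)"
    by (rule lborel_pair.Fubini') measurable
  also have "\<dots> = emeasure ?l A * (\<integral>\<^sup>+y. ?b (f y) \<partial>?l)"
    by (subst nn_integral_multc) (simp_all add: refl_A nn_integral_cmult)
  also have "(\<integral>\<^sup>+y. ?b (f y) \<partial>?l) = (\<integral>\<^sup>+y. ?b y \<partial>?l)"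
    by (intro nn_integral_cong) (simp add: indicator_def fB)
  finally have "(\<integral>\<^sup>+y. ?a (f y) \<partial>?l) * emeasure ?l B = emeasure ?l A * emeasure ?l B"
    by simp
  then have "(\<integral>\<^sup>+y. ?a (f y) \<partial>?l) = emeasure ?l A"
    using B by (simp add: ennreal_mult_cancel_left mult.commute[of _ "emeasure ?l B"])
  moreover have "(\<integral>\<^sup>+y. ?a (f y) \<partial>?l) = emeasure (distr ?l borel f) A"
    using nn_integral_distr[of f ?l borel ?a] by simp
  ultimately show "emeasure (distr ?l borel f) A = emeasure ?l A" by simp
qed simp

lemma borel_measurable_matrix_vector_mult [measurable (raw)]:
  fixes X :: "real^'n^'m"
  shows "f \<in> borel_measurable M \<Longrightarrow> (\<lambda>x. X *v f x) \<in> borel_measurable M"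
  by (rule measurable_compose[of f M borel])
    (auto intro!: borel_measurable_continuous_onI linear_continuous_on simp: linear_linear)

lemma borel_measurable_component [measurable (raw)]:
  fixes f :: "'a \<Rightarrow> real^'n"
  shows "f \<in> borel_measurable M \<Longrightarrow> (\<lambda>x. f x $ i) \<in> borel_measurable M"
  by (rule measurable_compose[of f M borel])
    (auto intro!: borel_measurable_continuous_onI continuous_intros)

lemma borel_measurable_vec_lambda:
  fixes f :: "'a \<Rightarrow> 'n::finite \<Rightarrow> real"
  assumes "\<And>i. (\<lambda>x. f x i) \<in> borel_measurable M"
  shows "(\<lambda>x. \<chi> i. f x i) \<in> borel_measurable M"
proof (subst borel_measurable_euclidean_space, rule ballI)
  fix b :: "real^'n" assume "b \<in> Basis"
  then obtain i where "b = axis i 1" by (auto simp: Basis_vec_def)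
  then show "(\<lambda>x. (\<chi> i. f x i) \<bullet> b) \<in> borel_measurable M"
    using assms[of i] by (simp add: inner_axis)
qed

lemma sets_std_gaussian [simp, measurable_cong]: "sets std_gaussian = sets borel"
  and space_std_gaussian [simp]: "space std_gaussian = UNIV"
  by (simp_all add: std_gaussian_def)

text \<open>The density is a function of the norm, which orthogonal maps preserve, as they do
  Lebesgue measure.\<close>

lemma std_gaussian_orthogonal:
  fixes U :: "real^'n^'n"
  assumes "orthogonal_matrix U"
  shows "distr std_gaussian borel ((*v) U) = std_gaussian"
proof -
  let ?h = "\<lambda>x::real^'n. ennreal (\<Prod>i\<in>UNIV. std_normal_density (x $ i))"
  have U: "orthogonal_transformation ((*v) U)"
    using assms by (simp add: orthogonal_transformation_matrix)
  have h: "?h x = ennreal ((1 / sqrt (2 * pi)) ^ CARD('n) * exp (- (norm x)\<^sup>2 / 2))" for x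
  proof -
    have "(\<Prod>i\<in>UNIV. std_normal_density (x $ i))
        = (\<Prod>i\<in>UNIV. 1 / sqrt (2 * pi) * exp (- (x $ i)\<^sup>2 / 2))"
      unfolding std_normal_density_def ..
    also have "\<dots> = (1 / sqrt (2 * pi)) ^ CARD('n) * exp (\<Sum>i\<in>UNIV. - (x $ i)\<^sup>2 / 2)"
      unfolding prod.distrib exp_sum[OF finite_class.finite_UNIV] prod_constant ..
    also have "(\<Sum>i\<in>UNIV. - (x $ i)\<^sup>2 / 2) = - (norm x)\<^sup>2 / 2"
      unfolding norm_vec_def L2_set_def
      by (simp add: sum_nonneg sum_negf sum_divide_distrib)
    finally show ?thesis by (rule arg_cong)
  qed
  have "?h (U *v x) = ?h x" for x
    unfolding h using orthogonal_transformation_norm[OF U] by simp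
  then have "distr std_gaussian borel ((*v) U) = distr (density lborel (\<lambda>x. ?h (U *v x))) borel ((*v) U)"
    by (simp add: std_gaussian_def)
  also have "\<dots> = density (distr lborel borel ((*v) U)) ?h"
    by (rule density_distr[symmetric]) auto
  finally show ?thesis
    by (simp add: lborel_orthogonal_transformation[OF U] std_gaussian_def)
qed

abbreviation normal_PiM :: "('n::finite \<Rightarrow> real) measure" where
  "normal_PiM \<equiv> \<Pi>\<^sub>M i\<in>UNIV. std_normal_distribution"

lemma prob_space_std_normal: "prob_space std_normal_distribution"
  by (rule prob_space_normal_density) simp

text \<open>Links the density on vectors to a product of one-dimensional laws, from which marginals
  and reindexings can be read off. Boxes determine the product measure, and on a box the Lebesgue
  integral factorizes.\<close>

lemma distr_std_gaussian_vec_nth: "distr std_gaussian (\<Pi>\<^sub>M i\<in>UNIV. std_normal_distribution) (($) :: real^'n \<Rightarrow> _) = normal_PiM"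
proof -
  interpret prob_space std_normal_distribution by (rule prob_space_std_normal)
  interpret product_sigma_finite "\<lambda>_::'n. std_normal_distribution"
    by (simp add: product_sigma_finite_def sigma_finite_measure_axioms)
  have [measurable]: "(($) :: real^'n \<Rightarrow> _) \<in> measurable borel normal_PiM"
    by (intro measurable_PiM_single') auto
  show ?thesis
  proof (rule PiM_eqI)
    fix A :: "'n \<Rightarrow> real set" assume "\<And>i. i \<in> UNIV \<Longrightarrow> A i \<in> sets std_normal_distribution"
    then have [measurable]: "\<And>i. A i \<in> sets borel" by simp
    have [measurable]: "Pi\<^sub>E UNIV A \<in> sets normal_PiM" by (intro sets_PiM_I_finite) auto
    \<comment> \<open>The factorized integral is indexed by \<open>Basis\<close>, the boxes by
      coordinates; \<open>ix\<close> recovers the coordinate from its basis vector.\<close>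
    obtain ix :: "real^'n \<Rightarrow> 'n" where ix: "ix (axis i 1) = i" for i
    proof
      show "(SOME j. axis i (1::real) = axis j 1) = i" for i :: 'n
        by (simp add: axis_eq_axis)
    qed
    let ?f = "\<lambda>b t. ennreal (std_normal_density t) * indicator (A (ix b)) t"
    have bas: "(Basis :: (real^'n) set) = (\<lambda>i. axis i 1) ` UNIV" by (auto simp: Basis_vec_def)
    have inj: "inj (\<lambda>i::'n. axis i (1::real))" by (simp add: inj_def axis_eq_axis)
    have "emeasure (distr std_gaussian normal_PiM (($) :: real^'n \<Rightarrow> _)) (Pi\<^sub>E UNIV A)
        = emeasure std_gaussian {x. \<forall>i. x $ i \<in> A i}"
      by (subst emeasure_distr) (auto intro!: arg_cong2[where f=emeasure])
    also have "\<dots> = (\<integral>\<^sup>+x. (\<Prod>b\<in>Basis. ?f b (x \<bullet> b)) \<partial>lborel)"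
    proof -
      have ind: "indicator {x. \<forall>i. x $ i \<in> A i} x = (\<Prod>i\<in>UNIV. indicator (A i) (x $ i) :: ennreal)" for x
      proof (cases "\<forall>i. x $ i \<in> A i")
        case False
        then obtain i where "x $ i \<notin> A i" by blast
        then have "(\<Prod>i\<in>UNIV. indicator (A i) (x $ i) :: ennreal) = 0"
          by (intro prod_zero bexI[of _ i]) auto
        with False show ?thesis by simp
      qed simp
      have eq: "(\<Prod>b\<in>Basis. ?f b (x \<bullet> b))
          = ennreal (\<Prod>i\<in>UNIV. std_normal_density (x $ i)) * indicator {x. \<forall>i. x $ i \<in> A i} x" for x :: "real^'n"
      proof -
        have "(\<Prod>b\<in>Basis. ?f b (x \<bullet> b))
            = (\<Prod>i\<in>UNIV. ennreal (std_normal_density (x $ i)) * indicator (A i) (x $ i))"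
          by (simp add: bas prod.reindex[OF inj] ix inner_axis)
        also have "\<dots> = (\<Prod>i\<in>UNIV. ennreal (std_normal_density (x $ i))) * (\<Prod>i\<in>UNIV. indicator (A i) (x $ i))"
          by (rule prod.distrib)
        also have "(\<Prod>i\<in>UNIV. ennreal (std_normal_density (x $ i))) = ennreal (\<Prod>i\<in>UNIV. std_normal_density (x $ i))"
          by (rule prod_ennreal) simp
        finally show ?thesis unfolding ind .
      qed
      have [measurable]: "{x :: real^'n. \<forall>i. x $ i \<in> A i} \<in> sets borel"
        by measurable
      show ?thesis
        unfolding std_gaussian_def eq by (rule emeasure_density) auto
    qed
    also have "\<dots> = (\<Prod>b\<in>Basis. (\<integral>\<^sup>+t. ?f b t \<partial>lborel))"
      by (rule nn_integral_lborel_prod) auto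
    also have "\<dots> = (\<Prod>i\<in>UNIV. emeasure std_normal_distribution (A i))"
      by (simp add: bas prod.reindex[OF inj] ix emeasure_density)
    finally show "emeasure (distr std_gaussian normal_PiM (($) :: real^'n \<Rightarrow> _)) (Pi\<^sub>E UNIV A)
        = (\<Prod>i\<in>UNIV. emeasure std_normal_distribution (A i))" .
  qed simp_all
qed

lemma borel_measurable_normal_PiM_vec_lambda [measurable]: "vec_lambda \<in> borel_measurable normal_PiM"
  by (rule borel_measurable_vec_lambda) measurable

lemma std_gaussian_eq_distr: "(std_gaussian :: (real^'n) measure) = distr normal_PiM borel vec_lambda"
proof -
  have [measurable]: "(($) :: real^'n \<Rightarrow> _) \<in> measurable borel normal_PiM"
    by (intro measurable_PiM_single') auto
  have "distr normal_PiM borel vec_lambda = distr (std_gaussian :: (real^'n) measure) borel (\<lambda>x. x)"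
    by (subst distr_std_gaussian_vec_nth[symmetric], subst distr_distr) (auto simp: o_def)
  then show ?thesis by (simp add: distr_id2)
qed

lemma prob_space_std_gaussian: "prob_space std_gaussian"
  unfolding std_gaussian_eq_distr
  by (intro prob_space.prob_space_distr prob_space_PiM prob_space_std_normal) measurable

text \<open>Distinct coordinates of an independent family are again independent; injectivity of
  \<open>j\<close> provides the distinctness.\<close>

lemma std_gaussian_reindex:
  fixes j :: "'p::finite \<Rightarrow> 'q::finite"
  assumes "inj j"
  shows "distr std_gaussian borel (\<lambda>x :: real^'q. \<chi> i. x $ j i) = std_gaussian"
proof -
  have [measurable]: "(\<lambda>x :: real^'q. \<chi> i. x $ j i) \<in> borel_measurable borel"
    by (intro borel_measurable_vec_lambda borel_measurable_component) simp
  have [measurable]: "(\<lambda>\<omega>. \<lambda>i\<in>UNIV. \<omega> (j i)) \<in> normal_PiM \<rightarrow>\<^sub>M (normal_PiM :: ('p \<Rightarrow> real) measure)"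
    by (intro measurable_PiM_single') auto
  have "distr std_gaussian borel (\<lambda>x :: real^'q. \<chi> i. x $ j i)
      = distr normal_PiM borel ((\<lambda>x :: real^'q. \<chi> i. x $ j i) \<circ> vec_lambda)"
    unfolding std_gaussian_eq_distr by (rule distr_distr) measurable
  also have "((\<lambda>x :: real^'q. \<chi> i. x $ j i) \<circ> vec_lambda) = vec_lambda \<circ> (\<lambda>\<omega>. \<lambda>i\<in>UNIV. \<omega> (j i))"
    by (simp add: fun_eq_iff)
  also have "distr normal_PiM borel (vec_lambda \<circ> (\<lambda>\<omega>. \<lambda>i\<in>UNIV. \<omega> (j i)))
      = distr (distr normal_PiM (normal_PiM :: ('p \<Rightarrow> real) measure) (\<lambda>\<omega>. \<lambda>i\<in>UNIV. \<omega> (j i))) borel vec_lambda"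
    by (rule distr_distr[symmetric]) measurable
  also have "distr normal_PiM normal_PiM (\<lambda>\<omega>. \<lambda>i\<in>UNIV. \<omega> (j i)) = (normal_PiM :: ('p \<Rightarrow> real) measure)"
    by (rule distr_PiM_reindex[of UNIV "\<lambda>_. std_normal_distribution"])
      (use assms in \<open>auto intro: prob_space_std_normal\<close>)
  finally show ?thesis by (simp add: std_gaussian_eq_distr[where 'n='p])
qed

lemma distr_std_gaussian_component:
  "distr std_gaussian borel (\<lambda>x::real^'n. x $ i) = std_normal_distribution"
proof -
  have "distr std_gaussian borel (\<lambda>x::real^'n. x $ i) = distr normal_PiM borel ((\<lambda>x::real^'n. x $ i) \<circ> vec_lambda)"
    unfolding std_gaussian_eq_distr by (rule distr_distr) measurable
  also have "(\<lambda>x::real^'n. x $ i) \<circ> vec_lambda = (\<lambda>\<omega>. \<omega> i)" by (simp add: fun_eq_iff)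
  also have "distr normal_PiM borel (\<lambda>\<omega>. \<omega> i) = distr normal_PiM std_normal_distribution (\<lambda>\<omega>. \<omega> i)"
    by (rule distr_cong) auto
  also have "\<dots> = std_normal_distribution"
    by (rule distr_PiM_component) (auto intro: prob_space_std_normal)
  finally show ?thesis .
qed

text \<open>The 0-1 matrix that selects the coordinates \<open>e\<close>, so that taking blocks
  becomes matrix multiplication. With \<open>Inl\<close> and \<open>Inr\<close> it splits a vector
  over a sum type, which is how two independent Gaussian vectors are realized on one space.\<close>

definition coord_proj :: "('m \<Rightarrow> 'n) \<Rightarrow> real^'n^'m" where
  "coord_proj e = submatrix e id (mat 1)"

lemma coord_proj_mult_vec: "coord_proj e *v x = (\<chi> i. x $ e i)"
  by (simp add: coord_proj_def submatrix_def mat_def matrix_vector_mult_def vec_eq_iff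
      if_distrib[where f="\<lambda>u. u * _"] cong: if_cong)

lemma submatrix_eq_coord_proj:
  "submatrix r c A = coord_proj r ** A ** transpose (coord_proj c)"
  by (simp add: coord_proj_def submatrix_def mat_def matrix_matrix_mult_def transpose_def vec_eq_iff
      if_distrib[where f="\<lambda>u. u * _"] if_distrib[where f="\<lambda>u. _ * u"] cong: if_cong)

lemma coord_proj_mult_transpose: "coord_proj e ** transpose (coord_proj f) = (\<chi> i j. if e i = f j then 1 else 0)"
  by (simp add: coord_proj_def submatrix_def mat_def matrix_matrix_mult_def transpose_def vec_eq_iff
      if_distrib[where f="\<lambda>u. u * _"] if_distrib[where f="\<lambda>u. _ * u"] cong: if_cong)

lemma coord_proj_mult_transpose_self: "inj e \<Longrightarrow> coord_proj e ** transpose (coord_proj e) = mat 1"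
  by (simp add: coord_proj_mult_transpose mat_def inj_eq)

lemma coord_proj_Inl_Inr:
  "coord_proj Inl ** transpose (coord_proj Inr) = 0" "coord_proj Inr ** transpose (coord_proj Inl) = 0"
  by (simp_all add: coord_proj_mult_transpose vec_eq_iff)

lemma coord_proj_sum:
  "transpose (coord_proj Inl) ** coord_proj Inl + transpose (coord_proj Inr) ** coord_proj Inr
    = (mat 1 :: real^('p::finite + 'q::finite)^('p + 'q))"
  by (simp add: vec_eq_iff split_sum_all coord_proj_def submatrix_def mat_def
      matrix_matrix_mult_def transpose_def if_distrib[where f="\<lambda>u. u * _"] cong: if_cong)

lemma std_gaussian_coord_proj:
  "inj e \<Longrightarrow> distr std_gaussian borel ((*v) (coord_proj e)) = std_gaussian"
  using std_gaussian_reindex[of e] by (simp add: coord_proj_mult_vec[abs_def])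


section \<open>Gaussian distributions and second moments\<close>

lemma distr_matrix_compose:
  fixes A :: "real^'n^'m" and B :: "real^'m^'p"
  assumes "sets M = sets borel"
  shows "distr (distr M borel ((*v) A)) borel ((*v) B) = distr M borel ((*v) (B ** A))"
proof -
  have [measurable_cong]: "sets M = sets borel" by fact
  have "distr (distr M borel ((*v) A)) borel ((*v) B) = distr M borel ((*v) B \<circ> (*v) A)"
    by (rule distr_distr) measurable
  also have "(*v) B \<circ> (*v) A = (*v) (B ** A)"
    by (simp add: fun_eq_iff matrix_vector_mul_assoc)
  finally show ?thesis .
qed

lemma sets_gaussian [simp, measurable_cong]: "sets (gaussian m S) = sets borel"
  and space_gaussian [simp]: "space (gaussian m S) = UNIV"
  by (simp_all add: gaussian_def)

lemma gaussian_0: "gaussian 0 S = distr std_gaussian borel ((*v) (matrix_sqrt S))"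
  by (simp add: gaussian_def)

lemma mult_transpose_eq_0_iff: "X ** transpose X = 0 \<longleftrightarrow> (X :: real^'n^'m) = 0"
proof
  assume "X ** transpose X = 0"
  then have "trace (transpose (transpose X) ** transpose X) = 0" by (simp add: trace_def)
  then have "transpose X = 0" by (simp only: trace_mult_transpose) simp
  then show "X = 0" by (simp add: transpose_def vec_eq_iff)
qed simp

text \<open>Both sides are images of one standard Gaussian vector \<open>(x, y)\<close>, under \<open>(x, y) \<mapsto> L x\<close> and
  \<open>(x, y) \<mapsto> S\<^sup>1\<^sup>/\<^sup>2 y\<close> where \<open>S = L L\<^sup>T\<close>. With the partial isometry \<open>W\<close> of the polar decomposition
  \<open>L = S\<^sup>1\<^sup>/\<^sup>2 W\<close>, these two maps differ by the orthogonal involution with blocks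
  \<open>I - W\<^sup>T W\<close>, \<open>W\<^sup>T\<close>, \<open>W\<close>, \<open>I - W W\<^sup>T\<close>.\<close>

theorem std_gaussian_linear_image:
  fixes L :: "real^'p^'q"
  shows "distr std_gaussian borel ((*v) L) = gaussian 0 (L ** transpose L)"
proof -
  let ?S = "L ** transpose L"
  have S: "psd ?S" by (rule psd_mult_transpose)
  obtain R R' J where R: "psd R" "R ** R = ?S" and sym: "transpose R' = R'" "transpose J = J"
    and rel: "?S ** R' = R" "R' ** ?S ** R' = J" "R ** R' = J" "J ** R' = R'" "J ** ?S = ?S"
  proof (rule psd_functional_calculus[OF S])
    fix F :: "(real \<Rightarrow> real) \<Rightarrow> real^'q^'q"
    assume F: "\<And>f. transpose (F f) = F f"
      "\<And>f g h. (\<And>x. x \<ge> 0 \<Longrightarrow> f x * g x = h x) \<Longrightarrow> F f ** F g = F h" "F (\<lambda>x. x) = ?S"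
    \<comment> \<open>Since \<open>inverse 0 = 0\<close>, \<open>?R'\<close> is the pseudo-inverse
      of \<open>?R\<close> and \<open>?P\<close> is the projection onto the range of
      \<open>?S\<close>.\<close>
    let ?R = "F sqrt" and ?R' = "F (\<lambda>x. inverse (sqrt x))" and ?P = "F (\<lambda>x. if x = 0 then 0 else 1)"
    have "F (\<lambda>x. sqrt (sqrt x)) ** F (\<lambda>x. sqrt (sqrt x)) = ?R"
      by (rule F(2)) simp
    then have psdR: "psd ?R"
      using psd_mult_transpose[of "F (\<lambda>x. sqrt (sqrt x))"] F(1) by simp
    have 1: "?R ** ?R = F (\<lambda>x. x)" by (rule F(2)) simp
    have 2: "F (\<lambda>x. x) ** ?R' = ?R"
      by (rule F(2)) (simp add: real_div_sqrt flip: divide_inverse)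
    have 3: "?R' ** ?R = ?P" "?R ** ?R' = ?P" by (rule F(2), simp)+
    have 4: "?P ** ?R' = ?R'" by (rule F(2)) simp
    have 5: "?P ** F (\<lambda>x. x) = F (\<lambda>x. x)" by (rule F(2)) simp
    show thesis
      by (rule that[of ?R ?R' ?P]) (use psdR 1 2 3 4 5 F(1) in \<open>simp_all add: F(3) flip: matrix_mul_assoc\<close>)
  qed
  have sqrtS: "matrix_sqrt ?S = R" by (rule matrix_sqrt_eqI[OF R])
  define W where "W = R' ** L"
  have WWt: "W ** transpose W = J"
    using rel(2) by (simp add: W_def matrix_transpose_mul sym matrix_mul_assoc)
  have PW: "J ** W = W" using rel(4) by (simp add: W_def matrix_mul_assoc)
  have JJ: "J ** J = J"
    by (subst (2 3) WWt[symmetric]) (simp add: matrix_mul_assoc PW)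
  have WtP: "transpose W ** J = transpose W"
    using arg_cong[OF PW, of transpose] by (simp add: matrix_transpose_mul sym)
  have LWt: "L ** transpose W = R"
    using rel(1) by (simp add: W_def matrix_transpose_mul sym matrix_mul_assoc)
  \<comment> \<open>The columns of \<open>L\<close> lie in the range of \<open>L L^T\<close>: the
    defect \<open>L - J L\<close> has Gram matrix zero.\<close>
  have "(L - J ** L) ** transpose (L - J ** L) = (?S - J ** ?S) - (?S - J ** ?S) ** J"
    by (simp add: transpose_diff matrix_transpose_mul sym matrix_diff_ldistrib matrix_diff_rdistrib matrix_mul_assoc)
  also have "\<dots> = 0" unfolding rel(5) by simp
  finally have "L - J ** L = 0" unfolding mult_transpose_eq_0_iff .
  then have PL: "J ** L = L" by simp
  define N where "N = transpose W ** W"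
  have LN: "L ** N = L"
  proof -
    have "L ** N = R ** W" unfolding N_def by (simp add: matrix_mul_assoc LWt)
    then show ?thesis using rel(3) PL by (simp add: W_def matrix_mul_assoc)
  qed
  have NN: "N ** N = N" and NWt: "N ** transpose W = transpose W"
    using WtP WWt by (simp_all add: N_def matrix_mul_assoc) (simp_all add: WWt WtP flip: matrix_mul_assoc)
  have WN: "W ** N = W" by (simp add: N_def matrix_mul_assoc WWt PW)
  let ?E1 = "coord_proj Inl :: real^('p + 'q)^'p" and ?E2 = "coord_proj Inr :: real^('p + 'q)^'q"
  have EE: "?E1 ** (transpose ?E1 ** X) = X" "?E2 ** (transpose ?E2 ** Y) = Y"
    "?E1 ** (transpose ?E2 ** Y) = 0" "?E2 ** (transpose ?E1 ** X) = 0"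
    for X :: "real^('p + 'q)^'p" and Y :: "real^('p + 'q)^'q"
    by (simp_all add: matrix_mul_assoc coord_proj_mult_transpose_self coord_proj_Inl_Inr)
  \<comment> \<open>The block rows of the involution, which exchanges the initial and the final
    space of \<open>W\<close> and fixes their complements.\<close>
  define V1 where "V1 = ?E1 - N ** ?E1 + transpose W ** ?E2"
  define V2 where "V2 = W ** ?E1 + ?E2 - J ** ?E2"
  define U where "U = transpose ?E1 ** V1 + transpose ?E2 ** V2"
  have EU: "?E1 ** U = V1" "?E2 ** U = V2"
    by (simp_all add: U_def matrix_add_ldistrib EE)
  have "V1 ** U = V1 - N ** V1 + transpose W ** V2"
    using EU by (simp add: V1_def matrix_add_rdistrib matrix_diff_rdistrib flip: matrix_mul_assoc)
  also have "\<dots> = ?E1"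
    by (simp add: V1_def V2_def matrix_add_ldistrib matrix_diff_ldistrib matrix_mul_assoc NN NWt WtP)
      (simp add: N_def)
  finally have V1U: "V1 ** U = ?E1" .
  have "V2 ** U = W ** V1 + V2 - J ** V2"
    using EU by (simp add: V2_def matrix_add_rdistrib matrix_diff_rdistrib flip: matrix_mul_assoc)
  also have "\<dots> = ?E2"
    by (simp add: V1_def V2_def matrix_add_ldistrib matrix_diff_ldistrib matrix_mul_assoc WN PW WWt JJ)
  finally have V2U: "V2 ** U = ?E2" .
  have "U ** U = transpose ?E1 ** (V1 ** U) + transpose ?E2 ** (V2 ** U)"
    by (subst (1) U_def) (simp add: matrix_add_rdistrib matrix_mul_assoc)
  then have UU: "U ** U = mat 1" unfolding V1U V2U coord_proj_sum .
  have tU: "transpose U = U"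
  proof -
    have tN: "transpose N = N" by (simp add: N_def matrix_transpose_mul)
    show ?thesis
      by (simp add: U_def V1_def V2_def transpose_add transpose_diff matrix_transpose_mul tN sym
          matrix_add_ldistrib matrix_diff_ldistrib matrix_add_rdistrib matrix_diff_rdistrib matrix_mul_assoc)
  qed
  have "orthogonal_matrix U" using UU tU by (simp add: orthogonal_matrix_def)
  note U = std_gaussian_orthogonal[OF this]
  \<comment> \<open>\<open>L\<close> annihilates the range of \<open>I - N\<close>, so only the
    block \<open>W^T\<close> survives, and \<open>L W^T = R\<close>.\<close>
  have LU: "L ** ?E1 ** U = R ** ?E2"
    using EU(1) by (simp add: V1_def matrix_add_ldistrib matrix_diff_ldistrib LN LWt matrix_mul_assoc flip: matrix_mul_assoc[of L ?E1 U])
  have "distr std_gaussian borel ((*v) L) = distr (distr std_gaussian borel ((*v) ?E1)) borel ((*v) L)"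
    by (simp add: std_gaussian_coord_proj)
  also have "\<dots> = distr std_gaussian borel ((*v) (L ** ?E1))"
    by (rule distr_matrix_compose) simp
  also have "\<dots> = distr (distr std_gaussian borel ((*v) U)) borel ((*v) (L ** ?E1))"
    by (simp only: U)
  also have "\<dots> = distr std_gaussian borel ((*v) (R ** ?E2))"
    unfolding LU[symmetric] by (rule distr_matrix_compose) simp
  also have "\<dots> = distr (distr std_gaussian borel ((*v) ?E2)) borel ((*v) R)"
    by (rule distr_matrix_compose[symmetric]) simp
  also have "\<dots> = gaussian 0 ?S"
    by (simp add: std_gaussian_coord_proj gaussian_0 sqrtS)
  finally show ?thesis .
qed

lemma gaussian_linear_image:
  fixes L :: "real^'p^'q"
  assumes "psd S"
  shows "distr (gaussian 0 S) borel ((*v) L) = gaussian 0 (L ** S ** transpose L)"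
proof -
  have "distr (gaussian 0 S) borel ((*v) L) = distr std_gaussian borel ((*v) (L ** matrix_sqrt S))"
    unfolding gaussian_0 by (rule distr_matrix_compose) simp
  also have "\<dots> = gaussian 0 (L ** matrix_sqrt S ** transpose (L ** matrix_sqrt S))"
    by (rule std_gaussian_linear_image)
  also have "L ** matrix_sqrt S ** transpose (L ** matrix_sqrt S) = L ** S ** transpose L"
  proof -
    have "L ** matrix_sqrt S ** transpose (L ** matrix_sqrt S) = L ** (matrix_sqrt S ** matrix_sqrt S) ** transpose L"
      using psd_matrix_sqrt[OF assms] by (simp add: matrix_transpose_mul psdD matrix_mul_assoc)
    then show ?thesis using matrix_sqrt_mult_self[OF assms] by simp
  qed
  finally show ?thesis .
qed

text \<open>Uncentred, so that integrals of quadratic forms and linear images are expressed without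
  tracking means. It agrees with the covariance for every measure in \<open>P2\<close> dominating a
  centred Gaussian, since such a measure is centred.\<close>

definition second_moment :: "(real^'n) measure \<Rightarrow> real^'n^'n" where
  "second_moment \<eta> = (\<chi> i j. \<integral>x. x $ i * x $ j \<partial>\<eta>)"

lemma transpose_second_moment: "transpose (second_moment \<eta>) = second_moment \<eta>"
  by (simp add: second_moment_def transpose_def vec_eq_iff mult.commute)

lemma
  assumes "\<eta> \<in> P2"
  shows P2_prob_space: "prob_space \<eta>" and P2_sets: "sets \<eta> = sets borel"
    and P2_integrable: "integrable \<eta> (\<lambda>x. (norm x)\<^sup>2)"
  using assms by (simp_all add: P2_def)

lemma P2_integrable_dominated:
  fixes f :: "'a::euclidean_space \<Rightarrow> 'b::euclidean_space"
  assumes "\<eta> \<in> P2" "f \<in> borel_measurable borel" "\<And>x. norm (f x) \<le> a + b * (norm x)\<^sup>2"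
  shows "integrable \<eta> f"
proof (rule Bochner_Integration.integrable_bound)
  interpret prob_space \<eta> by (rule P2_prob_space[OF assms(1)])
  have [measurable_cong]: "sets \<eta> = sets borel" by (rule P2_sets[OF assms(1)])
  show "integrable \<eta> (\<lambda>x. a + b * (norm x)\<^sup>2)"
    using P2_integrable[OF assms(1)] by simp
  show "f \<in> borel_measurable \<eta>" using assms(2) by measurable
  show "AE x in \<eta>. norm (f x) \<le> norm (a + b * (norm x)\<^sup>2)"
    using assms(3) by (intro AE_I2) (metis norm_ge_zero order_trans real_norm_def abs_ge_self)
qed

lemma P2_integrable_id:
  assumes "\<eta> \<in> P2"
  shows "integrable \<eta> (\<lambda>x. x)"
proof (rule P2_integrable_dominated[OF assms])
  fix x :: 'a
  have "0 \<le> (norm x - 1)\<^sup>2" by simp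
  then show "norm x \<le> 1 + 1 * (norm x)\<^sup>2"
    by (simp add: power2_eq_square algebra_simps) (smt (verit) norm_ge_zero zero_le_mult_iff)
qed simp

lemma P2_integrable_mult:
  fixes \<eta> :: "(real^'n) measure"
  assumes "\<eta> \<in> P2"
  shows "integrable \<eta> (\<lambda>x. x $ i * x $ j)"
proof (rule P2_integrable_dominated[OF assms])
  fix x :: "real^'n"
  show "norm (x $ i * x $ j) \<le> 0 + 1 * (norm x)\<^sup>2"
    using component_le_norm_cart[of x i] component_le_norm_cart[of x j]
    by (simp add: abs_mult power2_eq_square mult_mono)
qed measurable

lemma
  fixes \<eta> :: "(real^'n) measure"
  assumes "\<eta> \<in> P2"
  shows P2_integrable_quadratic: "integrable \<eta> (\<lambda>x. x \<bullet> (B *v x))"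
    and P2_integral_quadratic: "(\<integral>x. x \<bullet> (B *v x) \<partial>\<eta>) = trace (B ** second_moment \<eta>)"
proof -
  have eq: "x \<bullet> (B *v x) = (\<Sum>i\<in>UNIV. \<Sum>j\<in>UNIV. B $ i $ j * (x $ j * x $ i))" for x
    by (simp add: inner_vec_def matrix_vector_mult_def sum_distrib_left mult_ac)
  show "integrable \<eta> (\<lambda>x. x \<bullet> (B *v x))"
    unfolding eq by (intro Bochner_Integration.integrable_sum integrable_mult_right P2_integrable_mult assms)
  show "(\<integral>x. x \<bullet> (B *v x) \<partial>\<eta>) = trace (B ** second_moment \<eta>)"
    unfolding eq using P2_integrable_mult[OF assms]
    by (simp add: trace_def matrix_matrix_mult_def second_moment_def)
qed

lemma P2_linear_image:
  fixes \<eta> :: "(real^'n) measure" and L :: "real^'n^'m"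
  assumes "\<eta> \<in> P2"
  shows "distr \<eta> borel ((*v) L) \<in> P2"
proof -
  have [measurable_cong]: "sets \<eta> = sets borel" by (rule P2_sets[OF assms])
  have [measurable]: "(*v) L \<in> \<eta> \<rightarrow>\<^sub>M borel" by measurable
  have "integrable \<eta> (\<lambda>x. (norm (L *v x))\<^sup>2)"
  proof (rule P2_integrable_dominated[OF assms])
    fix x :: "real^'n"
    show "norm ((norm (L *v x))\<^sup>2) \<le> 0 + (norm L)\<^sup>2 * (norm x)\<^sup>2"
      using power_mono[OF norm_matrix_vector_mult_le[of L x], of 2] by (simp add: power_mult_distrib)
  qed measurable
  then show ?thesis
    using P2_prob_space[OF assms]
    by (auto simp: P2_def integrable_distr_eq intro!: prob_space.prob_space_distr)
qed

lemma second_moment_linear_image: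
  fixes \<eta> :: "(real^'n) measure" and L :: "real^'n^'m"
  assumes "\<eta> \<in> P2"
  shows "second_moment (distr \<eta> borel ((*v) L)) = L ** second_moment \<eta> ** transpose L"
proof -
  have [measurable_cong]: "sets \<eta> = sets borel" by (rule P2_sets[OF assms])
  have [measurable]: "(*v) L \<in> \<eta> \<rightarrow>\<^sub>M borel" by measurable
  have eq: "(L *v x) $ i * (L *v x) $ j = (\<Sum>k\<in>UNIV. \<Sum>l\<in>UNIV. L $ i $ k * L $ j $ l * (x $ k * x $ l))" for x i j
    by (simp add: matrix_vector_mult_def sum_product mult_ac)
  have "second_moment (distr \<eta> borel ((*v) L)) $ i $ j = (\<integral>x. (L *v x) $ i * (L *v x) $ j \<partial>\<eta>)" for i j
    unfolding second_moment_def by (subst integral_distr) auto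
  also have "\<dots> i j = (\<Sum>k\<in>UNIV. \<Sum>l\<in>UNIV. L $ i $ k * L $ j $ l * second_moment \<eta> $ k $ l)" for i j
    unfolding eq using P2_integrable_mult[OF assms] by (simp add: second_moment_def)
  also have "\<dots> i j = (L ** second_moment \<eta> ** transpose L) $ i $ j" for i j
    by (subst sum.swap) (simp add: matrix_matrix_mult_def transpose_def sum_distrib_right sum_distrib_left mult_ac)
  finally show ?thesis by (simp add: vec_eq_iff)
qed

lemma integral_linear_image:
  fixes \<eta> :: "(real^'n) measure" and L :: "real^'n^'m"
  assumes "\<eta> \<in> P2"
  shows "(\<integral>x. x \<partial>distr \<eta> borel ((*v) L)) = L *v (\<integral>x. x \<partial>\<eta>)"
proof -
  have [measurable_cong]: "sets \<eta> = sets borel" by (rule P2_sets[OF assms])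
  have "(\<integral>x. x \<partial>distr \<eta> borel ((*v) L)) = (\<integral>x. L *v x \<partial>\<eta>)"
    by (rule integral_distr) measurable
  then show ?thesis
    using integral_bounded_linear[OF _ P2_integrable_id[OF assms], of "(*v) L"]
    by (simp add: linear_linear)
qed

lemma covariance_matrix_eq_second_moment:
  assumes "\<eta> \<in> P2" "(\<integral>x. x \<partial>\<eta>) = 0"
  shows "covariance_matrix \<eta> = second_moment \<eta>"
proof -
  have "(\<integral>x. x $ i \<partial>\<eta>) = (\<integral>x. x \<partial>\<eta>) $ i" for i
    by (rule integral_bounded_linear[OF bounded_linear_vec_nth P2_integrable_id[OF assms(1)]])
  then show ?thesis using assms(2) by (simp add: covariance_matrix_def second_moment_def)
qed

text \<open>The mean and the mixed moments vanish by invariance under diagonal sign changes; the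
  remaining moments are one-dimensional.\<close>

lemma std_gaussian_P2: "(std_gaussian :: (real^'n) measure) \<in> P2"
  and second_moment_std_gaussian: "second_moment (std_gaussian :: (real^'n) measure) = mat 1"
  and integral_std_gaussian: "(\<integral>x. x \<partial>(std_gaussian :: (real^'n) measure)) = 0"
proof -
  let ?Z = "std_gaussian :: (real^'n) measure"
  have sq: "has_bochner_integral ?Z (\<lambda>x. (x $ i)\<^sup>2) 1" for i
  proof -
    have "has_bochner_integral (distr ?Z borel (\<lambda>x. x $ i)) (\<lambda>t. t\<^sup>2) 1"
      unfolding distr_std_gaussian_component
      using std_normal_distribution_even_moments[of 1] by (simp add: has_bochner_integral_iff)
    then show ?thesis
      by (simp add: has_bochner_integral_iff integrable_distr_eq integral_distr)
  qed
  have "integrable ?Z (\<lambda>x. \<Sum>i\<in>UNIV. (x $ i)\<^sup>2)"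
    using sq by (intro Bochner_Integration.integrable_sum) (auto simp: has_bochner_integral_iff)
  then have "integrable ?Z (\<lambda>x. (norm x)\<^sup>2)"
    by (simp add: norm_vec_def L2_set_def sum_nonneg)
  then show P2: "?Z \<in> P2" by (simp add: P2_def prob_space_std_gaussian)
  have refl: "distr ?Z borel ((*v) (diag_matrix v)) = ?Z" if "\<And>k. v $ k * v $ k = 1" for v
  proof (rule std_gaussian_orthogonal)
    have "diag_matrix v ** diag_matrix v = mat 1"
      using that by (simp add: diag_matrix_def mat_def matrix_matrix_mult_def vec_eq_iff
        if_distrib[where f="\<lambda>u. u * _"] if_distrib[where f="\<lambda>u. _ * u"] cong: if_cong)
    moreover have "transpose (diag_matrix v) = diag_matrix v"
      by (simp add: transpose_def diag_matrix_def vec_eq_iff)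
    ultimately show "orthogonal_matrix (diag_matrix v)" by (simp add: orthogonal_matrix_def)
  qed
  have diag: "(diag_matrix v *v x) $ k = v $ k * x $ k" for v x :: "real^'n" and k
    by (simp add: diag_matrix_def matrix_vector_mult_def if_distrib[where f="\<lambda>u. u * _"] cong: if_cong)
  show "(\<integral>x. x \<partial>?Z) = 0"
  proof -
    let ?D = "diag_matrix (\<chi> k. - 1) :: real^'n^'n"
    have "?D *v x = - x" for x by (simp add: vec_eq_iff diag)
    then have neg: "(\<integral>x. x \<partial>?Z) = - (\<integral>x. x \<partial>?Z)"
      using integral_linear_image[OF P2, of ?D] refl[of "\<chi> k. - 1"] by simp
    have "(\<integral>x. x \<partial>?Z) $ i = 0" for i
      using arg_cong[OF neg, of "\<lambda>v. v $ i"] by simp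
    then show ?thesis by (simp add: vec_eq_iff)
  qed
  show "second_moment ?Z = mat 1"
  proof -
    have "(\<integral>x. x $ i * x $ j \<partial>?Z) = 0" if "i \<noteq> j" for i j
    proof -
      let ?v = "(\<chi> k. if k = i then -1 else 1) :: real^'n"
      have "second_moment ?Z $ i $ j = second_moment (distr ?Z borel ((*v) (diag_matrix ?v))) $ i $ j"
        by (subst refl) auto
      also have "\<dots> = (\<integral>x. (diag_matrix ?v *v x) $ i * (diag_matrix ?v *v x) $ j \<partial>?Z)"
        unfolding second_moment_def by (subst integral_distr) auto
      also have "\<dots> = - second_moment ?Z $ i $ j"
        using that by (simp add: diag second_moment_def)
      finally show ?thesis by (simp add: second_moment_def)
    qed
    then show ?thesis
      using sq by (auto simp: vec_eq_iff second_moment_def mat_def has_bochner_integral_iff power2_eq_square)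
  qed
qed

lemma
  assumes "psd S"
  shows gaussian_P2: "gaussian 0 S \<in> P2"
    and second_moment_gaussian: "second_moment (gaussian 0 S) = S"
    and integral_gaussian: "(\<integral>x. x \<partial>gaussian 0 S) = 0"
    and covariance_gaussian: "covariance_matrix (gaussian 0 S) = S"
proof -
  show 1: "gaussian 0 S \<in> P2" unfolding gaussian_0 by (rule P2_linear_image[OF std_gaussian_P2])
  show 2: "second_moment (gaussian 0 S) = S"
    unfolding gaussian_0 second_moment_linear_image[OF std_gaussian_P2] second_moment_std_gaussian
    using psd_matrix_sqrt[OF assms] matrix_sqrt_mult_self[OF assms] by (simp add: psdD)
  show 3: "(\<integral>x. x \<partial>gaussian 0 S) = 0"
    unfolding gaussian_0 integral_linear_image[OF std_gaussian_P2] integral_std_gaussian by simp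
  show "covariance_matrix (gaussian 0 S) = S"
    using covariance_matrix_eq_second_moment[OF 1 3] 2 by simp
qed

text \<open>Used to exclude Gaussian projections with nonzero mean.\<close>

lemma integral_gaussian_mean:
  "(\<integral>x. x \<partial>gaussian m S) = (m :: real^'n)"
proof -
  interpret prob_space "std_gaussian :: (real^'n) measure" by (rule prob_space_std_gaussian)
  let ?L = "matrix_sqrt S"
  have L: "bounded_linear ((*v) ?L)" by (simp add: linear_linear)
  have "(\<integral>x. x \<partial>gaussian m S) = (\<integral>x. m + ?L *v x \<partial>std_gaussian)"
    unfolding gaussian_def by (rule integral_distr) measurable
  also have "\<dots> = m + ?L *v (\<integral>x. x \<partial>std_gaussian)"
    using integrable_bounded_linear[OF L P2_integrable_id[OF std_gaussian_P2]]
      integral_bounded_linear[OF L P2_integrable_id[OF std_gaussian_P2]] prob_space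
    by simp
  finally show ?thesis by (simp add: integral_std_gaussian)
qed


section \<open>Convex order and couplings\<close>

lemma extended_integral_integrable:
  assumes "integrable M f"
  shows "extended_integral M f = ereal (integral\<^sup>L M f)"
proof -
  have "(\<integral>\<^sup>+x. ennreal (f x) \<partial>M) < top" "(\<integral>\<^sup>+x. ennreal (- f x) \<partial>M) < top"
    using assms by (simp_all add: real_integrable_def less_top)
  then obtain a b where ab: "(\<integral>\<^sup>+x. ennreal (f x) \<partial>M) = ennreal a" "a \<ge> 0"
    "(\<integral>\<^sup>+x. ennreal (- f x) \<partial>M) = ennreal b" "b \<ge> 0"
    by (metis enn2real_nonneg ennreal_enn2real)
  then show ?thesis
    by (simp add: extended_integral_def real_lebesgue_integral_def[OF assms])
qed

lemma extended_integral_top: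
  assumes "(\<integral>\<^sup>+x. ennreal (f x) \<partial>M) = top"
  shows "extended_integral M f = \<infinity>"
  using assms by (simp add: extended_integral_def)

lemma convex_on_borel_measurable:
  fixes f :: "'a::euclidean_space \<Rightarrow> real"
  shows "convex_on UNIV f \<Longrightarrow> f \<in> borel_measurable borel"
  by (intro borel_measurable_continuous_onI convex_on_continuous) auto

lemma extended_integral_distr:
  assumes "\<phi> \<in> measurable M N" "f \<in> borel_measurable N"
  shows "extended_integral (distr M N \<phi>) f = extended_integral M (\<lambda>x. f (\<phi> x))"
  using assms by (simp add: extended_integral_def nn_integral_distr)

text \<open>The law of \<open>L x\<close> is symmetric because \<open>L\<close> and
  \<open>- L\<close> have the same product with their transposes. Convexity at the midpoint 0 of
  \<open>y\<close> and \<open>- y\<close> bounds the negative part of \<open>f y\<close> by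
  \<open>2 |f 0|\<close> plus the positive part of \<open>f (- y)\<close>, so finiteness of the
  positive part suffices.\<close>

lemma convex_on_std_gaussian_integrable:
  fixes L :: "real^'p^'q"
  assumes f: "convex_on UNIV f" and fin: "(\<integral>\<^sup>+x. ennreal (f (L *v x)) \<partial>std_gaussian) < top"
  shows "integrable std_gaussian (\<lambda>x. f (L *v x))"
proof -
  interpret prob_space "std_gaussian :: (real^'p) measure" by (rule prob_space_std_gaussian)
  have [measurable]: "f \<in> borel_measurable borel" by (rule convex_on_borel_measurable[OF f])
  have "distr std_gaussian borel ((*v) (- 1 *\<^sub>R L)) = distr std_gaussian borel ((*v) L)"
    unfolding std_gaussian_linear_image transpose_scalar matrix_scalar_ac scalar_matrix_assoc[symmetric] scaleR_scaleR
    by simp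
  moreover have "(\<integral>\<^sup>+x. ennreal (f (X *v x)) \<partial>std_gaussian) = (\<integral>\<^sup>+x. ennreal (f x) \<partial>distr std_gaussian borel ((*v) X))"
    for X :: "real^'p^'q"
    by (rule nn_integral_distr[symmetric]) measurable
  ultimately have sym: "(\<integral>\<^sup>+x. ennreal (f ((- 1 *\<^sub>R L) *v x)) \<partial>std_gaussian) < top"
    using fin by metis
  have "ennreal (- f (L *v x)) \<le> ennreal (2 * \<bar>f 0\<bar>) + ennreal (f ((- 1 *\<^sub>R L) *v x))" for x
  proof -
    have "f ((1 - 1/2) *\<^sub>R (L *v x) + (1/2) *\<^sub>R (- (L *v x))) \<le> (1 - 1/2) * f (L *v x) + 1/2 * f (- (L *v x))"
      by (rule convex_onD[OF f]) auto
    then have "- f (L *v x) \<le> 2 * \<bar>f 0\<bar> + f (- (L *v x))" by simp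
    also have "\<dots> \<le> 2 * \<bar>f 0\<bar> + max 0 (f (- (L *v x)))" by simp
    finally have "ennreal (- f (L *v x)) \<le> ennreal (2 * \<bar>f 0\<bar> + max 0 (f (- (L *v x))))"
      by (rule ennreal_leI)
    also have "\<dots> = ennreal (2 * \<bar>f 0\<bar>) + ennreal (f (- (L *v x)))"
      by (subst ennreal_plus) (auto simp: max_def ennreal_neg)
    finally show ?thesis unfolding scaleR_matrix_vector_assoc[symmetric] by simp
  qed
  then have "(\<integral>\<^sup>+x. ennreal (- f (L *v x)) \<partial>std_gaussian)
      \<le> (\<integral>\<^sup>+x. ennreal (2 * \<bar>f 0\<bar>) + ennreal (f ((- 1 *\<^sub>R L) *v x)) \<partial>std_gaussian)"
    by (intro nn_integral_mono)
  also have "\<dots> < top"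
    using sym emeasure_space_1
    by (subst nn_integral_add) (auto simp: ennreal_mult_less_top)
  finally show ?thesis using fin by (auto simp: real_integrable_def)
qed

text \<open>With \<open>a = A\<^sup>1\<^sup>/\<^sup>2\<close>, \<open>c = (S - A)\<^sup>1\<^sup>/\<^sup>2\<close> and a standard Gaussian vector \<open>(x, y)\<close>, the vectors \<open>a x + c y\<close> and
  \<open>a x - c y\<close> both have covariance \<open>S\<close>, and \<open>a x\<close> is their midpoint.\<close>

lemma convex_order_gaussian:
  fixes A S :: "real^'n^'n"
  assumes A: "psd A" and SA: "psd (S - A)"
  shows "convex_order (gaussian 0 A) (gaussian 0 S)"
  unfolding convex_order_def
proof (intro allI impI)
  fix f :: "real^'n \<Rightarrow> real" assume f: "convex_on UNIV f"
  have [measurable]: "f \<in> borel_measurable borel" by (rule convex_on_borel_measurable[OF f])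
  let ?a = "matrix_sqrt A" and ?c = "matrix_sqrt (S - A)"
  let ?E1 = "coord_proj Inl :: real^('n + 'n)^'n" and ?E2 = "coord_proj Inr :: real^('n + 'n)^'n"
  let ?Z = "std_gaussian :: (real^('n + 'n)) measure"
  have EE: "X ** ?E1 ** transpose ?E1 = X" "X ** ?E2 ** transpose ?E2 = X"
    "X ** ?E1 ** transpose ?E2 = 0" "X ** ?E2 ** transpose ?E1 = 0" for X :: "real^'n^'n"
    by (simp_all add: coord_proj_mult_transpose_self coord_proj_Inl_Inr flip: matrix_mul_assoc)
  have sq: "transpose ?a = ?a" "?a ** ?a = A" "transpose ?c = ?c" "?c ** ?c = S - A"
    using A SA by (simp_all add: psd_matrix_sqrt psdD matrix_sqrt_mult_self)
  define L0 where "L0 = ?a ** ?E1"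
  define Lp where "Lp = ?a ** ?E1 + ?c ** ?E2"
  define Lm where "Lm = ?a ** ?E1 - ?c ** ?E2"
  have "- ?c ** ?c = - (?c ** ?c)"
    by (simp add: matrix_matrix_mult_def vec_eq_iff sum_negf)
  then have "L0 ** transpose L0 = A" "Lp ** transpose Lp = S" "Lm ** transpose Lm = S"
    by (simp_all add: L0_def Lp_def Lm_def matrix_transpose_mul transpose_add transpose_diff
        matrix_add_ldistrib matrix_add_rdistrib matrix_diff_ldistrib matrix_diff_rdistrib sq EE
        matrix_mul_assoc)
  then have law: "gaussian 0 A = distr ?Z borel ((*v) L0)" "gaussian 0 S = distr ?Z borel ((*v) Lp)"
    "gaussian 0 S = distr ?Z borel ((*v) Lm)"
    by (simp_all add: std_gaussian_linear_image)
  have nn: "(\<integral>\<^sup>+x. ennreal (f (X *v x)) \<partial>?Z) = (\<integral>\<^sup>+x. ennreal (f x) \<partial>distr ?Z borel ((*v) X))" for X :: "real^('n+'n)^'n"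
    by (rule nn_integral_distr[symmetric]) measurable
  have ext: "extended_integral (distr ?Z borel ((*v) X)) f = extended_integral ?Z (\<lambda>x. f (X *v x))" for X :: "real^('n+'n)^'n"
    by (rule extended_integral_distr) measurable
  show "extended_integral (gaussian 0 A) f \<le> extended_integral (gaussian 0 S) f"
  proof (cases "(\<integral>\<^sup>+x. ennreal (f x) \<partial>gaussian 0 S) = top")
    case True
    then show ?thesis by (simp add: extended_integral_top)
  next
    case False
    then have fin: "(\<integral>\<^sup>+x. ennreal (f (Lp *v x)) \<partial>?Z) < top" "(\<integral>\<^sup>+x. ennreal (f (Lm *v x)) \<partial>?Z) < top"
      by (simp_all add: nn law(2,3)[symmetric] less_top)
    note int = convex_on_std_gaussian_integrable[OF f fin(1)] convex_on_std_gaussian_integrable[OF f fin(2)]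
    have le: "f (L0 *v x) \<le> 1/2 * f (Lp *v x) + 1/2 * f (Lm *v x)" for x
    proof -
      have "f ((1 - 1/2) *\<^sub>R (Lp *v x) + (1/2) *\<^sub>R (Lm *v x)) \<le> (1 - 1/2) * f (Lp *v x) + 1/2 * f (Lm *v x)"
        by (rule convex_onD[OF f]) auto
      also have "(1 - 1/2) *\<^sub>R (Lp *v x) + (1/2) *\<^sub>R (Lm *v x) = L0 *v x"
        by (simp add: Lp_def Lm_def L0_def matrix_vector_mult_add_rdistrib matrix_vector_mult_diff_rdistrib
            scaleR_add_right scaleR_diff_right flip: scaleR_add_left)
      finally show ?thesis by simp
    qed
    have "(\<integral>\<^sup>+x. ennreal (f (L0 *v x)) \<partial>?Z) \<le> (\<integral>\<^sup>+x. ennreal \<bar>1/2 * f (Lp *v x) + 1/2 * f (Lm *v x)\<bar> \<partial>?Z)"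
      by (intro nn_integral_mono ennreal_leI order_trans[OF le]) simp
    also have "\<dots> < top"
    proof -
      have "integrable ?Z (\<lambda>x. 1/2 * f (Lp *v x) + 1/2 * f (Lm *v x))" using int by simp
      then show ?thesis unfolding integrable_iff_bounded real_norm_def by simp
    qed
    finally have int0: "integrable ?Z (\<lambda>x. f (L0 *v x))"
      by (rule convex_on_std_gaussian_integrable[OF f])
    have same: "(\<integral>x. f (Lm *v x) \<partial>?Z) = (\<integral>x. f (Lp *v x) \<partial>?Z)"
    proof -
      have "(\<integral>x. f (X *v x) \<partial>?Z) = (\<integral>x. f x \<partial>distr ?Z borel ((*v) X))" for X :: "real^('n+'n)^'n"
        by (rule integral_distr[symmetric]) measurable
      then show ?thesis using law(2,3) by metis
    qed
    have "(\<integral>x. f (L0 *v x) \<partial>?Z) \<le> (\<integral>x. 1/2 * f (Lp *v x) + 1/2 * f (Lm *v x) \<partial>?Z)"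
      using int int0 le by (intro integral_mono) auto
    also have "\<dots> = (\<integral>x. f (Lp *v x) \<partial>?Z)"
      using int same by simp
    finally show ?thesis
      using int int0 unfolding law(1,2) by (simp add: ext extended_integral_integrable)
  qed
qed

text \<open>Linear functions test the means: with \<open>u\<close> the difference of the means, its
  squared norm comes out nonpositive. The convex functions \<open>(u . x)^2\<close> test the second
  moments in every direction.\<close>

lemma
  fixes \<mu> \<eta> :: "(real^'n) measure"
  assumes P2: "\<mu> \<in> P2" "\<eta> \<in> P2" and cx: "convex_order \<mu> \<eta>"
  shows convex_order_integral_eq: "(\<integral>x. x \<partial>\<mu>) = (\<integral>x. x \<partial>\<eta>)"
    and convex_order_second_moment: "psd (second_moment \<eta> - second_moment \<mu>)"
proof -
  have le: "integral\<^sup>L \<mu> f \<le> integral\<^sup>L \<eta> f" if "convex_on UNIV f" "integrable \<mu> f" "integrable \<eta> f" for f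
    using cx that by (auto simp: convex_order_def extended_integral_integrable)
  have lin: "integrable \<xi> (\<lambda>x. u \<bullet> x)" "(\<integral>x. u \<bullet> x \<partial>\<xi>) = u \<bullet> (\<integral>x. x \<partial>\<xi>)" if "\<xi> \<in> P2" for \<xi> :: "(real^'n) measure" and u
    using P2_integrable_id[OF that] by simp_all
  have "u \<bullet> (\<integral>x. x \<partial>\<mu>) \<le> u \<bullet> (\<integral>x. x \<partial>\<eta>)" for u
    using le[of "\<lambda>x. u \<bullet> x"] lin P2 by (simp add: convex_on_def inner_add_right)
  from this[of "(\<integral>x. x \<partial>\<mu>) - (\<integral>x. x \<partial>\<eta>)"]
  have "((\<integral>x. x \<partial>\<mu>) - (\<integral>x. x \<partial>\<eta>)) \<bullet> ((\<integral>x. x \<partial>\<mu>) - (\<integral>x. x \<partial>\<eta>)) \<le> 0"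
    by (simp add: inner_diff_right)
  then show "(\<integral>x. x \<partial>\<mu>) = (\<integral>x. x \<partial>\<eta>)"
    by (metis inner_gt_zero_iff not_le right_minus_eq)
  have "0 \<le> u \<bullet> ((second_moment \<eta> - second_moment \<mu>) *v u)" for u
  proof -
    let ?V = "(\<chi> i j. u $ i * u $ j) :: real^'n^'n"
    have eq: "(u \<bullet> x)\<^sup>2 = x \<bullet> (?V *v x)" for x
      by (simp add: matrix_vector_mult_def inner_vec_def sum_distrib_left sum_distrib_right power2_eq_square mult_ac)
    have tr: "trace (?V ** X) = u \<bullet> (X *v u)" if "transpose X = X" for X
    proof -
      have "X $ i $ j = X $ j $ i" for i j using that by (metis transpose_def vec_lambda_beta)
      then show ?thesis
        by (simp add: trace_def matrix_matrix_mult_def matrix_vector_mult_def inner_vec_def sum_distrib_left mult_ac)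
    qed
    have "convex_on UNIV (\<lambda>x. (u \<bullet> x)\<^sup>2)"
    proof (rule convex_onI)
      fix t :: real and x y assume t: "0 < t" "t < 1"
      have "(1 - t) * (u \<bullet> x)\<^sup>2 + t * (u \<bullet> y)\<^sup>2 - (u \<bullet> ((1 - t) *\<^sub>R x + t *\<^sub>R y))\<^sup>2
          = (1 - t) * t * (u \<bullet> x - u \<bullet> y)\<^sup>2"
        by (simp add: inner_add_right power2_eq_square algebra_simps)
      also have "\<dots> \<ge> 0" using t by simp
      finally show "(u \<bullet> ((1 - t) *\<^sub>R x + t *\<^sub>R y))\<^sup>2 \<le> (1 - t) * (u \<bullet> x)\<^sup>2 + t * (u \<bullet> y)\<^sup>2" by simp
    qed simp
    from le[OF this] have "trace (?V ** second_moment \<mu>) \<le> trace (?V ** second_moment \<eta>)"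
      unfolding eq using P2 by (simp add: P2_integrable_quadratic P2_integral_quadratic)
    then show ?thesis
      by (simp add: tr transpose_second_moment matrix_vector_mult_diff_rdistrib inner_diff_right)
  qed
  then show "psd (second_moment \<eta> - second_moment \<mu>)"
    by (simp add: psd_def transpose_diff transpose_second_moment)
qed

lemma
  assumes "\<pi> \<in> couplings \<mu> \<nu>"
  shows couplings_sets: "sets \<pi> = sets borel" and couplings_prob_space: "prob_space \<pi>"
    and couplings_fst: "distr \<pi> borel fst = \<mu>" and couplings_snd: "distr \<pi> borel snd = \<nu>"
  using assms by (auto simp: couplings_def)

lemma borel_measurable_fst_snd [measurable]:
  "(fst :: 'a::euclidean_space \<times> 'a \<Rightarrow> 'a) \<in> borel_measurable borel"
  "(snd :: 'a::euclidean_space \<times> 'a \<Rightarrow> 'a) \<in> borel_measurable borel"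
  by (auto intro!: borel_measurable_continuous_onI continuous_intros)

text \<open>The independent coupling has finite cost for measures in \<open>P2\<close>, which makes
  the infimum over couplings finite.\<close>

lemma pair_measure_in_couplings:
  fixes \<mu> \<nu> :: "'a::euclidean_space measure"
  assumes "prob_space \<mu>" "prob_space \<nu>" "sets \<mu> = sets borel" "sets \<nu> = sets borel"
  shows "\<mu> \<Otimes>\<^sub>M \<nu> \<in> couplings \<mu> \<nu>"
proof -
  interpret \<mu>: prob_space \<mu> by fact
  interpret \<nu>: prob_space \<nu> by fact
  interpret pair_prob_space \<mu> \<nu> ..
  have [measurable_cong]: "sets \<mu> = sets borel" "sets \<nu> = sets borel" by fact+
  have s: "sets (\<mu> \<Otimes>\<^sub>M \<nu>) = sets borel"
    unfolding borel_prod[symmetric] by (rule sets_pair_measure_cong[OF assms(3,4)])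
  have "distr (\<mu> \<Otimes>\<^sub>M \<nu>) borel fst = distr (\<mu> \<Otimes>\<^sub>M \<nu>) \<mu> fst"
    using assms by (intro distr_cong) auto
  then have 1: "distr (\<mu> \<Otimes>\<^sub>M \<nu>) borel fst = \<mu>" by (simp add: \<nu>.distr_pair_fst)
  have "distr (\<mu> \<Otimes>\<^sub>M \<nu>) borel snd = \<nu>"
  proof (rule measure_eqI)
    fix B assume "B \<in> sets (distr (\<mu> \<Otimes>\<^sub>M \<nu>) borel snd)"
    then have B: "B \<in> sets \<nu>" using assms by simp
    have "snd -` B \<inter> space (\<mu> \<Otimes>\<^sub>M \<nu>) = space \<mu> \<times> B"
      using sets.sets_into_space[OF B] by (auto simp: space_pair_measure)
    then show "emeasure (distr (\<mu> \<Otimes>\<^sub>M \<nu>) borel snd) B = emeasure \<nu> B"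
      using B assms(4) by (simp add: emeasure_distr \<nu>.emeasure_pair_measure_Times \<mu>.emeasure_space_1)
  qed (use assms in simp)
  with 1 s show ?thesis by (simp add: couplings_def prob_space_axioms)
qed

text \<open>This replaces the existence of optimal couplings, which would require a compactness argument.\<close>

lemma close_couplings_imp_eq:
  fixes \<alpha> \<beta> :: "'a::euclidean_space measure"
  assumes \<alpha>: "prob_space \<alpha>" "sets \<alpha> = sets borel" and \<beta>: "prob_space \<beta>" "sets \<beta> = sets borel"
    and close: "\<And>\<epsilon>. \<epsilon> > 0 \<Longrightarrow> \<exists>\<pi>\<in>couplings \<alpha> \<beta>. (\<integral>\<^sup>+z. ennreal ((dist (fst z) (snd z))\<^sup>2) \<partial>\<pi>) \<le> ennreal \<epsilon>"
  shows "\<alpha> = \<beta>"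
proof -
  interpret A: prob_space \<alpha> by fact
  interpret B: prob_space \<beta> by fact
  have nbhd: "measure \<beta> {y. infdist y C \<le> \<delta>} \<ge> measure \<alpha> C" "measure \<alpha> {y. infdist y C \<le> \<delta>} \<ge> measure \<beta> C"
    if C: "closed C" "C \<noteq> {}" and "\<delta> > 0" for C \<delta>
  proof -
    have m [measurable]: "C \<in> sets borel" "{y. infdist y C \<le> \<delta>} \<in> sets borel"
      using C by (auto intro!: borel_closed closed_Collect_le continuous_intros)
    have *: "measure \<alpha> C \<le> measure \<beta> {y. infdist y C \<le> \<delta>} + \<epsilon>" "measure \<beta> C \<le> measure \<alpha> {y. infdist y C \<le> \<delta>} + \<epsilon>"
      if \<epsilon>: "\<epsilon> > 0" for \<epsilon>
    proof -
      obtain \<pi> where \<pi>: "\<pi> \<in> couplings \<alpha> \<beta>"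
        and cost: "(\<integral>\<^sup>+z. ennreal ((dist (fst z) (snd z))\<^sup>2) \<partial>\<pi>) \<le> ennreal (\<epsilon> * \<delta>\<^sup>2)"
        using close[of "\<epsilon> * \<delta>\<^sup>2"] \<epsilon> \<open>\<delta> > 0\<close> by auto
      interpret P: prob_space \<pi> by (rule couplings_prob_space[OF \<pi>])
      have [measurable_cong]: "sets \<pi> = sets borel" by (rule couplings_sets[OF \<pi>])
      have [simp]: "space \<pi> = UNIV" using couplings_sets[OF \<pi>, THEN sets_eq_imp_space_eq] by simp
      \<comment> \<open>By Markov's inequality the pairs at distance at least
        \<open>\<delta>\<close> have mass at most the cost over \<open>\<delta>^2\<close>, that is,
        at most \<open>\<epsilon>\<close>; all other mass from \<open>C\<close> lands within
        \<open>\<delta>\<close> of it.\<close>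
      let ?F = "{z. \<delta> \<le> dist (fst z) (snd z)}"
      have F [measurable]: "?F \<in> sets \<pi>"
        unfolding couplings_sets[OF \<pi>] by (intro borel_closed closed_Collect_le continuous_intros)
      have "ennreal (\<delta>\<^sup>2) * emeasure \<pi> ?F = (\<integral>\<^sup>+z. ennreal (\<delta>\<^sup>2) * indicator ?F z \<partial>\<pi>)"
        by (rule nn_integral_cmult_indicator[symmetric]) measurable
      also have "\<dots> \<le> (\<integral>\<^sup>+z. ennreal ((dist (fst z) (snd z))\<^sup>2) \<partial>\<pi>)"
        using \<open>\<delta> > 0\<close> by (intro nn_integral_mono) (auto simp: indicator_def intro!: ennreal_leI power_mono)
      also note cost
      finally have "ennreal (\<delta>\<^sup>2 * measure \<pi> ?F) \<le> ennreal (\<delta>\<^sup>2 * \<epsilon>)"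
        by (simp add: P.emeasure_eq_measure ennreal_mult mult.commute)
      then have Fle: "measure \<pi> ?F \<le> \<epsilon>"
        using \<open>\<delta> > 0\<close> \<epsilon> by (simp add: ennreal_le_iff)
      have marg: "measure \<alpha> D = measure \<pi> {z. fst z \<in> D}" "measure \<beta> D = measure \<pi> {z. snd z \<in> D}"
        if [measurable]: "D \<in> sets borel" for D
      proof -
        have "measure (distr \<pi> borel fst) D = measure \<pi> (fst -` D \<inter> space \<pi>)"
          "measure (distr \<pi> borel snd) D = measure \<pi> (snd -` D \<inter> space \<pi>)"
          by (rule measure_distr; measurable)+
        then show "measure \<alpha> D = measure \<pi> {z. fst z \<in> D}" "measure \<beta> D = measure \<pi> {z. snd z \<in> D}"
          by (simp_all add: couplings_fst[OF \<pi>] couplings_snd[OF \<pi>] vimage_def)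
      qed
      have inf: "infdist y C \<le> \<delta>" if "x \<in> C" "\<not> \<delta> \<le> dist x y" for x y
        using infdist_le2[OF that(1), of y \<delta>] that(2) by (simp add: dist_commute)
      have ms: "{z. fst z \<in> D} \<in> sets \<pi>" "{z. snd z \<in> D} \<in> sets \<pi>" if [measurable]: "D \<in> sets borel" for D
        by measurable
      have "measure \<pi> {z. fst z \<in> C} \<le> measure \<pi> ({z. snd z \<in> {y. infdist y C \<le> \<delta>}} \<union> ?F)"
        using inf by (intro P.finite_measure_mono sets.Un ms m F) auto
      also have "\<dots> \<le> measure \<pi> {z. snd z \<in> {y. infdist y C \<le> \<delta>}} + measure \<pi> ?F"
        by (intro measure_Un_le ms m F)
      finally show "measure \<alpha> C \<le> measure \<beta> {y. infdist y C \<le> \<delta>} + \<epsilon>"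
        using Fle marg m by simp
      have "measure \<pi> {z. snd z \<in> C} \<le> measure \<pi> ({z. fst z \<in> {y. infdist y C \<le> \<delta>}} \<union> ?F)"
        using inf by (intro P.finite_measure_mono sets.Un ms m F) (auto simp: dist_commute)
      also have "\<dots> \<le> measure \<pi> {z. fst z \<in> {y. infdist y C \<le> \<delta>}} + measure \<pi> ?F"
        by (intro measure_Un_le ms m F)
      finally show "measure \<beta> C \<le> measure \<alpha> {y. infdist y C \<le> \<delta>} + \<epsilon>"
        using Fle marg m by simp
    qed
    show "measure \<beta> {y. infdist y C \<le> \<delta>} \<ge> measure \<alpha> C" "measure \<alpha> {y. infdist y C \<le> \<delta>} \<ge> measure \<beta> C"
      using * by (auto intro: field_le_epsilon)
  qed
  have lim: "(\<lambda>n. measure \<xi> {y. infdist y C \<le> 1 / real (Suc n)}) \<longlonglongrightarrow> measure \<xi> C"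
    if C: "closed C" "C \<noteq> {}" and "finite_measure \<xi>" "sets \<xi> = sets borel" for C :: "'a set" and \<xi>
  proof -
    interpret finite_measure \<xi> by fact
    have "(\<lambda>n. measure \<xi> {y. infdist y C \<le> 1 / real (Suc n)}) \<longlonglongrightarrow> measure \<xi> (\<Inter>n. {y. infdist y C \<le> 1 / real (Suc n)})"
    proof (rule finite_Lim_measure_decseq)
      show "range (\<lambda>n. {y. infdist y C \<le> 1 / real (Suc n)}) \<subseteq> sets \<xi>"
        using \<open>sets \<xi> = sets borel\<close> by (auto intro!: borel_closed closed_Collect_le continuous_intros)
      show "decseq (\<lambda>n. {y. infdist y C \<le> 1 / real (Suc n)})"
        unfolding decseq_def by (intro allI impI Collect_mono, erule order_trans) (simp add: frac_le)
    qed
    also have "(\<Inter>n. {y. infdist y C \<le> 1 / real (Suc n)}) = C"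
    proof
      show "(\<Inter>n. {y. infdist y C \<le> 1 / real (Suc n)}) \<subseteq> C"
      proof
        fix y assume "y \<in> (\<Inter>n. {y. infdist y C \<le> 1 / real (Suc n)})"
        then have "infdist y C \<le> 1 / real (Suc n)" for n by blast
        then have "infdist y C \<le> 0"
          using LIMSEQ_le_const[OF LIMSEQ_inverse_real_of_nat] by (simp add: inverse_eq_divide)
        then have "infdist y C = 0" using infdist_nonneg[of y C] by linarith
        then show "y \<in> C" using in_closed_iff_infdist_zero[OF C] by simp
      qed
    qed (auto)
    finally show ?thesis .
  qed
  \<comment> \<open>Closed neighbourhoods shrink to \<open>C\<close> unless it is empty:
    \<open>infdist\<close> to the empty set is 0 by convention, so that case is treated
    apart.\<close>
  have eq: "emeasure \<alpha> C = emeasure \<beta> C" if "closed C" for C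
  proof (cases "C = {}")
    case False
    have "measure \<alpha> C \<le> measure \<beta> C"
      by (rule LIMSEQ_le_const[OF lim[OF that False B.finite_measure_axioms \<beta>(2)]])
        (use nbhd(1)[OF that False] in auto)
    moreover have "measure \<beta> C \<le> measure \<alpha> C"
      by (rule LIMSEQ_le_const[OF lim[OF that False A.finite_measure_axioms \<alpha>(2)]])
        (use nbhd(2)[OF that False] in auto)
    ultimately show ?thesis by (simp add: A.emeasure_eq_measure B.emeasure_eq_measure)
  qed simp
  show ?thesis
  proof (rule measure_eqI_generator_eq[where E = "Collect closed" and \<Omega> = UNIV and A = "\<lambda>_. UNIV"])
    show "Int_stable (Collect closed :: 'a set set)" by (auto simp: Int_stable_def)
    show "sets \<alpha> = sigma_sets UNIV (Collect closed)" "sets \<beta> = sigma_sets UNIV (Collect closed)"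
      using \<alpha>(2) \<beta>(2) by (simp_all add: borel_eq_closed)
  qed (use eq in auto)
qed


section \<open>Projections for a degenerate Gaussian\<close>

text \<open>Turns the weighted size of the gap into a Euclidean one: at \<open>M z\<close> with
  \<open>T M = I\<close> it bounds \<open>|z|^2\<close> by \<open>tr T\<close> times
  \<open>z . M z\<close>.\<close>

lemma psd_vec_norm_bound:
  fixes T :: "real^'n^'n"
  assumes "psd T"
  shows "(norm (T *v x))\<^sup>2 \<le> trace T * (x \<bullet> (T *v x))"
proof -
  obtain R where R: "psd R" "R ** R = T" using psd_sqrt_exists[OF assms] .
  have "T *v x = R *v (R *v x)" by (simp add: matrix_vector_mul_assoc R)
  then have "norm (T *v x) \<le> norm R * norm (R *v x)" by (simp add: norm_matrix_vector_mult_le)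
  then have "(norm (T *v x))\<^sup>2 \<le> (norm R)\<^sup>2 * (norm (R *v x))\<^sup>2"
    by (metis norm_ge_zero power_mono power_mult_distrib)
  also have "(norm R)\<^sup>2 = trace T"
    using trace_mult_transpose[of R] R by (simp add: psdD)
  also have "(norm (R *v x))\<^sup>2 = x \<bullet> (T *v x)"
    using inner_matrix_vector_mult[of x R "R *v x"] R
    by (simp add: power2_norm_eq_inner matrix_vector_mul_assoc psdD)
  finally show ?thesis .
qed

text \<open>\<open>M\<close> and \<open>T\<close> enter through the optimality conditions alone, as
  a certificate. \<open>G\<close> is a coisometry: \<open>G^T G\<close> is the orthogonal projection
  onto a subspace that carries the degenerate Gaussian.\<close>

locale degenerate_projection =
  fixes G :: "real^'n^'m" and \<Lambda> M T :: "real^'m^'m" and S\<mu> :: "real^'n^'n"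
  assumes GG: "G ** transpose G = mat 1"
    and psd_\<Lambda>: "psd \<Lambda>" and psd_S\<mu>: "psd S\<mu>"
    and psd_M: "psd M" and psd_1_M: "psd (mat 1 - M)" and psd_T: "psd T" and MT: "M ** T = mat 1"
    and expansion: "psd (T ** \<Lambda> ** T - G ** S\<mu> ** transpose G)"
    and slackness: "trace ((mat 1 - M) ** (T ** \<Lambda> ** T - G ** S\<mu> ** transpose G)) = 0"
begin

definition "\<Gamma> = T ** \<Lambda> ** T"
definition "P = mat 1 - transpose G ** M ** G"
definition "S\<^sub>s = S\<mu> + transpose G ** (\<Gamma> - G ** S\<mu> ** transpose G) ** G"
definition "S\<nu> = transpose G ** \<Lambda> ** G"
text \<open>The minimal squared distance: what is left of the cost when the trace term and the gap
  term both vanish.\<close>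

definition "c0 = trace ((mat 1 - transpose G ** T ** G) ** S\<nu>) + trace (P ** S\<mu>)"

lemma GG_simps: "G ** (transpose G ** X) = X" "Y ** G ** transpose G = Y"
  by (simp_all add: matrix_mul_assoc GG) (simp add: GG flip: matrix_mul_assoc)

lemma TM: "T ** M = mat 1"
  using MT by (simp add: matrix_left_right_inverse)

lemma psd_\<Gamma>: "psd \<Gamma>"
  unfolding \<Gamma>_def using psd_congruence[OF psd_\<Lambda>, of T] by (simp add: psdD(1)[OF psd_T])

lemma psd_S\<nu>: "psd S\<nu>"
  using psd_congruence[OF psd_\<Lambda>, of "transpose G"] by (simp add: S\<nu>_def)

text \<open>The orthogonal projection onto the kernel of \<open>G\<close>, the directions in which
  the projected Gaussian is degenerate.\<close>

definition "H = mat 1 - transpose G ** G"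

lemma H: "transpose H = H" "H ** H = H" "psd H"
proof -
  show 1: "transpose H = H" by (simp add: H_def transpose_diff matrix_transpose_mul)
  show 2: "H ** H = H"
    by (simp add: H_def matrix_diff_ldistrib matrix_diff_rdistrib GG_simps flip: matrix_mul_assoc)
  show "psd H" using psd_mult_transpose[of H] 1 2 by simp
qed

lemma P_eq: "P = H + transpose G ** (mat 1 - M) ** G"
  by (simp add: P_def H_def matrix_diff_ldistrib matrix_diff_rdistrib)

lemma psd_P: "psd P"
  unfolding P_eq using psd_congruence[OF psd_1_M, of "transpose G"] by (intro psd_add H) simp

lemma S\<^sub>s_diff: "S\<^sub>s - S\<mu> = transpose G ** (\<Gamma> - G ** S\<mu> ** transpose G) ** G"
  by (simp add: S\<^sub>s_def)

lemma psd_S\<^sub>s_diff: "psd (S\<^sub>s - S\<mu>)"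
  using psd_congruence[OF expansion, of "transpose G"] by (simp add: S\<^sub>s_diff \<Gamma>_def)

lemma psd_S\<^sub>s: "psd S\<^sub>s"
  using psd_add[OF psd_S\<mu> psd_S\<^sub>s_diff] by simp

lemma S\<^sub>s_compress: "G ** S\<^sub>s ** transpose G = \<Gamma>"
  by (simp add: S\<^sub>s_def matrix_add_ldistrib matrix_add_rdistrib GG_simps matrix_mul_assoc GG)

text \<open>The difference lives on the range of \<open>G^T\<close>, where \<open>P\<close>
  compresses to \<open>I - M\<close>; there complementary slackness applies.\<close>

lemma trace_P_S\<^sub>s: "trace (P ** (S\<^sub>s - S\<mu>)) = 0"
proof -
  let ?D = "\<Gamma> - G ** S\<mu> ** transpose G"
  have "G ** P ** transpose G = mat 1 - M"
    by (simp add: P_def matrix_diff_ldistrib matrix_diff_rdistrib GG GG_simps flip: matrix_mul_assoc)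
  moreover have "trace (P ** (S\<^sub>s - S\<mu>)) = trace (G ** P ** transpose G ** ?D)"
    unfolding S\<^sub>s_diff using trace_mul_sym[of "P ** transpose G ** ?D" G] by (simp add: matrix_mul_assoc)
  ultimately show ?thesis using slackness by (simp add: \<Gamma>_def)
qed

text \<open>Since \<open>P >= H\<close>, zero trace against \<open>P\<close> gives
  \<open>tr(H D H) = 0\<close>, hence \<open>D H = 0\<close>. So \<open>D\<close> is concentrated on
  the range of \<open>G^T\<close>, where the last hypothesis prescribes it. This is why a projection
  alters no entry of the covariance outside the block.\<close>

lemma rigidity:
  assumes D: "psd D" and tr: "trace (P ** D) = 0"
    and c: "G ** D ** transpose G = \<Gamma> - G ** S\<mu> ** transpose G"
  shows "D = S\<^sub>s - S\<mu>"
proof -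
  have "0 \<le> trace (H ** D)" by (rule trace_mult_psd_nonneg[OF H(3) D])
  moreover have "psd (P - H)"
    using psd_congruence[OF psd_1_M, of "transpose G"] by (simp add: P_eq)
  then have "trace (H ** D) \<le> trace (P ** D)" using trace_mult_psd_mono(2)[OF D] by blast
  ultimately have "trace (H ** D) = 0" using tr by simp
  moreover have "trace (H ** D ** transpose H) = trace (H ** D)"
    using trace_mul_sym[of "H ** D" H] H by (simp add: matrix_mul_assoc)
  ultimately have HDH: "H ** D ** transpose H = 0"
    using psd_trace_0[OF psd_congruence[OF D, of H]] by simp
  have "D *v (H *v x) = 0" for x
  proof (rule psd_null_vector[OF D])
    have "(H *v x) \<bullet> (D *v (H *v x)) = x \<bullet> (H *v (D *v (H *v x)))"
      using inner_matrix_vector_mult[of x H "D *v (H *v x)"] H(1) by simp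
    also have "\<dots> = x \<bullet> ((H ** D ** transpose H) *v x)"
      by (simp only: matrix_vector_mul_assoc H(1) matrix_mul_assoc)
    finally show "(H *v x) \<bullet> (D *v (H *v x)) = 0" by (simp add: HDH)
  qed
  then have "D ** H = 0" by (simp add: matrix_eq_0_iff flip: matrix_vector_mul_assoc)
  then have r: "D ** (transpose G ** G) = D" by (simp add: H_def matrix_diff_ldistrib)
  then have "transpose (D ** (transpose G ** G)) = transpose D" by simp
  then have l: "(transpose G ** G) ** D = D" by (simp add: matrix_transpose_mul psdD(1)[OF D])
  have "D = (transpose G ** G) ** (D ** (transpose G ** G))" using l r by simp
  also have "\<dots> = transpose G ** (G ** D ** transpose G) ** G" by (simp add: matrix_mul_assoc)
  finally show ?thesis unfolding c S\<^sub>s_diff .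
qed

text \<open>The defect in \<open>G y = T G x\<close>, the relation satisfied by the coupling that
  attains the minimum.\<close>

abbreviation "gap z \<equiv> G *v snd z - (T ** G) *v fst z"

text \<open>The first marginal is an image under \<open>G^T\<close>, on whose range
  \<open>G^T G\<close> acts as the identity.\<close>

lemma AE_coupling_fst:
  assumes "\<pi> \<in> couplings (gaussian 0 S\<nu>) \<eta>"
  shows "AE z in \<pi>. (transpose G ** G) *v fst z = fst z"
proof -
  have [measurable_cong]: "sets \<pi> = sets borel" by (rule couplings_sets[OF assms])
  have 1: "gaussian 0 S\<nu> = distr (gaussian 0 \<Lambda>) borel ((*v) (transpose G))"
    by (simp add: gaussian_linear_image[OF psd_\<Lambda>] S\<nu>_def del: transpose_matrix_vector)
  have "AE x in gaussian 0 S\<nu>. (transpose G ** G) *v x = x"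
  proof -
    have "(transpose G ** G) *v (transpose G *v x) = transpose G *v x" for x
      by (simp only: matrix_vector_mul_assoc matrix_mul_assoc[symmetric] GG matrix_mul_rid)
    then show ?thesis
      unfolding 1 by (subst AE_distr_iff) (auto simp del: transpose_matrix_vector)
  qed
  then show ?thesis
    unfolding couplings_fst[OF assms, symmetric] by (subst (asm) AE_distr_iff) auto
qed

text \<open>The hypothesis holds on the support of the first marginal. It is only through the nonnegative last
  term that \<open>x\<close> and \<open>y\<close> interact.\<close>

lemma dist_decomposition:
  assumes "(transpose G ** G) *v x = x"
  shows "(dist x y)\<^sup>2 = x \<bullet> ((mat 1 - transpose G ** T ** G) *v x) + y \<bullet> (P *v y)
    + (G *v y - (T ** G) *v x) \<bullet> (M *v (G *v y - (T ** G) *v x))"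
proof -
  define a b where "a = G *v x" and "b = G *v y"
  have adj: "u \<bullet> ((transpose G ** X ** G) *v v) = (G *v u) \<bullet> (X *v (G *v v))" for u v X
  proof -
    have "u \<bullet> ((transpose G ** X ** G) *v v) = u \<bullet> (transpose G *v (X *v (G *v v)))"
      by (simp only: matrix_vector_mul_assoc matrix_mul_assoc)
    then show ?thesis using inner_matrix_vector_mult[of u "transpose G" "X *v (G *v v)"] by simp
  qed
  have xy: "x \<bullet> y = a \<bullet> b"
  proof -
    have "y \<bullet> x = y \<bullet> ((transpose G ** mat 1 ** G) *v x)" using assms by simp
    then show ?thesis unfolding adj by (simp add: a_def b_def inner_commute)
  qed
  have MTa: "M *v (T *v a) = a" using MT by (simp add: matrix_vector_mul_assoc)
  have TGx: "(T ** G) *v x = T *v a" by (simp add: a_def matrix_vector_mul_assoc)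
  have "(b - T *v a) \<bullet> (M *v (b - T *v a)) = b \<bullet> (M *v b) - 2 * (a \<bullet> b) + a \<bullet> (T *v a)"
    using inner_matrix_vector_commute[OF psdD(1)[OF psd_M], of "T *v a" b] inner_commute[of a b]
      inner_commute[of a "T *v a"]
    by (simp add: matrix_vector_mult_diff_distrib inner_diff_left inner_diff_right MTa)
  moreover have "(dist x y)\<^sup>2 = x \<bullet> x + y \<bullet> y - 2 * (x \<bullet> y)"
    by (simp add: dist_norm power2_norm_eq_inner inner_diff_left inner_diff_right inner_commute)
  ultimately show ?thesis
    by (simp add: TGx P_def matrix_vector_mult_diff_rdistrib inner_diff_right adj xy flip: a_def b_def)
qed

text \<open>The quadratic terms in \<open>x\<close> and \<open>y\<close> integrate to traces against
  the second moments of the marginals; adding and subtracting \<open>tr(P S\<mu>)\<close> separates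
  \<open>c0\<close>. Nonnegativity is recorded because \<open>ennreal\<close> truncates negative
  numbers to 0.\<close>

lemma
  assumes \<pi>: "\<pi> \<in> couplings (gaussian 0 S\<nu>) \<eta>" and \<eta>: "\<eta> \<in> P2"
  shows coupling_gap_integrable: "integrable \<pi> (\<lambda>z. gap z \<bullet> (M *v gap z))"
    and coupling_cost: "(\<integral>\<^sup>+z. ennreal ((dist (fst z) (snd z))\<^sup>2) \<partial>\<pi>)
      = ennreal (c0 + trace (P ** (second_moment \<eta> - S\<mu>)) + (\<integral>z. gap z \<bullet> (M *v gap z) \<partial>\<pi>))"
    and coupling_cost_nonneg: "0 \<le> c0 + trace (P ** (second_moment \<eta> - S\<mu>)) + (\<integral>z. gap z \<bullet> (M *v gap z) \<partial>\<pi>)"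
proof -
  have [measurable_cong]: "sets \<pi> = sets borel" by (rule couplings_sets[OF \<pi>])
  let ?d = "\<lambda>z. (dist (fst z) (snd z))\<^sup>2" and ?q = "\<lambda>z. gap z \<bullet> (M *v gap z)"
  let ?B = "mat 1 - transpose G ** T ** G"
  have fst_int: "integrable \<pi> (\<lambda>z. h (fst z))" "(\<integral>z. h (fst z) \<partial>\<pi>) = (\<integral>x. h x \<partial>gaussian 0 S\<nu>)"
    if "integrable (gaussian 0 S\<nu>) h" for h :: "_ \<Rightarrow> real"
  proof -
    have m: "fst \<in> \<pi> \<rightarrow>\<^sub>M borel" by measurable
    have h: "integrable (distr \<pi> borel fst) h" using that unfolding couplings_fst[OF \<pi>] .
    show "integrable \<pi> (\<lambda>z. h (fst z))" by (rule integrable_distr[OF m h])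
    show "(\<integral>z. h (fst z) \<partial>\<pi>) = (\<integral>x. h x \<partial>gaussian 0 S\<nu>)"
      using integral_distr[OF m, of h] borel_measurable_integrable[OF h]
      by (simp add: couplings_fst[OF \<pi>])
  qed
  have snd_int: "integrable \<pi> (\<lambda>z. h (snd z))" "(\<integral>z. h (snd z) \<partial>\<pi>) = (\<integral>y. h y \<partial>\<eta>)"
    if "integrable \<eta> h" for h :: "_ \<Rightarrow> real"
  proof -
    have m: "snd \<in> \<pi> \<rightarrow>\<^sub>M borel" by measurable
    have h: "integrable (distr \<pi> borel snd) h" using that unfolding couplings_snd[OF \<pi>] .
    show "integrable \<pi> (\<lambda>z. h (snd z))" by (rule integrable_distr[OF m h])
    show "(\<integral>z. h (snd z) \<partial>\<pi>) = (\<integral>x. h x \<partial>\<eta>)"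
      using integral_distr[OF m, of h] borel_measurable_integrable[OF h]
      by (simp add: couplings_snd[OF \<pi>])
  qed
  note \<nu> = gaussian_P2[OF psd_S\<nu>]
  have X: "integrable \<pi> (\<lambda>z. fst z \<bullet> (?B *v fst z))"
    "(\<integral>z. fst z \<bullet> (?B *v fst z) \<partial>\<pi>) = trace (?B ** S\<nu>)"
    using fst_int[OF P2_integrable_quadratic[OF \<nu>, of ?B]]
    by (simp_all add: P2_integral_quadratic[OF \<nu>] second_moment_gaussian[OF psd_S\<nu>])
  have Y: "integrable \<pi> (\<lambda>z. snd z \<bullet> (P *v snd z))"
    "(\<integral>z. snd z \<bullet> (P *v snd z) \<partial>\<pi>) = trace (P ** second_moment \<eta>)"
    using snd_int[OF P2_integrable_quadratic[OF \<eta>, of P]] by (simp_all add: P2_integral_quadratic[OF \<eta>])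
  have AE: "AE z in \<pi>. ?d z = fst z \<bullet> (?B *v fst z) + snd z \<bullet> (P *v snd z) + ?q z"
    using AE_coupling_fst[OF \<pi>] by eventually_elim (rule dist_decomposition)
  have d: "integrable \<pi> ?d"
  proof (rule Bochner_Integration.integrable_bound)
    show "integrable \<pi> (\<lambda>z. 2 * (norm (fst z))\<^sup>2 + 2 * (norm (snd z))\<^sup>2)"
      using fst_int(1)[OF P2_integrable[OF \<nu>]] snd_int(1)[OF P2_integrable[OF \<eta>]] by simp
    show "AE z in \<pi>. norm (?d z) \<le> norm (2 * (norm (fst z))\<^sup>2 + 2 * (norm (snd z))\<^sup>2)"
    proof (rule AE_I2)
      fix z :: "(real^'n) \<times> (real^'n)"
      have "dist (fst z) (snd z) \<le> norm (fst z) + norm (snd z)" by (simp add: dist_norm norm_triangle_ineq4)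
      then have "?d z \<le> (norm (fst z) + norm (snd z))\<^sup>2" by (simp add: power_mono)
      also have "\<dots> \<le> 2 * (norm (fst z))\<^sup>2 + 2 * (norm (snd z))\<^sup>2"
        using sum_squares_bound[of "norm (fst z)" "norm (snd z)"] by (simp add: power2_sum)
      finally show "norm (?d z) \<le> norm (2 * (norm (fst z))\<^sup>2 + 2 * (norm (snd z))\<^sup>2)" by simp
    qed
  qed measurable
  have q: "integrable \<pi> ?q"
  proof (rule integrable_cong_AE_imp)
    show "integrable \<pi> (\<lambda>z. ?d z - fst z \<bullet> (?B *v fst z) - snd z \<bullet> (P *v snd z))"
      using d X Y by simp
    show "AE z in \<pi>. ?d z - fst z \<bullet> (?B *v fst z) - snd z \<bullet> (P *v snd z) = ?q z"
      using AE by eventually_elim simp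
  qed measurable
  then show "integrable \<pi> ?q" .
  have "(\<integral>z. ?d z \<partial>\<pi>) = (\<integral>z. fst z \<bullet> (?B *v fst z) + snd z \<bullet> (P *v snd z) + ?q z \<partial>\<pi>)"
    by (rule integral_cong_AE) (use AE in measurable)
  also have "\<dots> = trace (?B ** S\<nu>) + trace (P ** second_moment \<eta>) + (\<integral>z. ?q z \<partial>\<pi>)"
    using X Y q by simp
  also have "\<dots> = c0 + trace (P ** (second_moment \<eta> - S\<mu>)) + (\<integral>z. ?q z \<partial>\<pi>)"
    by (simp add: c0_def matrix_diff_ldistrib trace_sub)
  finally have eq: "(\<integral>z. ?d z \<partial>\<pi>) = c0 + trace (P ** (second_moment \<eta> - S\<mu>)) + (\<integral>z. ?q z \<partial>\<pi>)" .
  show "(\<integral>\<^sup>+z. ennreal (?d z) \<partial>\<pi>)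
      = ennreal (c0 + trace (P ** (second_moment \<eta> - S\<mu>)) + (\<integral>z. ?q z \<partial>\<pi>))"
    unfolding eq[symmetric] by (rule nn_integral_eq_integral[OF d]) simp
  show "0 \<le> c0 + trace (P ** (second_moment \<eta> - S\<mu>)) + (\<integral>z. ?q z \<partial>\<pi>)"
    unfolding eq[symmetric] by simp
qed

lemma gap_nonneg: "0 \<le> (\<integral>z. gap z \<bullet> (M *v gap z) \<partial>\<pi>)"
  by (intro Bochner_Integration.integral_nonneg psdD(2)[OF psd_M])

definition "V \<eta> = (INF \<pi>\<in>couplings (gaussian 0 S\<nu>) \<eta>. \<integral>\<^sup>+z. ennreal ((dist (fst z) (snd z))\<^sup>2) \<partial>\<pi>)"

lemma W2_eq: "W2 (gaussian 0 S\<nu>) \<eta> = sqrt (enn2real (V \<eta>))"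
  by (simp add: W2_def V_def)

text \<open>\<open>enn2real\<close> sends infinity to 0, so comparing values of \<open>W2\<close>
  amounts to comparing values of \<open>V\<close> only when these are finite.\<close>

lemma V_finite:
  assumes "\<eta> \<in> P2"
  shows "V \<eta> < top"
proof -
  have \<pi>: "gaussian 0 S\<nu> \<Otimes>\<^sub>M \<eta> \<in> couplings (gaussian 0 S\<nu>) \<eta>"
    using assms gaussian_P2[OF psd_S\<nu>] by (intro pair_measure_in_couplings P2_prob_space P2_sets)
  show ?thesis
    unfolding V_def by (rule le_less_trans[OF INF_lower[OF \<pi>]]) (simp add: coupling_cost[OF \<pi> assms])
qed

lemma V_lower:
  assumes "\<eta> \<in> P2"
  shows "ennreal (c0 + trace (P ** (second_moment \<eta> - S\<mu>))) \<le> V \<eta>"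
  unfolding V_def
  by (rule INF_greatest) (simp add: coupling_cost[OF _ assms] ennreal_leI gap_nonneg)

text \<open>Built backwards, with \<open>x = G^T M G y\<close>: the component of \<open>y\<close> in
  the kernel of \<open>G\<close> is unconstrained here, so \<open>y\<close> need not be a function
  of \<open>x\<close>. The first marginal is right because
  \<open>M \<Gamma> M = \<Lambda>\<close>.\<close>

lemma matched_coupling:
  assumes \<eta>: "\<eta> \<in> P2" and law: "distr \<eta> borel ((*v) G) = gaussian 0 \<Gamma>"
  defines "\<pi> \<equiv> distr \<eta> borel (\<lambda>y. ((transpose G ** M ** G) *v y, y))"
  shows "\<pi> \<in> couplings (gaussian 0 S\<nu>) \<eta>" and "(\<integral>z. gap z \<bullet> (M *v gap z) \<partial>\<pi>) = 0"
proof -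
  have sets [measurable_cong]: "sets \<eta> = sets borel" by (rule P2_sets[OF \<eta>])
  have m [measurable]: "(\<lambda>y. ((transpose G ** M ** G) *v y, y)) \<in> \<eta> \<rightarrow>\<^sub>M borel"
    unfolding borel_prod[symmetric] by measurable
  have "distr \<pi> borel fst = distr \<eta> borel ((*v) (transpose G ** M ** G))"
    unfolding \<pi>_def by (subst distr_distr) (auto simp: o_def)
  also have "\<dots> = distr (distr \<eta> borel ((*v) G)) borel ((*v) (transpose G ** M))"
    by (rule distr_matrix_compose[OF sets, symmetric])
  also have "\<dots> = gaussian 0 (transpose G ** M ** \<Gamma> ** transpose (transpose G ** M))"
    unfolding law by (rule gaussian_linear_image[OF psd_\<Gamma>])
  also have "transpose G ** M ** \<Gamma> ** transpose (transpose G ** M) = S\<nu>"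
  proof -
    have "transpose G ** M ** \<Gamma> ** transpose (transpose G ** M) = transpose G ** (M ** T) ** \<Lambda> ** (T ** M) ** G"
      by (simp add: \<Gamma>_def matrix_transpose_mul psdD(1)[OF psd_M] matrix_mul_assoc)
    then show ?thesis by (simp add: MT TM S\<nu>_def)
  qed
  finally have 1: "distr \<pi> borel fst = gaussian 0 S\<nu>" .
  have "distr \<pi> borel snd = distr \<eta> borel (\<lambda>y. y)"
    unfolding \<pi>_def by (subst distr_distr) (auto simp: o_def)
  then have 2: "distr \<pi> borel snd = \<eta>" using distr_id2[OF sets[symmetric]] by simp
  show "\<pi> \<in> couplings (gaussian 0 S\<nu>) \<eta>"
    using 1 2 prob_space.prob_space_distr[OF P2_prob_space[OF \<eta>] m] by (simp add: couplings_def \<pi>_def)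
  have "gap ((transpose G ** M ** G) *v y, y) = 0" for y
  proof -
    have "T ** G ** (transpose G ** M ** G) = G"
      by (simp add: matrix_mul_assoc GG_simps TM)
    then show ?thesis by (simp add: matrix_vector_mul_assoc)
  qed
  moreover have "(\<integral>z. gap z \<bullet> (M *v gap z) \<partial>\<pi>)
      = (\<integral>y. gap ((transpose G ** M ** G) *v y, y) \<bullet> (M *v gap ((transpose G ** M ** G) *v y, y)) \<partial>\<eta>)"
    unfolding \<pi>_def by (rule integral_distr) measurable
  ultimately show "(\<integral>z. gap z \<bullet> (M *v gap z) \<partial>\<pi>) = 0" by simp
qed

text \<open>The map taking \<open>(x, y)\<close> to \<open>(T G x, G y)\<close> sends a coupling to
  one of \<open>N(0, \<Gamma>)\<close> with the law of \<open>G y\<close>, at a cost equal to the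
  squared Euclidean norm of the gap in mean. The original cost is at least \<open>c0\<close> plus
  the gap term, so that term is small along near-optimal couplings.\<close>

lemma near_optimal_law:
  assumes \<eta>: "\<eta> \<in> P2" and tr: "0 \<le> trace (P ** (second_moment \<eta> - S\<mu>))"
    and c0: "0 \<le> c0" and V: "V \<eta> \<le> ennreal c0"
  shows "distr \<eta> borel ((*v) G) = gaussian 0 \<Gamma>"
proof (rule close_couplings_imp_eq[symmetric])
  have sets [measurable_cong]: "sets \<eta> = sets borel" by (rule P2_sets[OF \<eta>])
  have "distr \<eta> borel ((*v) G) \<in> P2" by (rule P2_linear_image[OF \<eta>])
  then show "prob_space (distr \<eta> borel ((*v) G))" by (rule P2_prob_space)
  show "prob_space (gaussian 0 \<Gamma>)" by (rule P2_prob_space[OF gaussian_P2[OF psd_\<Gamma>]])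
  fix \<epsilon> :: real assume \<epsilon>: "\<epsilon> > 0"
  \<comment> \<open>Passing from the \<open>M\<close>-form to the Euclidean norm costs a factor
    \<open>tr T\<close>; the summand 1 makes the divisor positive.\<close>
  let ?t = "trace T + 1"
  have t: "?t > 0" using trace_nonneg_psd(2)[OF psd_T] by linarith
  have "V \<eta> < ennreal (c0 + \<epsilon> / ?t)"
    using V \<epsilon> t c0 by (auto intro!: le_less_trans[OF V] ennreal_lessI)
  then obtain \<pi> where \<pi>: "\<pi> \<in> couplings (gaussian 0 S\<nu>) \<eta>"
    and cost: "(\<integral>\<^sup>+z. ennreal ((dist (fst z) (snd z))\<^sup>2) \<partial>\<pi>) < ennreal (c0 + \<epsilon> / ?t)"
    unfolding V_def INF_less_iff by blast
  have sets\<pi> [measurable_cong]: "sets \<pi> = sets borel" by (rule couplings_sets[OF \<pi>])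
  have gap_le: "(\<integral>z. gap z \<bullet> (M *v gap z) \<partial>\<pi>) \<le> \<epsilon> / ?t"
    using cost tr unfolding coupling_cost[OF \<pi> \<eta>] ennreal_less_iff[OF coupling_cost_nonneg[OF \<pi> \<eta>]] by simp
  let ?f = "\<lambda>z. ((T ** G) *v fst z, G *v snd z)"
  have m [measurable]: "?f \<in> \<pi> \<rightarrow>\<^sub>M borel"
    unfolding borel_prod[symmetric] by measurable
  have fst: "distr (distr \<pi> borel ?f) borel fst = gaussian 0 \<Gamma>"
  proof -
    have "distr (distr \<pi> borel ?f) borel fst = distr (distr \<pi> borel fst) borel ((*v) (T ** G))"
      by (subst (1 2) distr_distr) (auto simp: o_def)
    also have "\<dots> = gaussian 0 (T ** G ** S\<nu> ** transpose (T ** G))"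
      unfolding couplings_fst[OF \<pi>] by (rule gaussian_linear_image[OF psd_S\<nu>])
    also have "T ** G ** S\<nu> ** transpose (T ** G) = \<Gamma>"
      by (simp add: S\<nu>_def \<Gamma>_def matrix_transpose_mul psdD(1)[OF psd_T] matrix_mul_assoc GG_simps)
    finally show ?thesis .
  qed
  have "distr (distr \<pi> borel ?f) borel snd = distr (distr \<pi> borel snd) borel ((*v) G)"
    by (subst (1 2) distr_distr) (auto simp: o_def)
  then have "distr \<pi> borel ?f \<in> couplings (gaussian 0 \<Gamma>) (distr \<eta> borel ((*v) G))"
    using fst couplings_snd[OF \<pi>] prob_space.prob_space_distr[OF couplings_prob_space[OF \<pi>] m]
    by (simp add: couplings_def)
  moreover have "(\<integral>\<^sup>+w. ennreal ((dist (fst w) (snd w))\<^sup>2) \<partial>distr \<pi> borel ?f) \<le> ennreal \<epsilon>"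
  proof -
    have "(\<integral>\<^sup>+w. ennreal ((dist (fst w) (snd w))\<^sup>2) \<partial>distr \<pi> borel ?f) = (\<integral>\<^sup>+z. ennreal ((dist (fst (?f z)) (snd (?f z)))\<^sup>2) \<partial>\<pi>)"
      by (rule nn_integral_distr) measurable
    also have "\<dots> \<le> (\<integral>\<^sup>+z. ennreal (?t * (gap z \<bullet> (M *v gap z))) \<partial>\<pi>)"
    proof (intro nn_integral_mono ennreal_leI)
      fix z :: "(real^'n) \<times> (real^'n)"
      have T: "T *v (M *v gap z) = gap z" by (simp add: matrix_vector_mul_assoc TM)
      have "(dist (fst (?f z)) (snd (?f z)))\<^sup>2 = (norm (gap z))\<^sup>2"
        by (simp add: dist_norm norm_minus_commute)
      also have "\<dots> \<le> trace T * ((M *v gap z) \<bullet> gap z)"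
        using psd_vec_norm_bound[OF psd_T, of "M *v gap z"] unfolding T .
      also have "\<dots> \<le> ?t * (gap z \<bullet> (M *v gap z))"
        using psdD(2)[OF psd_M, of "gap z"] by (simp add: inner_commute distrib_right)
      finally show "(dist (fst (?f z)) (snd (?f z)))\<^sup>2 \<le> ?t * (gap z \<bullet> (M *v gap z))" .
    qed
    also have "\<dots> = ennreal (\<integral>z. ?t * (gap z \<bullet> (M *v gap z)) \<partial>\<pi>)"
      using t psdD(2)[OF psd_M] coupling_gap_integrable[OF \<pi> \<eta>]
      by (intro nn_integral_eq_integral) auto
    also have "\<dots> \<le> ennreal \<epsilon>"
      using gap_le t by (intro ennreal_leI) (simp add: pos_le_divide_eq mult.commute)
    finally show ?thesis .
  qed
  ultimately show "\<exists>\<pi>\<in>couplings (gaussian 0 \<Gamma>) (distr \<eta> borel ((*v) G)).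
      (\<integral>\<^sup>+z. ennreal ((dist (fst z) (snd z))\<^sup>2) \<partial>\<pi>) \<le> ennreal \<epsilon>" by blast
qed simp_all

lemma
  assumes "\<eta> \<in> P2" "convex_order (gaussian 0 S\<mu>) \<eta>"
  shows dominating_psd: "psd (second_moment \<eta> - S\<mu>)"
    and dominating_integral: "(\<integral>x. x \<partial>\<eta>) = 0"
    and dominating_covariance: "covariance_matrix \<eta> = second_moment \<eta>"
    and dominating_trace: "0 \<le> trace (P ** (second_moment \<eta> - S\<mu>))"
proof -
  note \<mu> = gaussian_P2[OF psd_S\<mu>]
  show 1: "psd (second_moment \<eta> - S\<mu>)"
    using convex_order_second_moment[OF \<mu> assms] second_moment_gaussian[OF psd_S\<mu>] by simp
  show 2: "(\<integral>x. x \<partial>\<eta>) = 0"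
    using convex_order_integral_eq[OF \<mu> assms] integral_gaussian[OF psd_S\<mu>] by simp
  show "covariance_matrix \<eta> = second_moment \<eta>"
    by (rule covariance_matrix_eq_second_moment[OF assms(1) 2])
  show "0 \<le> trace (P ** (second_moment \<eta> - S\<mu>))" by (rule trace_mult_psd_nonneg[OF psd_P 1])
qed

lemma gaussian_S\<^sub>s:
  "gaussian 0 S\<^sub>s \<in> P2" "convex_order (gaussian 0 S\<mu>) (gaussian 0 S\<^sub>s)"
  "second_moment (gaussian 0 S\<^sub>s) = S\<^sub>s" "distr (gaussian 0 S\<^sub>s) borel ((*v) G) = gaussian 0 \<Gamma>"
  using gaussian_P2[OF psd_S\<^sub>s] convex_order_gaussian[OF psd_S\<mu> psd_S\<^sub>s_diff]
    second_moment_gaussian[OF psd_S\<^sub>s] gaussian_linear_image[OF psd_S\<^sub>s, of G] S\<^sub>s_compress by simp_all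

lemma V_upper:
  assumes "\<eta> \<in> P2" "second_moment \<eta> = S\<^sub>s" "distr \<eta> borel ((*v) G) = gaussian 0 \<Gamma>"
  shows "V \<eta> \<le> ennreal c0" "0 \<le> c0"
proof -
  obtain \<pi> where \<pi>: "\<pi> \<in> couplings (gaussian 0 S\<nu>) \<eta>" "(\<integral>z. gap z \<bullet> (M *v gap z) \<partial>\<pi>) = 0"
    using matched_coupling[OF assms(1,3)] by blast
  show "V \<eta> \<le> ennreal c0"
    unfolding V_def using coupling_cost[OF \<pi>(1) assms(1)] \<pi>(2) trace_P_S\<^sub>s assms(2)
    by (intro INF_lower2[OF \<pi>(1)]) simp
  show "0 \<le> c0"
    using coupling_cost_nonneg[OF \<pi>(1) assms(1)] \<pi>(2) trace_P_S\<^sub>s assms(2) by simp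
qed

theorem projection_iff:
  "is_W2_projection (gaussian 0 S\<nu>) (gaussian 0 S\<mu>) \<eta> \<longleftrightarrow>
    \<eta> \<in> P2 \<and> covariance_matrix \<eta> = S\<^sub>s \<and> distr \<eta> borel ((*v) G) = gaussian 0 \<Gamma> \<and>
    convex_order (gaussian 0 S\<mu>) \<eta>"
proof -
  have c0: "0 \<le> c0" using V_upper(2)[OF gaussian_S\<^sub>s(1,3,4)] .
  have lower: "ennreal c0 \<le> V \<eta>" if "\<eta> \<in> P2" "convex_order (gaussian 0 S\<mu>) \<eta>" for \<eta>
    by (rule order_trans[OF ennreal_leI V_lower[OF that(1)]]) (use dominating_trace[OF that] in simp)
  have W2_le: "W2 (gaussian 0 S\<nu>) \<eta> \<le> W2 (gaussian 0 S\<nu>) \<eta>' \<longleftrightarrow> V \<eta> \<le> V \<eta>'" if "\<eta> \<in> P2" "\<eta>' \<in> P2" for \<eta> \<eta>'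
    using V_finite[OF that(1)] V_finite[OF that(2)] unfolding W2_eq
    by (auto intro: enn2real_mono) (metis enn2real_nonneg ennreal_enn2real ennreal_leI)
  show ?thesis
  proof (intro iffI)
    assume "is_W2_projection (gaussian 0 S\<nu>) (gaussian 0 S\<mu>) \<eta>"
    then have \<eta>: "\<eta> \<in> P2" "convex_order (gaussian 0 S\<mu>) \<eta>"
      and "W2 (gaussian 0 S\<nu>) \<eta> \<le> W2 (gaussian 0 S\<nu>) (gaussian 0 S\<^sub>s)"
      using gaussian_S\<^sub>s(1,2) unfolding is_W2_projection_def is_arg_min_linorder by auto
    then have "V \<eta> \<le> V (gaussian 0 S\<^sub>s)" using W2_le gaussian_S\<^sub>s(1) by blast
    then have V: "V \<eta> \<le> ennreal c0" using V_upper(1)[OF gaussian_S\<^sub>s(1,3,4)] by (rule order_trans)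
    have law: "distr \<eta> borel ((*v) G) = gaussian 0 \<Gamma>"
      by (rule near_optimal_law[OF \<eta>(1) dominating_trace[OF \<eta>] c0 V])
    \<comment> \<open>The general lower bound exceeds \<open>c0\<close> by this trace, which must
      therefore vanish.\<close>
    have "ennreal (c0 + trace (P ** (second_moment \<eta> - S\<mu>))) \<le> ennreal c0"
      using V_lower[OF \<eta>(1)] V by (rule order_trans)
    then have tr: "trace (P ** (second_moment \<eta> - S\<mu>)) = 0"
      using c0 dominating_trace[OF \<eta>] by (simp add: ennreal_le_iff)
    \<comment> \<open>The law of \<open>G y\<close> fixes the block of the second moment;
      \<open>rigidity\<close> then determines all other entries.\<close>
    have "G ** second_moment \<eta> ** transpose G = \<Gamma>"
      using second_moment_linear_image[OF \<eta>(1), of G] law second_moment_gaussian[OF psd_\<Gamma>] by simp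
    then have "second_moment \<eta> - S\<mu> = S\<^sub>s - S\<mu>"
      by (intro rigidity[OF dominating_psd[OF \<eta>] tr]) (simp add: matrix_diff_ldistrib matrix_diff_rdistrib)
    then show "\<eta> \<in> P2 \<and> covariance_matrix \<eta> = S\<^sub>s \<and> distr \<eta> borel ((*v) G) = gaussian 0 \<Gamma> \<and>
        convex_order (gaussian 0 S\<mu>) \<eta>"
      using \<eta> law dominating_covariance[OF \<eta>] by simp
  next
    assume *: "\<eta> \<in> P2 \<and> covariance_matrix \<eta> = S\<^sub>s \<and> distr \<eta> borel ((*v) G) = gaussian 0 \<Gamma> \<and>
        convex_order (gaussian 0 S\<mu>) \<eta>"
    then have "V \<eta> \<le> ennreal c0"
      using dominating_covariance by (intro V_upper) auto
    then show "is_W2_projection (gaussian 0 S\<nu>) (gaussian 0 S\<mu>) \<eta>"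
      using * W2_le lower unfolding is_W2_projection_def is_arg_min_linorder by (meson order_trans)
  qed
qed

lemma projection_gaussian: "is_W2_projection (gaussian 0 S\<nu>) (gaussian 0 S\<mu>) (gaussian 0 S\<^sub>s)"
  using projection_iff gaussian_S\<^sub>s covariance_gaussian[OF psd_S\<^sub>s] by blast

text \<open>Convex order preserves the mean, so \<open>m = 0\<close>, and a centred Gaussian is
  determined by its covariance.\<close>

lemma gaussian_projection_unique:
  assumes "psd S" "is_W2_projection (gaussian 0 S\<nu>) (gaussian 0 S\<mu>) (gaussian m S)"
  shows "gaussian m S = gaussian 0 S\<^sub>s"
proof -
  have 1: "gaussian m S \<in> P2" "convex_order (gaussian 0 S\<mu>) (gaussian m S)" "covariance_matrix (gaussian m S) = S\<^sub>s"
    using assms(2) projection_iff by auto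
  then have "m = 0" using dominating_integral integral_gaussian_mean by metis
  then show ?thesis using 1(3) covariance_gaussian[OF assms(1)] by simp
qed

text \<open>With \<open>L = \<Lambda>^(1/2)\<close>, \<open>R = (L G S G^T L)^(1/2)\<close> and
  \<open>K = L T L\<close>, completing the square in \<open>R\<close> writes the objective as a
  constant plus \<open>tr(P (S - S\<mu>))\<close> plus \<open>tr((K - R) K^-1 (K - R))\<close>, the
  matrix counterpart of the cost decomposition. If both nonnegative terms vanish, then
  \<open>R = K\<close> gives the block \<open>\<Gamma>\<close>, and \<open>rigidity\<close> gives
  \<open>S\<^sub>s\<close>.\<close>

theorem trace_minimizer_iff:
  assumes inv: "invertible \<Lambda>"
  shows "is_arg_min (\<lambda>S. trace (S - 2 *\<^sub>R matrix_sqrt (matrix_sqrt S\<nu> ** S ** matrix_sqrt S\<nu>)))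
    (\<lambda>S. psd S \<and> loewner_le S\<mu> S) S \<longleftrightarrow> S = S\<^sub>s"
proof -
  define L where "L = matrix_sqrt \<Lambda>"
  have L: "psd L" "transpose L = L" "L ** L = \<Lambda>"
    using psd_\<Lambda> by (simp_all add: L_def psd_matrix_sqrt matrix_sqrt_mult_self psdD)
  obtain \<Lambda>' where "\<Lambda> ** \<Lambda>' = mat 1" using inv by (auto simp: invertible_def)
  then have "L ** (L ** \<Lambda>') = mat 1" using L by (simp add: matrix_mul_assoc)
  then obtain L' where LL': "L ** L' = mat 1" by blast
  then have L'L: "L' ** L = mat 1" by (simp add: matrix_left_right_inverse)
  have L': "psd L'" by (rule psd_inverse[OF L(1) LL'])
  have cancel: "L ** (L' ** X) = X" "L' ** (L ** X) = X" for X :: "real^'m^'m"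
    by (simp_all add: matrix_mul_assoc LL' L'L)
  \<comment> \<open>The square root of \<open>L \<Gamma> L\<close>, which is the value of
    \<open>?R\<close> at \<open>S\<^sub>s\<close>; \<open>K'\<close> is its inverse.\<close>
  define K where "K = L ** T ** L"
  define K' where "K' = L' ** M ** L'"
  have psdK: "psd K" using psd_congruence[OF psd_T, of L] by (simp add: K_def L)
  have psdK': "psd K'" using psd_congruence[OF psd_M, of L'] by (simp add: K'_def psdD(1)[OF L'])
  have MT': "M ** (T ** X) = X" "T ** (M ** X) = X" for X :: "real^'m^'m"
    by (simp_all add: matrix_mul_assoc MT TM)
  have KK': "K ** K' = mat 1" "K' ** K = mat 1"
    by (simp_all add: K_def K'_def cancel MT' LL' L'L flip: matrix_mul_assoc)
  have KK: "K ** K = L ** \<Gamma> ** L"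
    unfolding \<Gamma>_def unfolding K_def L(3)[symmetric] by (simp add: matrix_mul_assoc)
  have sqrt_S\<nu>: "matrix_sqrt S\<nu> = transpose G ** L ** G"
  proof (rule matrix_sqrt_eqI)
    show "psd (transpose G ** L ** G)" using psd_congruence[OF L(1), of "transpose G"] by simp
    show "(transpose G ** L ** G) ** (transpose G ** L ** G) = S\<nu>"
      unfolding S\<nu>_def unfolding L(3)[symmetric] by (simp add: GG_simps matrix_mul_assoc)
  qed
  let ?R = "\<lambda>S. matrix_sqrt (L ** (G ** S ** transpose G) ** L)"
  let ?Y = "\<lambda>S. (K - ?R S) ** K' ** transpose (K - ?R S)"
  let ?f = "\<lambda>S. trace (S - 2 *\<^sub>R matrix_sqrt (matrix_sqrt S\<nu> ** S ** matrix_sqrt S\<nu>))"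
  have psdY: "psd (?Y S)" for S by (rule psd_congruence[OF psdK'])
  have R: "psd (?R S)" "?R S ** ?R S = L ** (G ** S ** transpose G) ** L" if "psd S" for S
  proof -
    have "psd (L ** (G ** S ** transpose G) ** L)"
      using psd_congruence[OF psd_congruence[OF that, of G], of L] by (simp add: L)
    then show "psd (?R S)" "?R S ** ?R S = L ** (G ** S ** transpose G) ** L"
      by (simp_all add: psd_matrix_sqrt matrix_sqrt_mult_self)
  qed
  have f_eq: "?f S = trace (P ** S\<mu>) - trace (T ** \<Lambda>) + trace (P ** (S - S\<mu>)) + trace (?Y S)"
    if S: "psd S" for S
  proof -
    \<comment> \<open>Since \<open>G G^T = I\<close>, padding by \<open>G^T\<close> and
      \<open>G\<close> is multiplicative and so commutes with square roots; this moves the problem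
      to the smaller dimension, where \<open>L\<close> is invertible.\<close>
    have "matrix_sqrt (matrix_sqrt S\<nu> ** S ** matrix_sqrt S\<nu>) = transpose G ** ?R S ** G"
    proof (rule matrix_sqrt_eqI)
      show "psd (transpose G ** ?R S ** G)" using psd_congruence[OF R(1)[OF S], of "transpose G"] by simp
      have "(transpose G ** ?R S ** G) ** (transpose G ** ?R S ** G) = transpose G ** (?R S ** ?R S) ** G"
        by (simp add: GG_simps matrix_mul_assoc)
      also have "\<dots> = matrix_sqrt S\<nu> ** S ** matrix_sqrt S\<nu>"
        unfolding R(2)[OF S] sqrt_S\<nu> by (simp add: matrix_mul_assoc)
      finally show "(transpose G ** ?R S ** G) ** (transpose G ** ?R S ** G) = matrix_sqrt S\<nu> ** S ** matrix_sqrt S\<nu>" .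
    qed
    moreover have "trace (transpose G ** ?R S ** G) = trace (?R S)"
      using trace_mul_sym[of "transpose G ** ?R S" G] by (simp add: GG_simps)
    ultimately have f1: "?f S = trace S - 2 * trace (?R S)"
      by (simp add: trace_sub trace_scaleR)
    have "?Y S = K - ?R S - ?R S + ?R S ** K' ** ?R S"
      using KK' by (simp add: transpose_diff psdD(1)[OF psdK] psdD(1)[OF R(1)[OF S]]
          matrix_diff_ldistrib matrix_diff_rdistrib) (simp add: algebra_simps flip: matrix_mul_assoc)
    moreover have "trace (?R S ** K' ** ?R S) = trace (M ** (G ** S ** transpose G))"
    proof -
      have "trace (?R S ** K' ** ?R S) = trace (K' ** (?R S ** ?R S))"
        using trace_mul_sym[of "?R S" "K' ** ?R S"] by (simp add: matrix_mul_assoc)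
      also have "\<dots> = trace (L' ** (M ** (G ** S ** transpose G) ** L))"
        unfolding R(2)[OF S] by (simp add: K'_def cancel flip: matrix_mul_assoc)
      also have "\<dots> = trace (M ** (G ** S ** transpose G))"
        by (subst trace_mul_sym) (simp add: LL' flip: matrix_mul_assoc)
      finally show ?thesis .
    qed
    moreover have "trace K = trace (T ** \<Lambda>)"
      using trace_mul_sym[of L "T ** L"] by (simp add: K_def matrix_mul_assoc flip: L(3))
    ultimately have Y: "trace (?Y S) = trace (T ** \<Lambda>) - 2 * trace (?R S) + trace (M ** (G ** S ** transpose G))"
      by (simp only: trace_add trace_sub)
    have "trace (transpose G ** M ** G ** S) = trace (M ** (G ** S ** transpose G))"
      using trace_mul_sym[of "transpose G" "M ** G ** S"] by (simp add: matrix_mul_assoc)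
    then have "trace (P ** S) = trace S - trace (M ** (G ** S ** transpose G))"
      by (simp add: P_def matrix_diff_rdistrib trace_sub)
    then show ?thesis
      unfolding f1 by (simp add: Y matrix_diff_ldistrib trace_sub)
  qed
  have Y_S\<^sub>s: "trace (?Y S\<^sub>s) = 0"
  proof -
    have "?R S\<^sub>s = K" by (rule matrix_sqrt_eqI[OF psdK]) (simp add: KK S\<^sub>s_compress)
    then show ?thesis by (simp add: trace_def)
  qed
  have feas: "psd S\<^sub>s \<and> loewner_le S\<mu> S\<^sub>s"
    using psd_S\<^sub>s psd_S\<^sub>s_diff by (simp add: loewner_le_def)
  have nonneg: "0 \<le> trace (P ** (S - S\<mu>))" "0 \<le> trace (?Y S)" if "loewner_le S\<mu> S" for S
    using trace_mult_psd_nonneg[OF psd_P] trace_nonneg_psd(2)[OF psdY] that by (auto simp: loewner_le_def)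
  have opt: "?f S\<^sub>s \<le> ?f S" if "psd S \<and> loewner_le S\<mu> S" for S
    using that nonneg[of S] feas by (simp add: f_eq trace_P_S\<^sub>s Y_S\<^sub>s)
  show ?thesis
  proof
    assume "is_arg_min ?f (\<lambda>S. psd S \<and> loewner_le S\<mu> S) S"
    then have S: "psd S" "loewner_le S\<mu> S" and le: "?f S \<le> ?f S\<^sub>s"
      using feas unfolding is_arg_min_linorder by blast+
    have 0: "trace (P ** (S - S\<mu>)) = 0" "trace (?Y S) = 0"
      using le nonneg[OF S(2)] unfolding f_eq[OF S(1)] f_eq[OF psd_S\<^sub>s] trace_P_S\<^sub>s Y_S\<^sub>s by linarith+
    have "?Y S = 0" by (rule psd_trace_0[OF psdY 0(2)])
    \<comment> \<open>\<open>?Y S\<close> is the Gram matrix of \<open>(K - ?R S) B\<close>, where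
      the square root \<open>B\<close> of \<open>K'\<close> is invertible.\<close>
    have "K - ?R S = 0"
    proof -
      obtain B where B: "psd B" "B ** B = K'" using psd_sqrt_exists[OF psdK'] .
      have "((K - ?R S) ** B) ** transpose ((K - ?R S) ** B) = ?Y S"
        by (simp add: matrix_transpose_mul psdD(1)[OF B(1)] matrix_mul_assoc flip: B(2))
      then have "(K - ?R S) ** B = 0" using \<open>?Y S = 0\<close> mult_transpose_eq_0_iff by metis
      then have "(K - ?R S) ** B ** B ** K = 0" by simp
      then show ?thesis by (simp add: B KK' flip: matrix_mul_assoc)
    qed
    then have "K ** K = L ** (G ** S ** transpose G) ** L" using R(2)[OF S(1)] by simp
    then have "L ** \<Gamma> ** L = L ** (G ** S ** transpose G) ** L" by (simp add: KK)
    then have "L' ** (L ** \<Gamma> ** L) ** L' = L' ** (L ** (G ** S ** transpose G) ** L) ** L'" by simp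
    then have "\<Gamma> = G ** S ** transpose G"
      by (simp add: cancel LL' flip: matrix_mul_assoc)
    then have "S - S\<mu> = S\<^sub>s - S\<mu>"
      using S(2) by (intro rigidity 0(1)) (simp_all add: loewner_le_def matrix_diff_ldistrib matrix_diff_rdistrib)
    then show "S = S\<^sub>s" by simp
  next
    assume "S = S\<^sub>s"
    then show "is_arg_min ?f (\<lambda>S. psd S \<and> loewner_le S\<mu> S) S"
      using feas opt unfolding is_arg_min_linorder by blast
  qed
qed

end


section \<open>Coordinates\<close>

lemma coord_proj_id: "coord_proj id = mat 1"
  by (simp add: coord_proj_def submatrix_def vec_eq_iff)

text \<open>Connects the entrywise conditions of the final statement with matrix products.\<close>

lemma coord_proj_sandwich:
  assumes "inj e"
  shows "(transpose (coord_proj e) ** X ** coord_proj e) $ k $ l =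
    (if k \<in> range e \<and> l \<in> range e then X $ inv e k $ inv e l else (0::real))"
proof -
  have eq: "(transpose (coord_proj e) ** X ** coord_proj e) $ k $ l =
      (\<Sum>j\<in>UNIV. if e j = l then (\<Sum>i\<in>UNIV. if e i = k then X $ i $ j else 0) else 0)"
    by (simp add: matrix_matrix_mult_def transpose_def coord_proj_def submatrix_def mat_def
        if_distrib[where f="\<lambda>u. u * _"] if_distrib[where f="\<lambda>u. _ * u"] cong: if_cong)
  have sel: "(\<Sum>j\<in>UNIV. if e j = l then h j else 0) = (if l \<in> range e then h (inv e l) else (0::real))" for h l
    using inj_eq[OF assms] by (auto simp: inv_f_f[OF assms] intro!: sum.neutral)
  show ?thesis unfolding eq sel by simp
qed

lemma diag_matrix_zero_pad:
  assumes "inj e"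
  shows "diag_matrix (zero_pad e v) = transpose (coord_proj e) ** diag_matrix v ** coord_proj e"
  using inv_f_f[OF assms] by (auto simp: vec_eq_iff coord_proj_sandwich[OF assms] diag_matrix_def zero_pad_def)

lemma invertible_diag_matrix:
  fixes v :: "real^'n"
  assumes "\<And>i. v $ i \<noteq> 0"
  shows "invertible (diag_matrix v)"
proof -
  have "diag_matrix v ** diag_matrix (\<chi> i. 1 / v $ i) = mat 1"
    using assms by (simp add: diag_matrix_def mat_def matrix_matrix_mult_def vec_eq_iff
        if_distrib[where f="\<lambda>u. u * _"] if_distrib[where f="\<lambda>u. _ * u"] cong: if_cong)
  then show ?thesis using invertible_right_inverse by blast
qed

text \<open>For \<open>G = I\<close> the law of \<open>G y\<close> is the law of \<open>y\<close>,
  so the characterization leaves a single projection and the definite description is well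
  defined.\<close>

lemma J2_gaussian:
  fixes A \<Lambda> M T :: "real^'m^'m"
  assumes "psd A" "psd \<Lambda>" "psd M" "psd (mat 1 - M)" "psd T" "M ** T = mat 1"
    and "psd (T ** \<Lambda> ** T - A)" "trace ((mat 1 - M) ** (T ** \<Lambda> ** T - A)) = 0"
  shows "J2 (gaussian 0 \<Lambda>) (gaussian 0 A) = gaussian 0 (T ** \<Lambda> ** T)"
proof -
  interpret degenerate_projection "mat 1" \<Lambda> M T A
    using assms by unfold_locales simp_all
  have S: "S\<nu> = \<Lambda>" "S\<^sub>s = T ** \<Lambda> ** T" by (simp_all add: S\<nu>_def S\<^sub>s_def \<Gamma>_def)
  show ?thesis
    unfolding J2_def
  proof (rule the_equality)
    show "is_W2_projection (gaussian 0 \<Lambda>) (gaussian 0 A) (gaussian 0 (T ** \<Lambda> ** T))"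
      using projection_gaussian by (simp add: S)
    fix \<eta> assume "is_W2_projection (gaussian 0 \<Lambda>) (gaussian 0 A) \<eta>"
    moreover have "(*v) (mat 1) = (\<lambda>x :: real^'m. x)" by (simp add: fun_eq_iff)
    ultimately have "\<eta> \<in> P2" "distr \<eta> borel (\<lambda>x. x) = gaussian 0 (T ** \<Lambda> ** T)"
      using projection_iff[of \<eta>] by (simp_all add: S \<Gamma>_def)
    then show "\<eta> = gaussian 0 (T ** \<Lambda> ** T)"
      using distr_id2[OF P2_sets[symmetric]] by metis
  qed
qed

theorem proposition3p2:
  fixes \<Sigma>\<^sub>\<mu> \<Sigma>\<^sub>\<nu> \<Sigma>\<^sub>s Q :: "real^'n^'n"
    and \<Gamma> :: "real^'m^'m"
    and lam :: "real^'m"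
    and e :: "'m \<Rightarrow> 'n"
    and g :: "real^'n \<Rightarrow> real^'m"
  assumes "CARD('n) \<ge> 2"
    and "psd \<Sigma>\<^sub>\<mu>" and "psd \<Sigma>\<^sub>\<nu>"
    and "CARD('m) \<in> {1..CARD('n) - 1}" and "rank \<Sigma>\<^sub>\<nu> = CARD('m)"
    and "inj e"
    and "orthogonal_matrix Q" and "\<And>i. lam $ i > 0"
    and "\<Sigma>\<^sub>\<nu> = Q ** diag_matrix (zero_pad e lam) ** transpose Q"
    and "\<Gamma> = covariance_matrix
          (J2 (gaussian 0 (diag_matrix lam))
              (gaussian 0 (submatrix e e (transpose Q ** \<Sigma>\<^sub>\<mu> ** Q))))"
    and "submatrix e e (transpose Q ** \<Sigma>\<^sub>s ** Q) = \<Gamma>"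
    and "\<And>k l. \<not> (k \<in> range e \<and> l \<in> range e) \<Longrightarrow>
          (transpose Q ** \<Sigma>\<^sub>s ** Q) $ k $ l = (transpose Q ** \<Sigma>\<^sub>\<mu> ** Q) $ k $ l"
    and "\<And>x. g x = submatrix e id (transpose Q) *v x"
  shows "(\<forall>\<eta>. is_W2_projection (gaussian 0 \<Sigma>\<^sub>\<nu>) (gaussian 0 \<Sigma>\<^sub>\<mu>) \<eta> \<longleftrightarrow>
            \<eta> \<in> P2 \<and> covariance_matrix \<eta> = \<Sigma>\<^sub>s \<and> distr \<eta> borel g = gaussian 0 \<Gamma> \<and>
            convex_order (gaussian 0 \<Sigma>\<^sub>\<mu>) \<eta>) \<and>
    psd \<Sigma>\<^sub>s \<and>
    is_W2_projection (gaussian 0 \<Sigma>\<^sub>\<nu>) (gaussian 0 \<Sigma>\<^sub>\<mu>) (gaussian 0 \<Sigma>\<^sub>s) \<and>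
    (\<forall>m S. psd S \<and> is_W2_projection (gaussian 0 \<Sigma>\<^sub>\<nu>) (gaussian 0 \<Sigma>\<^sub>\<mu>) (gaussian m S) \<longrightarrow>
            gaussian m S = gaussian 0 \<Sigma>\<^sub>s) \<and>
    (\<forall>S. is_arg_min
            (\<lambda>S. trace (S - 2 *\<^sub>R matrix_sqrt (matrix_sqrt \<Sigma>\<^sub>\<nu> ** S ** matrix_sqrt \<Sigma>\<^sub>\<nu>)))
            (\<lambda>S. psd S \<and> loewner_le \<Sigma>\<^sub>\<mu> S) S \<longleftrightarrow> S = \<Sigma>\<^sub>s)"
proof -
  let ?\<Lambda> = "diag_matrix lam" and ?E = "coord_proj e :: real^'n^'m"
  define G where "G = ?E ** transpose Q"
  define A where "A = G ** \<Sigma>\<^sub>\<mu> ** transpose G"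
  have QQ: "Q ** transpose Q = mat 1" "transpose Q ** Q = mat 1"
    using \<open>orthogonal_matrix Q\<close> by (simp_all add: orthogonal_matrix_def)
  have EE: "?E ** transpose ?E = mat 1" by (rule coord_proj_mult_transpose_self[OF \<open>inj e\<close>])
  have GQ: "G ** Q = ?E" and tG: "transpose G = Q ** transpose ?E"
    by (simp_all add: G_def matrix_transpose_mul QQ flip: matrix_mul_assoc)
  have QtG: "transpose Q ** transpose G = transpose ?E"
    by (simp add: tG matrix_mul_assoc QQ)
  have GG: "G ** transpose G = mat 1"
    by (simp add: tG matrix_mul_assoc GQ EE)
  have psd\<Lambda>: "psd ?\<Lambda>" using \<open>\<And>i. lam $ i > 0\<close> by (intro psd_diag_matrix less_imp_le)
  have inv\<Lambda>: "invertible ?\<Lambda>"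
    using \<open>\<And>i. lam $ i > 0\<close> by (intro invertible_diag_matrix) (metis less_irrefl)
  have compress: "submatrix e e (transpose Q ** S ** Q) = G ** S ** transpose G" for S
    by (simp add: submatrix_eq_coord_proj G_def matrix_transpose_mul matrix_mul_assoc)
  have psdA: "psd A" unfolding A_def by (rule psd_congruence[OF \<open>psd \<Sigma>\<^sub>\<mu>\<close>])
  \<comment> \<open>One certificate, found for the block \<open>A\<close>, serves both the
    projection that defines \<open>\<Gamma>\<close> and the degenerate one.\<close>
  obtain M T where MT: "psd M" "psd (mat 1 - M)" "psd T" "M ** T = mat 1"
    "psd (T ** ?\<Lambda> ** T - A)" "trace ((mat 1 - M) ** (T ** ?\<Lambda> ** T - A)) = 0"
    using exists_optimal_expansion[OF psdA psd\<Lambda> inv\<Lambda>] .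
  interpret D: degenerate_projection G ?\<Lambda> M T \<Sigma>\<^sub>\<mu>
    using GG psd\<Lambda> \<open>psd \<Sigma>\<^sub>\<mu>\<close> MT unfolding A_def by unfold_locales
  have S\<nu>: "\<Sigma>\<^sub>\<nu> = D.S\<nu>"
    unfolding \<open>\<Sigma>\<^sub>\<nu> = _\<close> D.S\<nu>_def diag_matrix_zero_pad[OF \<open>inj e\<close>] tG
    by (simp add: G_def matrix_mul_assoc)
  have "\<Gamma> = covariance_matrix (gaussian 0 (T ** ?\<Lambda> ** T))"
    using \<open>\<Gamma> = _\<close> J2_gaussian[OF psdA psd\<Lambda> MT] unfolding compress A_def by simp
  then have \<Gamma>: "\<Gamma> = D.\<Gamma>"
    using covariance_gaussian[OF D.psd_\<Gamma>] by (simp add: D.\<Gamma>_def)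
  have S\<^sub>s: "\<Sigma>\<^sub>s = D.S\<^sub>s"
  proof -
    \<comment> \<open>In the basis given by \<open>Q\<close>, passing from
      \<open>\<Sigma>\<^sub>\<mu>\<close> to \<open>D.S\<^sub>s\<close> adds the zero-padded block
      \<open>\<Gamma> - A\<close>, which matches the entrywise description of
      \<open>\<Sigma>\<^sub>s\<close>.\<close>
    have "transpose Q ** D.S\<^sub>s ** Q = transpose Q ** \<Sigma>\<^sub>\<mu> ** Q + transpose ?E ** (\<Gamma> - A) ** ?E"
      unfolding D.S\<^sub>s_def \<Gamma> A_def
      by (simp add: matrix_add_ldistrib matrix_add_rdistrib matrix_mul_assoc QtG)
        (simp add: GQ flip: matrix_mul_assoc)
    moreover have "(transpose Q ** \<Sigma>\<^sub>s ** Q) $ k $ l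
        = (transpose Q ** \<Sigma>\<^sub>\<mu> ** Q + transpose ?E ** (\<Gamma> - A) ** ?E) $ k $ l" for k l
    proof (cases "k \<in> range e \<and> l \<in> range e")
      case True
      then obtain i j where kl: "k = e i" "l = e j" by blast
      have "A $ i $ j = (transpose Q ** \<Sigma>\<^sub>\<mu> ** Q) $ k $ l"
        unfolding A_def compress[symmetric] by (simp add: submatrix_def kl)
      moreover have "\<Gamma> $ i $ j = (transpose Q ** \<Sigma>\<^sub>s ** Q) $ k $ l"
        using \<open>submatrix e e (transpose Q ** \<Sigma>\<^sub>s ** Q) = \<Gamma>\<close> by (auto simp: submatrix_def kl)
      ultimately show ?thesis
        using inv_f_f[OF \<open>inj e\<close>] by (simp add: coord_proj_sandwich[OF \<open>inj e\<close>] kl)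
    next
      case False
      then show ?thesis
        using assms(12)[of k l] by (auto simp: coord_proj_sandwich[OF \<open>inj e\<close>])
    qed
    ultimately have "transpose Q ** \<Sigma>\<^sub>s ** Q = transpose Q ** D.S\<^sub>s ** Q"
      by (simp add: vec_eq_iff)
    then have "Q ** (transpose Q ** \<Sigma>\<^sub>s ** Q) ** transpose Q = Q ** (transpose Q ** D.S\<^sub>s ** Q) ** transpose Q"
      by simp
    then show ?thesis by (simp add: matrix_mul_assoc QQ) (simp add: QQ flip: matrix_mul_assoc)
  qed
  have g: "g = (*v) G"
    using \<open>\<And>x. g x = _\<close> by (simp add: fun_eq_iff submatrix_eq_coord_proj coord_proj_id G_def)
  show ?thesis
    unfolding S\<nu> S\<^sub>s \<Gamma> g
    using D.projection_iff D.psd_S\<^sub>s D.projection_gaussian D.gaussian_projection_unique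
      D.trace_minimizer_iff[OF inv\<Lambda>] by blast
qed

end
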